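(* Consider the two-user MIMO broadcast channel with transmit correlation described in the context, under CSIR, and let $r_0=\dim\big(\mathrm{Span}(\mathbf U_1)\cap\mathrm{Span}(\mathbf U_2)\big)\ge 0$. Then the DoF pairs $(N_1^*,0)$, $(0,N_2^* )$, $\big((N_1^*-r_0)^+,N_2^*\big)$ and $\big(N_1^*,(N_2^*-r_0)^+\big)$ are achievable. Furthermore, if $N_1\le r_1$ and $N_2\le r_2$, the DoF pairs $$\Big(\min(N_1,r_1-r_0)+\min\big((N_1-r_1+r_0)^+,(N_2-r_2+r_0)^+\big),\ \min(N_2,r_2-r_0)\Big),$$ $$\Big(\min(N_1,r_1-r_0),\ \min(N_2,r_2-r_0)+\min\big((N_1-r_1+r_0)^+,(N_2-r_2+r_0)^+\big)\Big)$$ are also achievable. The convex hull of all these pairs and $(0,0)$ is contained in the DoF region.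
   Context: Model: a transmitter with $M$ antennas serves $K$ users; user $k$ has $N_k$ antennas. At each channel use user $k$ receives $\mathbf y_k=\mathbf H_k\mathbf x+\mathbf w_k$, where $\mathbf x\in\mathbb C^M$ is the transmitted vector, $\mathbf w_k$ has i.i.d. $\mathcal{CN}(0,1)$ entries (independent across time), and each codeword of length $J$ satisfies $\frac1J\sum_{j=1}^J\|\mathbf x(j)\|^2\le\rho$. The channel is $\mathbf H_k=\mathbf G_k\boldsymbol\Sigma_k^{1/2}\mathbf U_k^{H}$, where $\mathbf R_k=\frac1{N_k}\mathbb E[\mathbf H_k^H\mathbf H_k]=\mathbf U_k\boldsymbol\Sigma_k\mathbf U_k^H$ is the transmit correlation matrix, of rank $r_k$ and trace $M$, $\mathbf U_k\in\mathbb C^{M\times r_k}$ has orthonormal columns, $\boldsymbol\Sigma_k$ is an $r_k\times r_k$ diagonal matrix with positive diagonal, and $\mathbf G_k\in\mathbb C^{N_k\times r_k}$ is random with differential entropy $h(\mathbf G_k)>-\infty$ and $\mathbb E[\mathbf G_k^H\mathbf G_k]=N_k\mathbf I_{r_k}$. $\mathrm{Span}(\mathbf U_k)$ is called the eigenspace of user $k$. The channel statistics are known to the transmitter and to user $k$; the transmitter never knows channel realizations. CSIR means user $k$ knows the realization of $\mathbf H_k$. Users receive independent messages; a DoF tuple $(d_1,\dots,d_K)$ is achievable if there are rate tuples in the capacity region at every SNR $\rho$ with $d_k=\lim_{\rho\to\infty}R_k(\rho)/\log\rho$; the DoF region is the set of achievable DoF tuples. Notation: $N_k^*=\min(N_k,r_k)$,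 $(x)^+=\max(x,0)$. *)

theory Defs
  imports "HOL-Probability.Probability" "HOL-Library.Function_Algebras"
begin

definition cscale :: "complex \<Rightarrow> (nat \<Rightarrow> complex) \<Rightarrow> (nat \<Rightarrow> complex)" where
  "cscale c f = (\<lambda>i. c * f i)"

definition col :: "nat \<Rightarrow> (nat \<times> nat \<Rightarrow> complex) \<Rightarrow> nat \<Rightarrow> (nat \<Rightarrow> complex)" where
  "col M U a = (\<lambda>i. if i < M then U (i, a) else 0)"

definition eigenspace :: "nat \<Rightarrow> nat \<Rightarrow> (nat \<times> nat \<Rightarrow> complex) \<Rightarrow> (nat \<Rightarrow> complex) set" where
  "eigenspace M r U = module.span cscale (col M U ` {..<r})"

definition cdim :: "(nat \<Rightarrow> complex) set \<Rightarrow> nat" where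
  "cdim S = vector_space.dim cscale S"

definition Gspace :: "nat \<Rightarrow> nat \<Rightarrow> (nat \<times> nat \<Rightarrow> complex) measure" where
  "Gspace N r = PiM ({..<N} \<times> {..<r}) (\<lambda>_. (lborel :: complex measure))"

definition cn01 :: "complex measure" where
  "cn01 = density lborel (\<lambda>z. ennreal (exp (- ((cmod z) ^ 2)) / pi))"

definition noise_space :: "nat \<Rightarrow> (nat \<Rightarrow> complex) measure" where
  "noise_space N = PiM {..<N} (\<lambda>_. cn01)"

definition use_space :: "nat \<Rightarrow> nat \<Rightarrow> ((nat \<times> nat \<Rightarrow> complex) \<Rightarrow> real)
    \<Rightarrow> ((nat \<times> nat \<Rightarrow> complex) \<times> (nat \<Rightarrow> complex)) measure" where
  "use_space N r g = pair_measure (density (Gspace N r) (\<lambda>G. ennreal (g G))) (noise_space N)"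

definition block_space :: "nat \<Rightarrow> nat \<Rightarrow> nat \<Rightarrow> ((nat \<times> nat \<Rightarrow> complex) \<Rightarrow> real)
    \<Rightarrow> (nat \<Rightarrow> (nat \<times> nat \<Rightarrow> complex) \<times> (nat \<Rightarrow> complex)) measure" where
  "block_space J N r g = PiM {..<J} (\<lambda>_. use_space N r g)"

text \<open>H = G Sigma^(1/2) U^H (N x M), Sigma = diag(sigma).\<close>
definition chan_matrix :: "nat \<Rightarrow> nat \<Rightarrow> nat \<Rightarrow> (nat \<times> nat \<Rightarrow> complex) \<Rightarrow> (nat \<Rightarrow> real)
    \<Rightarrow> (nat \<times> nat \<Rightarrow> complex) \<Rightarrow> (nat \<times> nat \<Rightarrow> complex)" where
  "chan_matrix M N r U \<sigma> G = (\<lambda>(i, m). if i < N \<and> m < M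
      then (\<Sum>a<r. G (i, a) * complex_of_real (sqrt (\<sigma> a)) * cnj (U (m, a))) else 0)"

definition received :: "nat \<Rightarrow> nat \<Rightarrow> (nat \<times> nat \<Rightarrow> complex) \<Rightarrow> (nat \<Rightarrow> complex)
    \<Rightarrow> (nat \<Rightarrow> complex) \<Rightarrow> (nat \<Rightarrow> complex)" where
  "received M N H x w = (\<lambda>i. if i < N then (\<Sum>m<M. H (i, m) * x m) + w i else 0)"

text \<open>What a receiver with CSIR observes over the block: (H(j), y(j)) for j < J.\<close>
definition observation :: "nat \<Rightarrow> nat \<Rightarrow> nat \<Rightarrow> nat \<Rightarrow> (nat \<times> nat \<Rightarrow> complex) \<Rightarrow> (nat \<Rightarrow> real)
    \<Rightarrow> (nat \<Rightarrow> nat \<Rightarrow> complex) \<Rightarrow> (nat \<Rightarrow> (nat \<times> nat \<Rightarrow> complex) \<times> (nat \<Rightarrow> complex))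
    \<Rightarrow> (nat \<Rightarrow> (nat \<times> nat \<Rightarrow> complex) \<times> (nat \<Rightarrow> complex))" where
  "observation J M N r U \<sigma> xs \<omega> = (\<lambda>j. if j < J then
      (chan_matrix M N r U \<sigma> (fst (\<omega> j)),
       received M N (chan_matrix M N r U \<sigma> (fst (\<omega> j))) (xs j) (snd (\<omega> j)))
     else (\<lambda>_. 0, \<lambda>_. 0))"

definition corr_user :: "nat \<Rightarrow> nat \<Rightarrow> nat \<Rightarrow> (nat \<times> nat \<Rightarrow> complex) \<Rightarrow> (nat \<Rightarrow> real)
    \<Rightarrow> ((nat \<times> nat \<Rightarrow> complex) \<Rightarrow> real) \<Rightarrow> bool" where
  "corr_user M N r U \<sigma> g \<longleftrightarrow>
     N \<ge> 1 \<and>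
     (\<forall>a<r. \<forall>b<r. (\<Sum>i<M. cnj (U (i, a)) * U (i, b)) = (if a = b then 1 else 0)) \<and>
     (\<forall>a<r. \<sigma> a > 0) \<and> (\<Sum>a<r. \<sigma> a) = real M \<and>
     g \<in> borel_measurable (Gspace N r) \<and> (\<forall>G. g G \<ge> 0) \<and>
     (\<integral>\<^sup>+ G. ennreal (g G) \<partial>Gspace N r) = 1 \<and>
     \<comment> \<open>differential entropy h(G) = - int g ln g is > -infinity\<close>
     (\<integral>\<^sup>+ G. ennreal (max 0 (g G * ln (g G))) \<partial>Gspace N r) < \<infinity> \<and>
     \<comment> \<open>E[G^H G] = N I\<close>
     (\<forall>i<N. \<forall>a<r. integrable (Gspace N r) (\<lambda>G. g G * (cmod (G (i, a)))^2)) \<and>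
     (\<forall>a<r. \<forall>b<r. (\<integral>G. complex_of_real (g G) * (\<Sum>i<N. cnj (G (i, a)) * G (i, b)) \<partial>Gspace N r)
          = (if a = b then of_nat N else 0))"

definition msg :: "nat \<Rightarrow> nat \<times> nat \<Rightarrow> nat" where
  "msg k m = (if k = 1 then fst m else snd m)"

definition err_event
    :: "nat \<Rightarrow> nat \<Rightarrow> (nat \<Rightarrow> nat) \<Rightarrow> (nat \<Rightarrow> nat) \<Rightarrow> (nat \<Rightarrow> nat \<times> nat \<Rightarrow> complex)
    \<Rightarrow> (nat \<Rightarrow> nat \<Rightarrow> real) \<Rightarrow> (nat \<Rightarrow> (nat \<times> nat \<Rightarrow> complex) \<Rightarrow> real)
    \<Rightarrow> (nat \<times> nat \<Rightarrow> nat \<Rightarrow> nat \<Rightarrow> complex) \<Rightarrow> (nat \<Rightarrow> (nat \<Rightarrow> (nat \<times> nat \<Rightarrow> complex) \<times> (nat \<Rightarrow> complex)) \<Rightarrow> nat) \<Rightarrow> nat \<Rightarrow> nat \<times> nat \<Rightarrow> (nat \<Rightarrow> (nat \<times> nat \<Rightarrow> complex) \<times> (nat \<Rightarrow> complex)) set" where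
  "err_event J M N r U \<sigma> g enc dec k m =
     {\<omega> \<in> space (block_space J (N k) (r k) (g k)).
        dec k (observation J M (N k) (r k) (U k) (\<sigma> k) (enc m) \<omega>) \<noteq> msg k m}"

definition user_error
    :: "nat \<Rightarrow> nat \<Rightarrow> (nat \<Rightarrow> nat) \<Rightarrow> (nat \<Rightarrow> nat) \<Rightarrow> (nat \<Rightarrow> nat \<times> nat \<Rightarrow> complex)
    \<Rightarrow> (nat \<Rightarrow> nat \<Rightarrow> real) \<Rightarrow> (nat \<Rightarrow> (nat \<times> nat \<Rightarrow> complex) \<Rightarrow> real)
    \<Rightarrow> (nat \<Rightarrow> nat) \<Rightarrow> (nat \<times> nat \<Rightarrow> nat \<Rightarrow> nat \<Rightarrow> complex) \<Rightarrow> (nat \<Rightarrow> (nat \<Rightarrow> (nat \<times> nat \<Rightarrow> complex) \<times> (nat \<Rightarrow> complex)) \<Rightarrow> nat) \<Rightarrow> nat \<Rightarrow> real" where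
  "user_error J M N r U \<sigma> g L enc dec k =
     (\<Sum>m\<in>{..<L 1} \<times> {..<L 2}. measure (block_space J (N k) (r k) (g k))
          (err_event J M N r U \<sigma> g enc dec k m)) / (real (L 1) * real (L 2))"

text \<open>enc m j i = i-th entry of x(j) for message pair m; dec k = decoder of user k.\<close>
definition valid_code where
  "valid_code J M N r U \<sigma> g \<rho> L (enc :: nat \<times> nat \<Rightarrow> nat \<Rightarrow> nat \<Rightarrow> complex)
      (dec :: nat \<Rightarrow> (nat \<Rightarrow> (nat \<times> nat \<Rightarrow> complex) \<times> (nat \<Rightarrow> complex)) \<Rightarrow> nat) \<longleftrightarrow>
     J > 0 \<and> L 1 \<ge> 1 \<and> L 2 \<ge> 1 \<and>
     (\<forall>m\<in>{..<L 1} \<times> {..<L 2}. (\<Sum>j<J. \<Sum>i<M. (cmod (enc m j i))^2) / real J \<le> \<rho>) \<and>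
     (\<forall>k\<in>{1,2}. \<forall>m\<in>{..<L 1} \<times> {..<L 2}.
        err_event J M N r U \<sigma> g enc dec k m \<in> sets (block_space J (N k) (r k) (g k)))"

text \<open>Capacity region at SNR rho (closure of achievable rates; rates in nats).\<close>
definition cap_region :: "nat \<Rightarrow> (nat \<Rightarrow> nat) \<Rightarrow> (nat \<Rightarrow> nat) \<Rightarrow> (nat \<Rightarrow> nat \<times> nat \<Rightarrow> complex)
    \<Rightarrow> (nat \<Rightarrow> nat \<Rightarrow> real) \<Rightarrow> (nat \<Rightarrow> (nat \<times> nat \<Rightarrow> complex) \<Rightarrow> real) \<Rightarrow> real \<Rightarrow> (real \<times> real) set" where
  "cap_region M N r U \<sigma> g \<rho> = {(R1, R2). R1 \<ge> 0 \<and> R2 \<ge> 0 \<and>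
     (\<forall>\<epsilon>>0. \<exists>J0. \<forall>J\<ge>J0. \<exists>L enc dec. valid_code J M N r U \<sigma> g \<rho> L enc dec \<and>
        ln (real (L 1)) \<ge> real J * (R1 - \<epsilon>) \<and> ln (real (L 2)) \<ge> real J * (R2 - \<epsilon>) \<and>
        (\<forall>k\<in>{1,2}. user_error J M N r U \<sigma> g L enc dec k \<le> \<epsilon>))}"

definition dof_region :: "nat \<Rightarrow> (nat \<Rightarrow> nat) \<Rightarrow> (nat \<Rightarrow> nat) \<Rightarrow> (nat \<Rightarrow> nat \<times> nat \<Rightarrow> complex)
    \<Rightarrow> (nat \<Rightarrow> nat \<Rightarrow> real) \<Rightarrow> (nat \<Rightarrow> (nat \<times> nat \<Rightarrow> complex) \<Rightarrow> real) \<Rightarrow> (real \<times> real) set" where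
  "dof_region M N r U \<sigma> g = {(d1, d2). \<exists>R :: real \<Rightarrow> real \<times> real.
     (\<forall>\<rho>>0. R \<rho> \<in> cap_region M N r U \<sigma> g \<rho>) \<and>
     ((\<lambda>\<rho>. fst (R \<rho>) / ln \<rho>) \<longlongrightarrow> d1) at_top \<and>
     ((\<lambda>\<rho>. snd (R \<rho>) / ln \<rho>) \<longlongrightarrow> d2) at_top}"

end

theory Submission
  imports Defs "HOL-Real_Asymp.Real_Asymp" "Jordan_Normal_Form.Determinant"
begin

text \<open>
  Let $V_k$ be the eigenspace of user $k$. Extend a basis of $V_1 \cap V_2$ to bases of $V_1$ and of $V_2$;
  the vectors dual to the resulting basis of $V_1 + V_2$ serve as beams: a beam dual to a vector outside $V_k$
  is invisible to user $k$, and the visible beams have linearly independent images under $U_k^H$. Since the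
  law of $G_k$ has a density, $H_k$ is almost surely injective on the span of any $N_k$ visible beams.
  Every vertex of the hull is a number of private beams plus a number of common beams, all resolved
  by each user that has data.

  No mutual information is computed. Each beam carries uncoded QAM of size about $\rho / \log^2 \rho$ with
  amplitude about $\log \rho$; then the minimum distance detector fails with probability $p(\rho) \to 0$ in each
  channel use. At a fixed SNR an outer code with the Gilbert-Varshamov distance corrects the resulting
  symbol errors and costs only the fraction $2 p(\rho)$ of the rate plus $\log 2$. Time sharing
  is done on the level of the uncoded schemes, where the alphabet may change from one channel use to the next;
  hence Hamming distances are weighted by the logarithms of the alphabet sizes.
\<close>

section \<open>Codes with large weighted Hamming distance\<close>

text \<open>Nothing bounds the mass that the density of \<open>G\<close> puts near singular
  matrices, so p(\<rho>) tends to 0 at an unspecified speed, and at a fixed SNR a longer block does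
  not make it smaller. Reliability at fixed \<rho> therefore has to come from the outer code alone.
  Only p(\<rho>) tending to 0 is required for the degrees of freedom: correcting a fraction p of
  symbol errors takes relative distance 2p, hence a loss of 2p ln q = o(ln \<rho>) for an alphabet
  of size q. The ln 2 is the price of counting the possible error patterns by 2^J; it is a constant
  and disappears after division by ln \<rho>. A common beam still carries data of a single user; it
  is common in that both users receive it, so it occupies a dimension at both receivers. The failure
  bound depends on the amplitude and on the unit spacing of the constellation, not on its size; this
  is why the alphabet may grow with \<rho> while the failure probability vanishes.\<close>

definition wdist :: "nat \<Rightarrow> (nat \<Rightarrow> real) \<Rightarrow> (nat \<Rightarrow> nat) \<Rightarrow> (nat \<Rightarrow> nat) \<Rightarrow> real" where
  "wdist J w c c' = (\<Sum>j<J. if c j \<noteq> c' j then w j else 0)"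

lemma wdist_commute: "wdist J w c c' = wdist J w c' c"
  by (simp add: wdist_def eq_commute)

lemma wdist_triangle:
  assumes "\<And>j. j < J \<Longrightarrow> w j \<ge> 0"
  shows "wdist J w a c \<le> wdist J w a b + wdist J w b c"
  unfolding wdist_def sum.distrib[symmetric] using assms by (intro sum_mono) auto

text \<open>A word of the ball is determined by the set S of positions where it differs from
  \<open>c\<close> and by its letters there. For given S there are at most \<Prod>q_j such words,
  which is the exponential of the weight of S and so at most exp \<tau>; this is why logarithms of
  the alphabet sizes are the right weights. The factor 2^J counts the sets S.\<close>

lemma card_wdist_ball:
  fixes q :: "nat \<Rightarrow> nat"
  assumes q: "\<And>j. j < J \<Longrightarrow> q j \<ge> 1"
    and c: "c \<in> (\<Pi>\<^sub>E j\<in>{..<J}. {..<q j})"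
  shows "real (card {c' \<in> (\<Pi>\<^sub>E j\<in>{..<J}. {..<q j}). wdist J (\<lambda>j. ln (real (q j))) c c' \<le> \<tau>})
      \<le> 2 ^ J * exp \<tau>"
proof -
  let ?W = "\<Pi>\<^sub>E j\<in>{..<J}. {..<q j}" and ?w = "\<lambda>j. ln (real (q j))"
  let ?B = "{c' \<in> ?W. wdist J ?w c c' \<le> \<tau>}"
  define \<S> where "\<S> = {S. S \<subseteq> {..<J} \<and> (\<Sum>j\<in>S. ?w j) \<le> \<tau>}"
  have fin: "finite \<S>" unfolding \<S>_def by (rule finite_subset[of _ "Pow {..<J}"]) auto
  have card\<S>: "card \<S> \<le> 2 ^ J"
  proof -
    have "card \<S> \<le> card (Pow {..<J})" unfolding \<S>_def by (intro card_mono) auto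
    then show ?thesis by (simp add: card_Pow)
  qed
  have sub: "?B \<subseteq> (\<Union>S\<in>\<S>. (\<lambda>h. override_on c h S) ` (\<Pi>\<^sub>E j\<in>S. {..<q j}))"
  proof
    fix c' assume c': "c' \<in> ?B"
    define S where "S = {j\<in>{..<J}. c j \<noteq> c' j}"
    have "(\<Sum>j\<in>S. ?w j) = wdist J ?w c c'"
      unfolding wdist_def S_def by (subst sum.inter_filter) auto
    then have "S \<in> \<S>" using c' unfolding \<S>_def by (auto simp: S_def)
    moreover have "c' = override_on c (restrict c' S) S"
    proof
      fix j show "c' j = override_on c (restrict c' S) S j"
        using c c' by (cases "j < J") (auto simp: override_on_def S_def PiE_def extensional_def)
    qed
    moreover have "restrict c' S \<in> (\<Pi>\<^sub>E j\<in>S. {..<q j})"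
      using c' by (auto simp: S_def PiE_def)
    ultimately show "c' \<in> (\<Union>S\<in>\<S>. (\<lambda>h. override_on c h S) ` (\<Pi>\<^sub>E j\<in>S. {..<q j}))" by blast
  qed
  have finS: "finite (\<Pi>\<^sub>E j\<in>S. {..<q j})" if "S \<in> \<S>" for S
    using that finite_subset[of S "{..<J}"] by (intro finite_PiE) (auto simp: \<S>_def)
  have "real (card ?B) \<le> real (card (\<Union>S\<in>\<S>. (\<lambda>h. override_on c h S) ` (\<Pi>\<^sub>E j\<in>S. {..<q j})))"
    using fin finS by (intro of_nat_mono card_mono[OF _ sub]) auto
  also have "\<dots> \<le> (\<Sum>S\<in>\<S>. real (card ((\<lambda>h. override_on c h S) ` (\<Pi>\<^sub>E j\<in>S. {..<q j}))))"
    using card_UN_le[OF fin] by (simp flip: of_nat_sum)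
  also have "\<dots> \<le> (\<Sum>S\<in>\<S>. exp \<tau>)"
  proof (intro sum_mono)
    fix S assume S: "S \<in> \<S>"
    then have fS: "finite S" and SJ: "S \<subseteq> {..<J}"
      by (auto simp: \<S>_def intro: finite_subset)
    have "real (card ((\<lambda>h. override_on c h S) ` (\<Pi>\<^sub>E j\<in>S. {..<q j}))) \<le> (\<Prod>j\<in>S. real (q j))"
      using card_image_le[OF finS[OF S], of "\<lambda>h. override_on c h S"] fS
      by (simp add: card_PiE flip: of_nat_prod)
    also have "\<dots> = exp (\<Sum>j\<in>S. ?w j)"
      unfolding exp_sum[OF fS] using q SJ by (intro prod.cong) fastforce+
    also have "\<dots> \<le> exp \<tau>" using S by (simp add: \<S>_def)
    finally show "real (card ((\<lambda>h. override_on c h S) ` (\<Pi>\<^sub>E j\<in>S. {..<q j}))) \<le> exp \<tau>" .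
  qed
  also have "\<dots> \<le> 2 ^ J * exp \<tau>"
    using of_nat_mono[OF card\<S>, where 'a = real] by simp
  finally show ?thesis .
qed

text \<open>Gilbert-Varshamov: around a code of maximal cardinality the balls of radius \<tau> cover
  all words, since an uncovered word could be added. Comparing the number of words with the ball
  bound gives the size.\<close>

lemma separated_code_exists:
  fixes q :: "nat \<Rightarrow> nat"
  assumes q: "\<And>j. j < J \<Longrightarrow> q j \<ge> 1" and \<tau>: "\<tau> \<ge> 0"
  obtains C where "C \<subseteq> (\<Pi>\<^sub>E j\<in>{..<J}. {..<q j})" "finite C" "C \<noteq> {}"
    "\<And>c c'. c \<in> C \<Longrightarrow> c' \<in> C \<Longrightarrow> c \<noteq> c' \<Longrightarrow> wdist J (\<lambda>j. ln (real (q j))) c c' > \<tau>"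
    "ln (real (card C)) \<ge> (\<Sum>j<J. ln (real (q j))) - \<tau> - real J * ln 2"
proof -
  let ?W = "\<Pi>\<^sub>E j\<in>{..<J}. {..<q j}" and ?w = "\<lambda>j. ln (real (q j))"
  define sep where "sep C \<longleftrightarrow> C \<subseteq> ?W \<and> (\<forall>c\<in>C. \<forall>c'\<in>C. c \<noteq> c' \<longrightarrow> wdist J ?w c c' > \<tau>)" for C
  have finW: "finite ?W" by (intro finite_PiE) auto
  have "sep {}" by (simp add: sep_def)
  moreover have "\<forall>C. sep C \<longrightarrow> card C < Suc (card ?W)"
    using card_mono[OF finW] by (auto simp: sep_def less_Suc_eq_le)
  ultimately obtain C where C: "sep C" and max: "\<And>C'. sep C' \<Longrightarrow> card C' \<le> card C"
    using ex_has_greatest_nat[of sep "{}" card "Suc (card ?W)"] by auto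
  have finC: "finite C" using C finW unfolding sep_def by (auto intro: finite_subset)
  have cover: "?W \<subseteq> (\<Union>c\<in>C. {c' \<in> ?W. wdist J ?w c c' \<le> \<tau>})"
  proof
    fix x assume x: "x \<in> ?W"
    show "x \<in> (\<Union>c\<in>C. {c' \<in> ?W. wdist J ?w c c' \<le> \<tau>})"
    proof (rule ccontr)
      assume "\<not> ?thesis"
      then have far: "wdist J ?w c x > \<tau>" if "c \<in> C" for c using that x by force
      have "wdist J ?w x x = 0" by (simp add: wdist_def)
      \<comment> \<open>A word far from every codeword is at distance 0 from itself, so \<tau> \<ge>
        0 shows that adding it really enlarges the code.\<close>
      with far[of x] \<tau> have "x \<notin> C" by fastforce
      moreover have "sep (insert x C)"
        using C far x far[unfolded wdist_commute[of J ?w _ x]] by (auto simp: sep_def)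
      ultimately show False using max[of "insert x C"] finC by simp
    qed
  qed
  have "exp (\<Sum>j<J. ?w j) = real (card ?W)"
    unfolding card_PiE[OF finite_lessThan] exp_sum[OF finite_lessThan] of_nat_prod
    using q by (intro prod.cong) fastforce+
  also have "\<dots> \<le> real (\<Sum>c\<in>C. card {c' \<in> ?W. wdist J ?w c c' \<le> \<tau>})"
    using finC finW
    by (intro of_nat_mono order.trans[OF card_mono[OF _ cover]] card_UN_le finite_UN_I) auto
  also have "\<dots> \<le> (\<Sum>c\<in>C. 2 ^ J * exp \<tau>)"
    unfolding of_nat_sum using C q by (intro sum_mono card_wdist_ball) (auto simp: sep_def)
  finally have le: "exp (\<Sum>j<J. ?w j) \<le> real (card C) * (2 ^ J * exp \<tau>)" by simp
  have ne: "C \<noteq> {}"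
  proof
    assume "C = {}"
    with le have "exp (\<Sum>j<J. ?w j) \<le> 0" by simp
    then show False using exp_gt_zero[of "\<Sum>j<J. ?w j"] by linarith
  qed
  then have pos: "card C > 0" using finC by (simp add: card_gt_0_iff)
  have "(\<Sum>j<J. ?w j) \<le> ln (real (card C) * (2 ^ J * exp \<tau>))"
    using le pos by (subst ln_ge_iff) auto
  also have "\<dots> = ln (real (card C)) + (real J * ln 2 + \<tau>)"
    using pos by (simp add: ln_mult ln_realpow)
  finally show ?thesis
    using C finC ne by (intro that[of C]) (auto simp: sep_def)
qed

section \<open>Symbol errors over a block\<close>

text \<open>The error indicator of use j depends on coordinate j of the product only, so the
  weighted indicators are independent with values in [0, B], and Hoeffding's inequality applies. The
  events E j vary with j because both the scheme and the transmitted letter do.\<close>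

lemma PiM_weighted_error_tail:
  fixes P :: "'a measure" and E :: "nat \<Rightarrow> 'a set"
  assumes P: "prob_space P" and J: "J > 0" and B: "B > 0" and \<eta>: "\<eta> \<ge> 0"
    and E[measurable]: "\<And>j. j < J \<Longrightarrow> E j \<in> sets P"
    and p: "\<And>j. j < J \<Longrightarrow> measure P (E j) \<le> p"
    and w: "\<And>j. j < J \<Longrightarrow> 0 \<le> w j" "\<And>j. j < J \<Longrightarrow> w j \<le> B"
  shows "measure (PiM {..<J} (\<lambda>_. P)) {\<omega> \<in> space (PiM {..<J} (\<lambda>_. P)).
       (\<Sum>j<J. if \<omega> j \<in> E j then w j else 0) > p * (\<Sum>j<J. w j) + \<eta> * real J}
     \<le> exp (- 2 * \<eta>\<^sup>2 * real J / B\<^sup>2)"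
proof -
  let ?Q = "PiM {..<J} (\<lambda>_. P)"
  define X where "X j \<omega> = (if \<omega> j \<in> E j then w j else 0)" for j and \<omega> :: "nat \<Rightarrow> 'a"
  interpret Q: prob_space ?Q by (intro prob_space_PiM P)
  have comp: "distr ?Q P (\<lambda>\<omega>. \<omega> j) = P" if "j < J" for j
    using distr_PiM_component[of "{..<J}" "\<lambda>_. P" j] P that by simp
  \<comment> \<open>Independence of the coordinates is checked through the joint law: on the product
    space the restriction to \<open>{..<J}\<close> is the identity, so the joint law is the product
    of the marginals by construction.\<close>
  have indep0: "Q.indep_vars (\<lambda>_. P) (\<lambda>j \<omega>. \<omega> j) {..<J}"
  proof (subst Q.indep_vars_iff_distr_eq_PiM')
    have "distr ?Q ?Q (\<lambda>x. \<lambda>i\<in>{..<J}. x i) = distr ?Q ?Q (\<lambda>x. x)"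
      by (intro distr_cong) (auto simp: space_PiM PiE_def extensional_restrict)
    also have "\<dots> = PiM {..<J} (\<lambda>i. distr ?Q P (\<lambda>\<omega>. \<omega> i))"
      unfolding distr_id using comp by (intro PiM_cong) auto
    finally show "distr ?Q ?Q (\<lambda>x. \<lambda>i\<in>{..<J}. x i) = PiM {..<J} (\<lambda>i. distr ?Q P (\<lambda>\<omega>. \<omega> i))" .
  qed (use J in auto)
  have indep: "Q.indep_vars (\<lambda>_. borel) X {..<J}"
    unfolding X_def
    by (rule Q.indep_vars_compose2[OF indep0, of "\<lambda>j x. if x \<in> E j then w j else 0"]) measurable
  interpret H: Hoeffding_ineq ?Q "{..<J}" X "\<lambda>_. 0" "\<lambda>_. B" "\<Sum>i<J. Q.expectation (X i)"
    by unfold_locales (use indep w B in \<open>auto simp: X_def\<close>)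
  have ex: "Q.expectation (X j) \<le> w j * p" if j: "j < J" for j
  proof -
    have "Q.expectation (X j) = (\<integral>\<omega>. w j * indicator (E j) (\<omega> j) \<partial>?Q)"
      unfolding X_def by (intro Bochner_Integration.integral_cong) (auto simp: indicator_def)
    also have "\<dots> = (\<integral>x. w j * indicator (E j) x \<partial>distr ?Q P (\<lambda>\<omega>. \<omega> j))"
      using E[OF j] j by (subst integral_distr) auto
    also have "\<dots> = w j * measure P (E j)"
      using E[OF j] comp[OF j] prob_space.finite_measure[OF P] sets.sets_into_space[OF E[OF j]]
      by (simp add: Int_absorb2)
    also have "\<dots> \<le> w j * p" using p[OF j] w(1)[OF j] by (intro mult_left_mono)
    finally show ?thesis .
  qed
  have mean: "(\<Sum>j<J. Q.expectation (X j)) \<le> p * (\<Sum>j<J. w j)"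
    unfolding sum_distrib_left using ex by (intro sum_mono) (auto simp: mult.commute)
  have Xm[measurable]: "X j \<in> borel_measurable ?Q" if "j < J" for j
    using indep that unfolding Q.indep_vars_def by auto
  \<comment> \<open>The threshold in the claim uses an upper bound of the mean, so its event lies
    inside the one that Hoeffding's inequality bounds.\<close>
  have "measure ?Q {\<omega> \<in> space ?Q. (\<Sum>j<J. X j \<omega>) > p * (\<Sum>j<J. w j) + \<eta> * real J}
     \<le> measure ?Q {\<omega> \<in> space ?Q. (\<Sum>j<J. X j \<omega>) \<ge> (\<Sum>j<J. Q.expectation (X j)) + \<eta> * real J}"
    using mean by (intro Q.finite_measure_mono) auto
  also have "\<dots> \<le> exp (- 2 * (\<eta> * real J)\<^sup>2 / (\<Sum>i<J. (B - 0)\<^sup>2))"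
    using J B \<eta> by (intro H.Hoeffding_ineq_ge) auto
  also have "\<dots> = exp (- 2 * \<eta>\<^sup>2 * real J / B\<^sup>2)"
    using J B by (simp add: power2_eq_square field_simps)
  finally show ?thesis unfolding X_def .
qed

section \<open>Probability spaces of the noise and of one channel use\<close>

text \<open>The real and imaginary parts are independent real normals of variance 1/2, hence the
  \<open>1 / sqrt 2\<close>; the total mass is the product of two one-dimensional integrals.\<close>

lemma prob_space_cn01: "prob_space cn01"
proof -
  let ?f = "\<lambda>x::real. normal_density 0 (1 / sqrt 2) x"
  have eq: "exp (- ((cmod z) ^ 2)) / pi = (\<Prod>b\<in>Basis. ?f (z \<bullet> b))" for z
  proof -
    have n: "?f x = exp (- x\<^sup>2) / sqrt pi" for x
      by (simp add: normal_density_def power_divide)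
    have "(\<Prod>b\<in>Basis. ?f (z \<bullet> b)) = (exp (- (Re z)\<^sup>2) / sqrt pi) * (exp (- (Im z)\<^sup>2) / sqrt pi)"
      by (simp add: Basis_complex_def n complex_i_not_one inner_complex_def)
    also have "\<dots> = exp (- ((Re z)\<^sup>2 + (Im z)\<^sup>2)) / pi"
      by (simp add: exp_add[symmetric] real_sqrt_mult_self)
    finally show ?thesis by (simp add: cmod_def)
  qed
  have "(\<integral>\<^sup>+z. ennreal (exp (- ((cmod z) ^ 2)) / pi) \<partial>lborel)
      = (\<integral>\<^sup>+z. (\<Prod>b\<in>(Basis :: complex set). ennreal (?f (z \<bullet> b))) \<partial>lborel)"
    unfolding eq by (subst prod_ennreal) auto
  also have "\<dots> = (\<Prod>b\<in>(Basis :: complex set). \<integral>\<^sup>+x. ennreal (?f x) \<partial>lborel)"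
    by (subst nn_integral_lborel_prod) auto
  also have "(\<integral>\<^sup>+x. ennreal (?f x) \<partial>lborel) = 1"
    using prob_space.emeasure_space_1[OF prob_space_normal_density[of "1 / sqrt 2" 0]]
    by (simp add: emeasure_density)
  finally show ?thesis
    unfolding cn01_def by (intro prob_spaceI) (simp add: emeasure_density)
qed

lemma sets_cn01 [measurable_cong, simp]: "sets cn01 = sets borel"
  by (simp add: cn01_def)

lemma prob_space_noise_space: "prob_space (noise_space N)"
  unfolding noise_space_def by (intro prob_space_PiM prob_space_cn01)

lemma prob_space_use_space:
  assumes "corr_user M N r U \<sigma> g"
  shows "prob_space (use_space N r g)"
proof -
  have "prob_space (density (Gspace N r) (\<lambda>G. ennreal (g G)))"
    using assms by (intro prob_spaceI) (auto simp: corr_user_def emeasure_density cong: nn_integral_cong)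
  then show ?thesis unfolding use_space_def
    by (intro prob_space_pair prob_space_noise_space)
qed

lemma borel_measurable_use_space_snd:
  assumes "i < N"
  shows "(\<lambda>\<omega>. snd \<omega> i) \<in> borel_measurable (use_space N r g)"
proof -
  have "(\<lambda>w. w i) \<in> borel_measurable (noise_space N)"
    using measurable_component_singleton[of i "{..<N}" "\<lambda>_. cn01"] assms
    by (simp add: noise_space_def cong: measurable_cong_sets)
  then show ?thesis unfolding use_space_def by measurable
qed

lemma borel_measurable_use_space_fst:
  assumes "i < N" "a < r"
  shows "(\<lambda>\<omega>. fst \<omega> (i, a)) \<in> borel_measurable (use_space N r g)"
proof -
  have "(\<lambda>G. G (i, a)) \<in> borel_measurable (Gspace N r)"
    using measurable_component_singleton[of "(i, a)" "{..<N} \<times> {..<r}" "\<lambda>_. lborel :: complex measure"] assms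
    by (simp add: Gspace_def)
  then show ?thesis unfolding use_space_def by measurable
qed

section \<open>Coding over uncoded symbol schemes\<close>

text \<open>This is entry j of \<open>observation\<close>, so a detector for one use can be applied
  letter by letter to a whole block.\<close>

definition use_output :: "nat \<Rightarrow> nat \<Rightarrow> nat \<Rightarrow> (nat \<times> nat \<Rightarrow> complex) \<Rightarrow> (nat \<Rightarrow> real) \<Rightarrow> (nat \<Rightarrow> complex)
    \<Rightarrow> (nat \<times> nat \<Rightarrow> complex) \<times> (nat \<Rightarrow> complex) \<Rightarrow> (nat \<times> nat \<Rightarrow> complex) \<times> (nat \<Rightarrow> complex)" where
  "use_output M N r U \<sigma> x \<omega> =
     (chan_matrix M N r U \<sigma> (fst \<omega>), received M N (chan_matrix M N r U \<sigma> (fst \<omega>)) x (snd \<omega>))"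

text \<open>An uncoded scheme for one channel use: \<open>q k\<close> is the alphabet size of user
  k, \<open>f\<close> maps a pair of letters to a transmit vector and \<open>D k\<close> is the
  detector. Power and error are bounded for every pair of letters and not on average, because the
  words of an outer code need not use the letters uniformly.\<close>

definition symbol_scheme :: "nat \<Rightarrow> (nat \<Rightarrow> nat) \<Rightarrow> (nat \<Rightarrow> nat) \<Rightarrow> (nat \<Rightarrow> nat \<times> nat \<Rightarrow> complex)
    \<Rightarrow> (nat \<Rightarrow> nat \<Rightarrow> real) \<Rightarrow> (nat \<Rightarrow> (nat \<times> nat \<Rightarrow> complex) \<Rightarrow> real) \<Rightarrow> real \<Rightarrow> real
    \<Rightarrow> (nat \<Rightarrow> nat) \<Rightarrow> (nat \<times> nat \<Rightarrow> nat \<Rightarrow> complex)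
    \<Rightarrow> (nat \<Rightarrow> (nat \<times> nat \<Rightarrow> complex) \<times> (nat \<Rightarrow> complex) \<Rightarrow> nat) \<Rightarrow> bool" where
  "symbol_scheme M N r U \<sigma> g \<rho> p q f D \<longleftrightarrow>
     (\<forall>k\<in>{1,2}. q k \<ge> 1) \<and>
     (\<forall>s\<in>{..<q 1} \<times> {..<q 2}. (\<Sum>i<M. (cmod (f s i))\<^sup>2) \<le> \<rho>) \<and>
     (\<forall>k\<in>{1,2}. \<forall>s\<in>{..<q 1} \<times> {..<q 2}.
        (\<lambda>\<omega>. D k (use_output M (N k) (r k) (U k) (\<sigma> k) (f s) \<omega>))
           \<in> use_space (N k) (r k) (g k) \<rightarrow>\<^sub>M count_space UNIV \<and>
        measure (use_space (N k) (r k) (g k)) {\<omega> \<in> space (use_space (N k) (r k) (g k)).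
           D k (use_output M (N k) (r k) (U k) (\<sigma> k) (f s) \<omega>) \<noteq> msg k s} \<le> p)"

lemma symbol_schemeD:
  assumes S: "symbol_scheme M N r U \<sigma> g \<rho> p q f D"
  shows "k \<in> {1,2} \<Longrightarrow> q k \<ge> 1"
    and "s \<in> {..<q 1} \<times> {..<q 2} \<Longrightarrow> (\<Sum>i<M. (cmod (f s i))\<^sup>2) \<le> \<rho>"
    and "k \<in> {1,2} \<Longrightarrow> s \<in> {..<q 1} \<times> {..<q 2} \<Longrightarrow>
        (\<lambda>\<omega>. D k (use_output M (N k) (r k) (U k) (\<sigma> k) (f s) \<omega>))
           \<in> use_space (N k) (r k) (g k) \<rightarrow>\<^sub>M count_space UNIV"
    and "k \<in> {1,2} \<Longrightarrow> s \<in> {..<q 1} \<times> {..<q 2} \<Longrightarrow>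
        measure (use_space (N k) (r k) (g k)) {\<omega> \<in> space (use_space (N k) (r k) (g k)).
           D k (use_output M (N k) (r k) (U k) (\<sigma> k) (f s) \<omega>) \<noteq> msg k s} \<le> p"
proof -
  note S' = S[unfolded symbol_scheme_def]
  show "k \<in> {1,2} \<Longrightarrow> q k \<ge> 1" using S' by blast
  show "s \<in> {..<q 1} \<times> {..<q 2} \<Longrightarrow> (\<Sum>i<M. (cmod (f s i))\<^sup>2) \<le> \<rho>" using S' by blast
  note S'' = S'[THEN conjunct2, THEN conjunct2, THEN bspec, THEN bspec]
  show "k \<in> {1,2} \<Longrightarrow> s \<in> {..<q 1} \<times> {..<q 2} \<Longrightarrow>
        (\<lambda>\<omega>. D k (use_output M (N k) (r k) (U k) (\<sigma> k) (f s) \<omega>))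
           \<in> use_space (N k) (r k) (g k) \<rightarrow>\<^sub>M count_space UNIV"
    by (rule S''[THEN conjunct1])
  show "k \<in> {1,2} \<Longrightarrow> s \<in> {..<q 1} \<times> {..<q 2} \<Longrightarrow>
        measure (use_space (N k) (r k) (g k)) {\<omega> \<in> space (use_space (N k) (r k) (g k)).
           D k (use_output M (N k) (r k) (U k) (\<sigma> k) (f s) \<omega>) \<noteq> msg k s} \<le> p"
    by (rule S''[THEN conjunct2])
qed

lemma symbol_scheme_mono:
  "symbol_scheme M N r U \<sigma> g \<rho> p q f D \<Longrightarrow> p \<le> p' \<Longrightarrow> symbol_scheme M N r U \<sigma> g \<rho> p' q f D"
  unfolding symbol_scheme_def by (meson order.trans)

text \<open>By Hoeffding's inequality the weighted number of symbol errors exceeds its mean by a linear amount only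
  with exponentially small probability, so half the distance of the outer code has to be just above that mean.\<close>

lemma code_from_symbol_schemes:
  assumes P: "\<And>k. k \<in> {1,2} \<Longrightarrow> prob_space (use_space (N k) (r k) (g k))"
    and J: "J > 0" and B: "B > 0" and \<eta>: "\<eta> > 0"
    and S: "\<And>j. j < J \<Longrightarrow> symbol_scheme M N r U \<sigma> g \<rho> p (q j) (f j) (D j)"
    and qB: "\<And>j k. j < J \<Longrightarrow> k \<in> {1,2} \<Longrightarrow> ln (real (q j k)) \<le> B"
  obtains L enc dec where "valid_code J M N r U \<sigma> g \<rho> L enc dec"
    "\<And>k. k \<in> {1,2} \<Longrightarrow>
       ln (real (L k)) \<ge> (1 - 2 * p) * (\<Sum>j<J. ln (real (q j k))) - real J * (ln 2 + 2 * \<eta>)"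
    "\<And>k. k \<in> {1,2} \<Longrightarrow> user_error J M N r U \<sigma> g L enc dec k \<le> exp (- 2 * \<eta>\<^sup>2 * real J / B\<^sup>2)"
proof -
  define w where "w k j = ln (real (q j k))" for k j
  define T where "T k = p * (\<Sum>j<J. w k j) + \<eta> * real J" for k
  have q1: "q j k \<ge> 1" if "j < J" "k \<in> {1,2}" for j k
    using symbol_schemeD(1)[OF S[OF that(1)] that(2)] .
  have w0: "w k j \<ge> 0" if "j < J" "k \<in> {1,2}" for j k
    using q1[OF that] by (simp add: w_def)
  \<comment> \<open>The bound p dominates the probability of an error event for the letter pair (0,
    0), which exists because both alphabets are nonempty.\<close>
  have p0: "p \<ge> 0"
  proof -
    have "(0, 0) \<in> {..<q 0 1} \<times> {..<q 0 2}" using q1[OF J, of 1] q1[OF J, of 2] by auto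
    then show ?thesis using symbol_schemeD(4)[OF S[OF J], of 1] measure_nonneg order.trans by blast
  qed
  have T0: "T k \<ge> 0" if "k \<in> {1,2}" for k
    unfolding T_def using p0 \<eta> w0 that by (intro add_nonneg_nonneg mult_nonneg_nonneg sum_nonneg) auto
  have "\<exists>C. C \<subseteq> (\<Pi>\<^sub>E j\<in>{..<J}. {..<q j k}) \<and> finite C \<and> C \<noteq> {} \<and>
      (\<forall>c\<in>C. \<forall>c'\<in>C. c \<noteq> c' \<longrightarrow> wdist J (w k) c c' > 2 * T k) \<and>
      ln (real (card C)) \<ge> (\<Sum>j<J. w k j) - 2 * T k - real J * ln 2" if k: "k \<in> {1,2}" for k
    using separated_code_exists[of J "\<lambda>j. q j k" "2 * T k"] q1 k T0[OF k] unfolding w_def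
    by (metis mult_nonneg_nonneg zero_le_numeral)
  then obtain C where C: "\<And>k. k \<in> {1,2} \<Longrightarrow> C k \<subseteq> (\<Pi>\<^sub>E j\<in>{..<J}. {..<q j k}) \<and> finite (C k) \<and> C k \<noteq> {} \<and>
      (\<forall>c\<in>C k. \<forall>c'\<in>C k. c \<noteq> c' \<longrightarrow> wdist J (w k) c c' > 2 * T k) \<and>
      ln (real (card (C k))) \<ge> (\<Sum>j<J. w k j) - 2 * T k - real J * ln 2"
    by metis
  define L where "L k = card (C k)" for k
  have "\<exists>c. bij_betw c {..<L k} (C k)" if "k \<in> {1,2}" for k
    using ex_bij_betw_nat_finite[of "C k"] C[OF that] by (auto simp: L_def atLeast0LessThan)
  then obtain cw where cw: "\<And>k. k \<in> {1,2} \<Longrightarrow> bij_betw (cw k) {..<L k} (C k)"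
    by metis
  have cwC: "cw k m \<in> C k" if "k \<in> {1,2}" "m < L k" for k m
    using cw[OF that(1)] that(2) by (auto simp: bij_betw_def)
  have L1: "L k \<ge> 1" if "k \<in> {1,2}" for k
    using C[OF that] by (simp add: L_def Suc_le_eq card_gt_0_iff)
  define sym where "sym m j = (cw 1 (fst m) j, cw 2 (snd m) j)" for m :: "nat \<times> nat" and j
  define enc where "enc m j = f j (sym m j)" for m j
  \<comment> \<open>Bounded distance decoding with radius T k. Since codewords are more than 2 T k
    apart, at most one message qualifies; if none does, \<open>LEAST\<close> returns some value and
    the event is covered by the error bound.\<close>
  define dec where "dec k obs = (LEAST m. m < L k \<and> wdist J (w k) (cw k m) (\<lambda>j. D j k (obs j)) \<le> T k)"
    for k and obs :: "nat \<Rightarrow> (nat \<times> nat \<Rightarrow> complex) \<times> (nat \<Rightarrow> complex)"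
  let ?P = "\<lambda>k. use_space (N k) (r k) (g k)"
  let ?O = "\<lambda>k. use_output M (N k) (r k) (U k) (\<sigma> k)"
  have sym: "sym m j \<in> {..<q j 1} \<times> {..<q j 2}" if "m \<in> {..<L 1} \<times> {..<L 2}" "j < J" for m j
    using that cwC[of 1 "fst m"] cwC[of 2 "snd m"] C[of 1] C[of 2]
    by (auto simp: sym_def PiE_def Pi_def subset_iff)
  have msg_sym: "msg k (sym m j) = cw k (msg k m) j" if "k \<in> {1,2}" for k m j
    using that by (auto simp: msg_def sym_def)
  have msg_L: "msg k m < L k" if "k \<in> {1,2}" "m \<in> {..<L 1} \<times> {..<L 2}" for k m
    using that by (auto simp: msg_def)
  have meas: "(\<lambda>\<omega>. D j k (?O k (enc m j) \<omega>)) \<in> ?P k \<rightarrow>\<^sub>M count_space UNIV"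
    if "k \<in> {1,2}" "m \<in> {..<L 1} \<times> {..<L 2}" "j < J" for k m j
    unfolding enc_def by (rule symbol_schemeD(3)[OF S[OF that(3)] that(1) sym[OF that(2,3)]])
  have perr: "measure (?P k) {\<omega> \<in> space (?P k). D j k (?O k (enc m j) \<omega>) \<noteq> msg k (sym m j)} \<le> p"
    if "k \<in> {1,2}" "m \<in> {..<L 1} \<times> {..<L 2}" "j < J" for k m j
    unfolding enc_def by (rule symbol_schemeD(4)[OF S[OF that(3)] that(1) sym[OF that(2,3)]])
  have obs: "wdist J v c (\<lambda>j. D j k (observation J M (N k) (r k) (U k) (\<sigma> k) (enc m) \<omega> j))
      = wdist J v c (\<lambda>j. D j k (?O k (enc m j) (\<omega> j)))" for v c k m \<omega>
    unfolding wdist_def observation_def use_output_def by (intro sum.cong) auto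
  have dec_eq: "dec k (observation J M (N k) (r k) (U k) (\<sigma> k) (enc m) \<omega>)
      = (LEAST m'. m' < L k \<and> wdist J (w k) (cw k m') (\<lambda>j. D j k (?O k (enc m j) (\<omega> j))) \<le> T k)" for k m \<omega>
    unfolding dec_def obs ..
  have err_sets: "err_event J M N r U \<sigma> g enc dec k m \<in> sets (block_space J (N k) (r k) (g k))"
    if km: "k \<in> {1,2}" "m \<in> {..<L 1} \<times> {..<L 2}" for k m
  proof -
    have [measurable]: "(\<lambda>\<omega>. D j k (?O k (enc m j) (\<omega> j))) \<in> block_space J (N k) (r k) (g k) \<rightarrow>\<^sub>M count_space UNIV"
      if "j < J" for j
      unfolding block_space_def
      by (rule measurable_compose[OF measurable_component_singleton[of j "{..<J}" "\<lambda>_. ?P k"] meas[OF km that]])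
        (use that in auto)
    show ?thesis unfolding err_event_def dec_eq wdist_def by measurable
  qed
  have err: "measure (block_space J (N k) (r k) (g k)) (err_event J M N r U \<sigma> g enc dec k m)
       \<le> exp (- 2 * \<eta>\<^sup>2 * real J / B\<^sup>2)"
    if km: "k \<in> {1,2}" "m \<in> {..<L 1} \<times> {..<L 2}" for k m
  proof -
    define E where "E j = {\<omega> \<in> space (?P k). D j k (?O k (enc m j) \<omega>) \<noteq> msg k (sym m j)}" for j
    have Es: "E j \<in> sets (?P k)" if "j < J" for j
      using meas[OF km that] unfolding E_def by measurable
    let ?Q = "PiM {..<J} (\<lambda>_. ?P k)"
    interpret Q: prob_space ?Q by (intro prob_space_PiM P km)
    let ?bad = "{\<omega> \<in> space ?Q. (\<Sum>j<J. if \<omega> j \<in> E j then w k j else 0) > p * (\<Sum>j<J. w k j) + \<eta> * real J}"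
    \<comment> \<open>The distance from the true codeword to the detected word is the weighted
      number of symbol errors. While it is at most T k, the triangle inequality excludes every other
      codeword, so a decoding error forces this number above T k.\<close>
    have sub: "err_event J M N r U \<sigma> g enc dec k m \<subseteq> ?bad"
    proof
      fix \<omega> assume \<omega>: "\<omega> \<in> err_event J M N r U \<sigma> g enc dec k m"
      then have sp: "\<omega> \<in> space ?Q" by (simp add: err_event_def block_space_def)
      let ?h = "\<lambda>j. D j k (?O k (enc m j) (\<omega> j))"
      have wd: "wdist J (w k) (cw k (msg k m)) ?h = (\<Sum>j<J. if \<omega> j \<in> E j then w k j else 0)"
        unfolding wdist_def using sp km
        by (intro sum.cong) (auto simp: E_def space_PiM PiE_def Pi_def msg_sym)
      have "\<not> wdist J (w k) (cw k (msg k m)) ?h \<le> T k"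
      proof
        assume le: "wdist J (w k) (cw k (msg k m)) ?h \<le> T k"
        have "(LEAST m'. m' < L k \<and> wdist J (w k) (cw k m') ?h \<le> T k) = msg k m"
        proof (rule Least_equality)
          fix m' assume m': "m' < L k \<and> wdist J (w k) (cw k m') ?h \<le> T k"
          have "wdist J (w k) (cw k m') (cw k (msg k m)) \<le> wdist J (w k) (cw k m') ?h + wdist J (w k) ?h (cw k (msg k m))"
            using w0 km by (intro wdist_triangle) auto
          also have "\<dots> \<le> 2 * T k" using le m' by (simp add: wdist_commute[of _ _ ?h])
          finally have "cw k m' = cw k (msg k m)"
            using C[OF km(1)] cwC[OF km(1)] m' msg_L[OF km] by (meson not_le)
          then have "m' = msg k m"
            using cw[OF km(1)] m' msg_L[OF km] by (auto simp: bij_betw_def inj_on_def)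
          then show "msg k m \<le> m'" by simp
        qed (use le msg_L[OF km] in simp)
        with \<omega> show False by (simp add: err_event_def dec_eq)
      qed
      with wd sp show "\<omega> \<in> ?bad" by (simp add: T_def)
    qed
    have bad_sets: "?bad \<in> sets ?Q"
    proof -
      have [measurable]: "(\<lambda>\<omega>. if \<omega> j \<in> E j then w k j else 0) \<in> borel_measurable ?Q" if "j < J" for j
        by (rule measurable_compose[OF measurable_component_singleton[of j "{..<J}" "\<lambda>_. ?P k"]]) (use that Es[OF that] in \<open>auto intro!: measurable_If_set\<close>)
      show ?thesis by measurable
    qed
    have "measure ?Q (err_event J M N r U \<sigma> g enc dec k m) \<le> measure ?Q ?bad"
      using sub bad_sets by (intro Q.finite_measure_mono) auto
    also have "\<dots> \<le> exp (- 2 * \<eta>\<^sup>2 * real J / B\<^sup>2)"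
      using PiM_weighted_error_tail[OF P[OF km(1)] J B, of \<eta> E p "w k"] \<eta> Es perr[OF km] w0 qB km
      by (simp add: E_def w_def)
    finally show ?thesis by (simp add: block_space_def)
  qed
  show ?thesis
  proof (rule that[of L enc dec])
    show "valid_code J M N r U \<sigma> g \<rho> L enc dec"
      unfolding valid_code_def
    proof (intro conjI ballI)
      fix m assume m: "m \<in> {..<L 1} \<times> {..<L 2}"
      have "(\<Sum>i<M. (cmod (enc m j i))\<^sup>2) \<le> \<rho>" if "j < J" for j
        unfolding enc_def by (rule symbol_schemeD(2)[OF S[OF that] sym[OF m that]])
      then have "(\<Sum>j<J. \<Sum>i<M. (cmod (enc m j i))\<^sup>2) \<le> (\<Sum>j<J. \<rho>)" by (intro sum_mono) auto
      then show "(\<Sum>j<J. \<Sum>i<M. (cmod (enc m j i))\<^sup>2) / real J \<le> \<rho>"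
        using J by (simp add: field_simps)
    qed (use J L1 err_sets in auto)
    show "ln (real (L k)) \<ge> (1 - 2 * p) * (\<Sum>j<J. ln (real (q j k))) - real J * (ln 2 + 2 * \<eta>)"
      if "k \<in> {1,2}" for k
      using C[OF that] by (simp add: L_def T_def w_def algebra_simps)
    show "user_error J M N r U \<sigma> g L enc dec k \<le> exp (- 2 * \<eta>\<^sup>2 * real J / B\<^sup>2)"
      if k: "k \<in> {1,2}" for k
    proof -
      have "(\<Sum>m\<in>{..<L 1} \<times> {..<L 2}. measure (block_space J (N k) (r k) (g k))
          (err_event J M N r U \<sigma> g enc dec k m)) \<le> (\<Sum>m\<in>{..<L 1} \<times> {..<L 2}. exp (- 2 * \<eta>\<^sup>2 * real J / B\<^sup>2))"
        by (intro sum_mono err k)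
      also have "\<dots> = real (L 1) * real (L 2) * exp (- 2 * \<eta>\<^sup>2 * real J / B\<^sup>2)"
        by (simp add: card_cartesian_product)
      finally show ?thesis
        unfolding user_error_def using L1[of 1] L1[of 2]
        by (simp add: divide_le_eq mult.commute)
    qed
  qed
qed

section \<open>Time sharing between symbol schemes\<close>

text \<open>The scheme may change from one use to the next; \<open>c1\<close> and \<open>c2\<close>
  bound from below the total logarithmic alphabet sizes, that is, the rates before outer coding.
  \<open>B\<close> is recorded because Hoeffding's exponent needs a bound on the weights that does
  not grow with J.\<close>

definition scheme_block :: "nat \<Rightarrow> (nat \<Rightarrow> nat) \<Rightarrow> (nat \<Rightarrow> nat) \<Rightarrow> (nat \<Rightarrow> nat \<times> nat \<Rightarrow> complex)
    \<Rightarrow> (nat \<Rightarrow> nat \<Rightarrow> real) \<Rightarrow> (nat \<Rightarrow> (nat \<times> nat \<Rightarrow> complex) \<Rightarrow> real)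
    \<Rightarrow> real \<Rightarrow> real \<Rightarrow> real \<Rightarrow> nat \<Rightarrow> real \<Rightarrow> real \<Rightarrow> bool" where
  "scheme_block M N r U \<sigma> g \<rho> p B J c1 c2 \<longleftrightarrow> (\<exists>q f D.
     (\<forall>j<J. symbol_scheme M N r U \<sigma> g \<rho> p (q j) (f j) (D j) \<and> (\<forall>k\<in>{1,2}. ln (real (q j k)) \<le> B)) \<and>
     c1 \<le> (\<Sum>j<J. ln (real (q j 1))) \<and> c2 \<le> (\<Sum>j<J. ln (real (q j 2))))"

lemma scheme_block_mono:
  assumes "scheme_block M N r U \<sigma> g \<rho> p B J c1 c2" "p \<le> p'" "B \<le> B'" "c1' \<le> c1" "c2' \<le> c2"
  shows "scheme_block M N r U \<sigma> g \<rho> p' B' J c1' c2'"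
proof -
  obtain q f D where q:
     "\<And>j. j < J \<Longrightarrow> symbol_scheme M N r U \<sigma> g \<rho> p (q j) (f j) (D j) \<and> (\<forall>k\<in>{1,2}. ln (real (q j k)) \<le> B)"
     "c1 \<le> (\<Sum>j<J. ln (real (q j 1)))" "c2 \<le> (\<Sum>j<J. ln (real (q j 2)))"
    using assms(1) unfolding scheme_block_def by auto
  show ?thesis unfolding scheme_block_def
  proof (intro exI conjI allI impI)
    show "symbol_scheme M N r U \<sigma> g \<rho> p' (q j) (f j) (D j)" if "j < J" for j
      using q(1)[OF that] symbol_scheme_mono assms(2) by blast
    show "\<forall>k\<in>{1,2}. ln (real (q j k)) \<le> B'" if "j < J" for j
      using q(1)[OF that] assms(3) by force
  qed (use q assms in auto)
qed

lemma scheme_block_append: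
  assumes "scheme_block M N r U \<sigma> g \<rho> p B m c1 c2" "scheme_block M N r U \<sigma> g \<rho> p B n c1' c2'"
  shows "scheme_block M N r U \<sigma> g \<rho> p B (m + n) (c1 + c1') (c2 + c2')"
proof -
  obtain q f D where q:
     "\<And>j. j < m \<Longrightarrow> symbol_scheme M N r U \<sigma> g \<rho> p (q j) (f j) (D j) \<and> (\<forall>k\<in>{1,2}. ln (real (q j k)) \<le> B)"
     "c1 \<le> (\<Sum>j<m. ln (real (q j 1)))" "c2 \<le> (\<Sum>j<m. ln (real (q j 2)))"
    using assms(1) unfolding scheme_block_def by auto
  obtain q' f' D' where q':
     "\<And>j. j < n \<Longrightarrow> symbol_scheme M N r U \<sigma> g \<rho> p (q' j) (f' j) (D' j) \<and> (\<forall>k\<in>{1,2}. ln (real (q' j k)) \<le> B)"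
     "c1' \<le> (\<Sum>j<n. ln (real (q' j 1)))" "c2' \<le> (\<Sum>j<n. ln (real (q' j 2)))"
    using assms(2) unfolding scheme_block_def by auto
  define q'' where "q'' j = (if j < m then q j else q' (j - m))" for j
  define f'' where "f'' j = (if j < m then f j else f' (j - m))" for j
  define D'' where "D'' j = (if j < m then D j else D' (j - m))" for j
  have sum: "(\<Sum>j<m+n. ln (real (q'' j k))) = (\<Sum>j<m. ln (real (q j k))) + (\<Sum>j<n. ln (real (q' j k)))" for k
  proof -
    have "(\<Sum>j<m+n. ln (real (q'' j k))) = (\<Sum>j<m. ln (real (q'' j k))) + (\<Sum>j<n. ln (real (q'' (m + j) k)))"
      by (induction n) simp_all
    then show ?thesis by (simp add: q''_def)
  qed
  have "symbol_scheme M N r U \<sigma> g \<rho> p (q'' j) (f'' j) (D'' j) \<and> (\<forall>k\<in>{1,2}. ln (real (q'' j k)) \<le> B)"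
    if "j < m + n" for j
    using q(1)[of j] q'(1)[of "j - m"] that
    by (cases "j < m") (simp_all add: q''_def f''_def D''_def)
  then show ?thesis unfolding scheme_block_def
    using q(2,3) q'(2,3) sum by (intro exI[of _ q''] exI[of _ f''] exI[of _ D'']) (auto intro: add_mono)
qed

text \<open>\<open>B\<close> is chosen before \<epsilon> and J; only then does the error bound of
  the outer code decay exponentially in J. The slack \<epsilon> is there for the rounding of time
  shares to whole channel uses.\<close>

definition scheme_rates :: "nat \<Rightarrow> (nat \<Rightarrow> nat) \<Rightarrow> (nat \<Rightarrow> nat) \<Rightarrow> (nat \<Rightarrow> nat \<times> nat \<Rightarrow> complex)
    \<Rightarrow> (nat \<Rightarrow> nat \<Rightarrow> real) \<Rightarrow> (nat \<Rightarrow> (nat \<times> nat \<Rightarrow> complex) \<Rightarrow> real) \<Rightarrow> real \<Rightarrow> real \<Rightarrow> (real \<times> real) set" where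
  "scheme_rates M N r U \<sigma> g \<rho> p = {(a1, a2). 0 \<le> a1 \<and> 0 \<le> a2 \<and>
     (\<exists>B>0. \<forall>\<epsilon>>0. \<exists>J0. \<forall>J\<ge>J0.
        scheme_block M N r U \<sigma> g \<rho> p B J (real J * (a1 - \<epsilon>)) (real J * (a2 - \<epsilon>)))}"

lemma scheme_rates_single:
  assumes S: "symbol_scheme M N r U \<sigma> g \<rho> p q f D"
  shows "(ln (real (q 1)), ln (real (q 2))) \<in> scheme_rates M N r U \<sigma> g \<rho> p"
proof -
  let ?B = "1 + ln (real (q 1)) + ln (real (q 2))"
  have nn: "0 \<le> ln (real (q 1))" "0 \<le> ln (real (q 2))"
    using symbol_schemeD(1)[OF S, of 1] symbol_schemeD(1)[OF S, of 2] by auto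
  have "scheme_block M N r U \<sigma> g \<rho> p ?B J (real J * (ln (real (q 1)) - \<epsilon>)) (real J * (ln (real (q 2)) - \<epsilon>))"
    if "\<epsilon> > 0" for J \<epsilon>
    unfolding scheme_block_def using S nn that
    by (intro conjI allI impI exI[of _ "\<lambda>_. q"] exI[of _ "\<lambda>_. f"] exI[of _ "\<lambda>_. D"])
       (auto intro: mult_left_mono)
  moreover have "?B > 0" using nn by simp
  ultimately show ?thesis unfolding scheme_rates_def using nn by blast
qed

lemma scheme_rates_mono:
  assumes "p \<le> p'" shows "scheme_rates M N r U \<sigma> g \<rho> p \<subseteq> scheme_rates M N r U \<sigma> g \<rho> p'"
proof (rule subsetI)
  fix x assume "x \<in> scheme_rates M N r U \<sigma> g \<rho> p"
  then obtain B where "0 \<le> fst x" "0 \<le> snd x" and B: "B > 0" and "\<And>\<epsilon>. \<epsilon> > 0 \<Longrightarrow> \<exists>J0. \<forall>J\<ge>J0.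
        scheme_block M N r U \<sigma> g \<rho> p B J (real J * (fst x - \<epsilon>)) (real J * (snd x - \<epsilon>))"
    unfolding scheme_rates_def by (cases x) auto
  moreover have "scheme_block M N r U \<sigma> g \<rho> p' B J c c'" if "scheme_block M N r U \<sigma> g \<rho> p B J c c'" for J c c'
    using scheme_block_mono[OF that assms] by simp
  ultimately have "0 \<le> fst x" "0 \<le> snd x" "\<forall>\<epsilon>>0. \<exists>J0. \<forall>J\<ge>J0.
        scheme_block M N r U \<sigma> g \<rho> p' B J (real J * (fst x - \<epsilon>)) (real J * (snd x - \<epsilon>))"
    by meson+
  with B show "x \<in> scheme_rates M N r U \<sigma> g \<rho> p'"
    unfolding scheme_rates_def by (cases x) auto
qed

text \<open>Time sharing: the first \<open>\<lfloor>u J\<rfloor>\<close> channel uses run one sequence of schemes, the remaining ones the other.\<close>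

lemma convex_scheme_rates: "convex (scheme_rates M N r U \<sigma> g \<rho> p)"
proof (rule convexI)
  fix x y :: "real \<times> real" and u v :: real
  assume x: "x \<in> scheme_rates M N r U \<sigma> g \<rho> p" and y: "y \<in> scheme_rates M N r U \<sigma> g \<rho> p"
    and uv0: "0 \<le> u" "0 \<le> v" and uv: "u + v = 1"
  show "u *\<^sub>R x + v *\<^sub>R y \<in> scheme_rates M N r U \<sigma> g \<rho> p"
  \<comment> \<open>The end points are treated apart because the block length below is obtained by
    dividing by u and v.\<close>
  proof (cases "u = 0 \<or> v = 0")
    case True
    with uv x y show ?thesis by auto
  next
    case False
    with uv0 have u: "u > 0" and v: "v > 0" by auto
    obtain a1 a2 where xa: "x = (a1, a2)" by force
    obtain b1 b2 where yb: "y = (b1, b2)" by force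
    from x obtain B where a0: "0 \<le> a1" "0 \<le> a2" and B: "B > 0"
      and X: "\<And>\<epsilon>. \<epsilon> > 0 \<Longrightarrow> \<exists>J0. \<forall>J\<ge>J0.
        scheme_block M N r U \<sigma> g \<rho> p B J (real J * (a1 - \<epsilon>)) (real J * (a2 - \<epsilon>))"
      unfolding xa scheme_rates_def by auto
    from y obtain B' where b0: "0 \<le> b1" "0 \<le> b2" and B': "B' > 0"
      and Y: "\<And>\<epsilon>. \<epsilon> > 0 \<Longrightarrow> \<exists>J0. \<forall>J\<ge>J0.
        scheme_block M N r U \<sigma> g \<rho> p B' J (real J * (b1 - \<epsilon>)) (real J * (b2 - \<epsilon>))"
      unfolding yb scheme_rates_def by auto
    have "\<exists>J0. \<forall>J\<ge>J0. scheme_block M N r U \<sigma> g \<rho> p (max B B') J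
        (real J * (u * a1 + v * b1 - \<epsilon>)) (real J * (u * a2 + v * b2 - \<epsilon>))" if \<epsilon>: "\<epsilon> > 0" for \<epsilon>
    proof -
      from \<epsilon> have \<epsilon>2: "\<epsilon> / 2 > 0" by simp
      obtain Ja where Ja: "\<And>J. J \<ge> Ja \<Longrightarrow>
          scheme_block M N r U \<sigma> g \<rho> p B J (real J * (a1 - \<epsilon> / 2)) (real J * (a2 - \<epsilon> / 2))"
        using X[OF \<epsilon>2] by blast
      obtain Jb where Jb: "\<And>J. J \<ge> Jb \<Longrightarrow>
          scheme_block M N r U \<sigma> g \<rho> p B' J (real J * (b1 - \<epsilon> / 2)) (real J * (b2 - \<epsilon> / 2))"
        using Y[OF \<epsilon>2] by blast
      \<comment> \<open>The first two terms make both parts of the block long enough, with the +1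
        paying for the floor. The last two make the single use lost by rounding, worth at most a1 or
        a2, fit into J \<epsilon> / 2, the half of the slack that the parts leave over.\<close>
      obtain J0 :: nat where J0: "real J0 \<ge> max (max ((real Ja + 1) / u) (real Jb / v)) (max (2 * a1 / \<epsilon>) (2 * a2 / \<epsilon>))"
        using real_arch_simple by blast
      have "scheme_block M N r U \<sigma> g \<rho> p (max B B') J
        (real J * (u * a1 + v * b1 - \<epsilon>)) (real J * (u * a2 + v * b2 - \<epsilon>))" if "J \<ge> J0" for J
      proof -
        have "real J \<ge> real J0" using that by simp
        then have J: "real J \<ge> (real Ja + 1) / u" "real J \<ge> real Jb / v"
          "real J \<ge> 2 * a1 / \<epsilon>" "real J \<ge> 2 * a2 / \<epsilon>"
          using J0 by auto
        have J': "u * real J \<ge> real Ja + 1" "v * real J \<ge> real Jb"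
          "real J * \<epsilon> / 2 \<ge> a1" "real J * \<epsilon> / 2 \<ge> a2"
          using J u v \<epsilon> by (simp_all add: field_simps)
        define m where "m = nat \<lfloor>u * real J\<rfloor>"
        have "\<lfloor>u * real J\<rfloor> \<ge> 0" using u by simp
        then have m: "real m \<le> u * real J" "u * real J < real m + 1"
          unfolding m_def by linarith+
        have "u * real J \<le> 1 * real J" using uv v by (intro mult_right_mono) auto
        with m have mJ: "m \<le> J" by linarith
        define n where "n = J - m"
        have Jmn: "J = m + n" using mJ by (simp add: n_def)
        have "v * real J = real J - u * real J" using uv by (simp add: algebra_simps flip: distrib_right)
        then have n: "real n \<ge> v * real J" using m mJ by (simp add: n_def of_nat_diff)
        have bound: "real m * (a - \<epsilon> / 2) + real n * (b - \<epsilon> / 2) \<ge> real J * (u * a + v * b - \<epsilon>)"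
          if "0 \<le> a" "0 \<le> b" "real J * \<epsilon> / 2 \<ge> a" for a b
        proof -
          have "real m * a \<ge> (u * real J - 1) * a" using m that by (intro mult_right_mono) auto
          moreover have "real n * b \<ge> (v * real J) * b" using n that by (intro mult_right_mono) auto
          moreover have "real m * (a - \<epsilon> / 2) + real n * (b - \<epsilon> / 2) = real m * a + real n * b - real J * \<epsilon> / 2"
            by (simp add: Jmn algebra_simps)
          ultimately show ?thesis using that by (simp add: algebra_simps)
        qed
        have "scheme_block M N r U \<sigma> g \<rho> p (max B B') m (real m * (a1 - \<epsilon> / 2)) (real m * (a2 - \<epsilon> / 2))"
          using m J' by (intro scheme_block_mono[OF Ja]) auto
        moreover have "scheme_block M N r U \<sigma> g \<rho> p (max B B') n (real n * (b1 - \<epsilon> / 2)) (real n * (b2 - \<epsilon> / 2))"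
          using n J' by (intro scheme_block_mono[OF Jb]) auto
        ultimately have "scheme_block M N r U \<sigma> g \<rho> p (max B B') J
            (real m * (a1 - \<epsilon> / 2) + real n * (b1 - \<epsilon> / 2)) (real m * (a2 - \<epsilon> / 2) + real n * (b2 - \<epsilon> / 2))"
          unfolding Jmn by (rule scheme_block_append)
        then show ?thesis
          by (rule scheme_block_mono[OF _ order.refl order.refl bound[OF a0(1) b0(1) J'(3)] bound[OF a0(2) b0(2) J'(4)]])
      qed
      then show ?thesis by blast
    qed
    moreover have "max B B' > 0" using B by simp
    moreover have "0 \<le> u * a1 + v * b1" "0 \<le> u * a2 + v * b2" using a0 b0 u v by auto
    ultimately show ?thesis unfolding xa yb scheme_rates_def by auto
  qed
qed

section \<open>From symbol schemes to the capacity region\<close>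

text \<open>The code with a single message pair. \<open>dof_region\<close> asks for a rate pair at
  every positive SNR, whereas useful schemes exist only at high SNR; this pair fills the
  gap.\<close>

lemma cap_region_zero:
  assumes "\<rho> \<ge> 0"
  shows "(0, 0) \<in> cap_region M N r U \<sigma> g \<rho>"
proof -
  have "valid_code J M N r U \<sigma> g \<rho> (\<lambda>_. 1) (\<lambda>_ _ _. 0) (\<lambda>_ _. 0)" if "J \<ge> 1" for J
    using that assms by (auto simp: valid_code_def err_event_def msg_def)
  moreover have "user_error J M N r U \<sigma> g (\<lambda>_. 1) (\<lambda>_ _ _. 0) (\<lambda>_ _. 0) k = 0" for J k
    by (auto simp: user_error_def err_event_def msg_def intro!: sum.neutral)
  moreover have "ln (real 1) \<ge> real J * (0 - \<epsilon>)" if "\<epsilon> > 0" for J :: nat and \<epsilon> :: real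
    using that by simp
  ultimately have "\<exists>J0. \<forall>J\<ge>J0. \<exists>L enc dec. valid_code J M N r U \<sigma> g \<rho> L enc dec \<and>
        ln (real (L 1)) \<ge> real J * (0 - \<epsilon>) \<and> ln (real (L 2)) \<ge> real J * (0 - \<epsilon>) \<and>
        (\<forall>k\<in>{1,2}. user_error J M N r U \<sigma> g L enc dec k \<le> \<epsilon>)" if "\<epsilon> > 0" for \<epsilon>
    using that
    by (intro exI[of _ 1] allI impI exI[of _ "\<lambda>_. 1"] exI[of _ "\<lambda>_ _ _. 0"] exI[of _ "\<lambda>_ _. 0"] conjI ballI) auto
  then show ?thesis unfolding cap_region_def by simp
qed

text \<open>The factor 1 - 2p is the cost of the distance of the outer code, ln 2 that of the
  Gilbert-Varshamov count. The maximum with 0 is taken because at small rates these costs may exceed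
  what is available; a code always has logarithmic size at least 0.\<close>

lemma scheme_rates_cap_region:
  assumes P: "\<And>k. k \<in> {1,2} \<Longrightarrow> prob_space (use_space (N k) (r k) (g k))"
    and p: "0 \<le> p" "p \<le> 1 / 2" and a: "(a1, a2) \<in> scheme_rates M N r U \<sigma> g \<rho> p"
  shows "(max 0 ((1 - 2 * p) * a1 - ln 2), max 0 ((1 - 2 * p) * a2 - ln 2)) \<in> cap_region M N r U \<sigma> g \<rho>"
proof -
  from a obtain B where B: "B > 0" and A: "\<And>\<epsilon>. \<epsilon> > 0 \<Longrightarrow> \<exists>J0. \<forall>J\<ge>J0.
        scheme_block M N r U \<sigma> g \<rho> p B J (real J * (a1 - \<epsilon>)) (real J * (a2 - \<epsilon>))"
    unfolding scheme_rates_def by auto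
  have "\<exists>J0. \<forall>J\<ge>J0. \<exists>L enc dec. valid_code J M N r U \<sigma> g \<rho> L enc dec \<and>
        ln (real (L 1)) \<ge> real J * (max 0 ((1 - 2 * p) * a1 - ln 2) - \<epsilon>) \<and>
        ln (real (L 2)) \<ge> real J * (max 0 ((1 - 2 * p) * a2 - ln 2) - \<epsilon>) \<and>
        (\<forall>k\<in>{1,2}. user_error J M N r U \<sigma> g L enc dec k \<le> \<epsilon>)" if \<epsilon>: "\<epsilon> > 0" for \<epsilon>
  proof -
    \<comment> \<open>The slack 2 \<eta> per use in the outer code costs \<epsilon> / 2, and the
      approximation of the rates by the block costs at most another \<epsilon> / 2.\<close>
    define \<eta> where "\<eta> = \<epsilon> / 4"
    have \<eta>: "\<eta> > 0" using \<epsilon> by (simp add: \<eta>_def)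
    obtain J1 where J1: "\<And>J. J \<ge> J1 \<Longrightarrow>
        scheme_block M N r U \<sigma> g \<rho> p B J (real J * (a1 - \<epsilon> / 2)) (real J * (a2 - \<epsilon> / 2))"
      using A[of "\<epsilon> / 2"] \<epsilon> by auto
    \<comment> \<open>As \<open>B\<close> and \<eta> are fixed while J grows, Hoeffding's bound is a
      geometric sequence in J.\<close>
    have "(\<lambda>J. exp (- 2 * \<eta>\<^sup>2 / B\<^sup>2) ^ J) \<longlonglongrightarrow> 0"
      using \<eta> B by (intro LIMSEQ_power_zero) auto
    then have "eventually (\<lambda>J. exp (- 2 * \<eta>\<^sup>2 / B\<^sup>2) ^ J < \<epsilon>) sequentially"
      using \<epsilon> by (rule order_tendstoD)
    then obtain J2 where J2: "\<And>J. J \<ge> J2 \<Longrightarrow> exp (- 2 * \<eta>\<^sup>2 / B\<^sup>2) ^ J < \<epsilon>"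
      unfolding eventually_sequentially by blast
    have "\<exists>L enc dec. valid_code J M N r U \<sigma> g \<rho> L enc dec \<and>
        ln (real (L 1)) \<ge> real J * (max 0 ((1 - 2 * p) * a1 - ln 2) - \<epsilon>) \<and>
        ln (real (L 2)) \<ge> real J * (max 0 ((1 - 2 * p) * a2 - ln 2) - \<epsilon>) \<and>
        (\<forall>k\<in>{1,2}. user_error J M N r U \<sigma> g L enc dec k \<le> \<epsilon>)" if J: "J \<ge> Suc (J1 + J2)" for J
    proof -
      have "J \<ge> J1" using J by simp
      from J1[OF this] obtain q f D where q:
        "\<And>j. j < J \<Longrightarrow> symbol_scheme M N r U \<sigma> g \<rho> p (q j) (f j) (D j)"
        "\<And>j k. j < J \<Longrightarrow> k \<in> {1,2} \<Longrightarrow> ln (real (q j k)) \<le> B"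
        "(\<Sum>j<J. ln (real (q j 1))) \<ge> real J * (a1 - \<epsilon> / 2)"
        "(\<Sum>j<J. ln (real (q j 2))) \<ge> real J * (a2 - \<epsilon> / 2)"
        unfolding scheme_block_def by blast
      have J0: "J > 0" using J by simp
      obtain L enc dec where V: "valid_code J M N r U \<sigma> g \<rho> L enc dec"
        and L: "\<And>k. k \<in> {1,2} \<Longrightarrow>
          ln (real (L k)) \<ge> (1 - 2 * p) * (\<Sum>j<J. ln (real (q j k))) - real J * (ln 2 + 2 * \<eta>)"
        and e: "\<And>k. k \<in> {1,2} \<Longrightarrow> user_error J M N r U \<sigma> g L enc dec k \<le> exp (- 2 * \<eta>\<^sup>2 * real J / B\<^sup>2)"
        using code_from_symbol_schemes[where M = M and N = N and r = r and U = U and \<sigma> = \<sigma> and g = g and \<rho> = \<rho> and p = p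
            and q = q and f = f and D = D, OF P J0 B \<eta> q(1,2)] by blast
      have "exp (- 2 * \<eta>\<^sup>2 * real J / B\<^sup>2) = exp (- 2 * \<eta>\<^sup>2 / B\<^sup>2) ^ J"
        by (simp add: exp_of_nat_mult[symmetric] field_simps)
      then have e': "user_error J M N r U \<sigma> g L enc dec k \<le> \<epsilon>" if "k \<in> {1,2}" for k
        using e[OF that] J2[of J] J by simp
      have rate: "ln (real (L k)) \<ge> real J * (max 0 ((1 - 2 * p) * a - ln 2) - \<epsilon>)"
        if k: "k \<in> {1,2}" and W: "(\<Sum>j<J. ln (real (q j k))) \<ge> real J * (a - \<epsilon> / 2)" for k a
      proof -
        have "L k \<ge> 1" using V k by (auto simp: valid_code_def)
        then have "ln (real (L k)) \<ge> 0" by simp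
        moreover have "0 \<ge> real J * (0 - \<epsilon>)" using \<epsilon> by simp
        moreover have "ln (real (L k)) \<ge> real J * (((1 - 2 * p) * a - ln 2) - \<epsilon>)"
        proof -
          have "(1 - 2 * p) * (\<Sum>j<J. ln (real (q j k))) \<ge> (1 - 2 * p) * (real J * (a - \<epsilon> / 2))"
            using p W by (intro mult_left_mono) auto
          moreover have "p * (real J * \<epsilon>) \<ge> 0" using p \<epsilon> by simp
          moreover have "(1 - 2 * p) * (real J * (a - \<epsilon> / 2)) = real J * ((1 - 2 * p) * a) - real J * \<epsilon> / 2 + p * (real J * \<epsilon>)"
            by (simp add: field_simps)
          moreover have "real J * (ln 2 + 2 * \<eta>) = real J * ln 2 + real J * \<epsilon> / 2"
            by (simp add: \<eta>_def field_simps)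
          moreover have "real J * (((1 - 2 * p) * a - ln 2) - \<epsilon>) = real J * ((1 - 2 * p) * a) - real J * ln 2 - real J * \<epsilon>"
            by (simp add: right_diff_distrib)
          ultimately show ?thesis using L[OF k] by linarith
        qed
        ultimately show ?thesis by (simp add: max_def)
      qed
      show ?thesis using V rate[of 1, OF _ q(3)] rate[of 2, OF _ q(4)] e' by blast
    qed
    then show ?thesis by blast
  qed
  then show ?thesis unfolding cap_region_def by simp
qed

section \<open>Degrees of freedom of symbol schemes\<close>

text \<open>The analogue of \<open>dof_region\<close> before outer coding. Schemes are required only
  for large \<rho>, where the constellations are nonempty, and the symbol error bound has to vanish,
  at whatever speed.\<close>

definition scheme_dofs :: "nat \<Rightarrow> (nat \<Rightarrow> nat) \<Rightarrow> (nat \<Rightarrow> nat) \<Rightarrow> (nat \<Rightarrow> nat \<times> nat \<Rightarrow> complex)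
    \<Rightarrow> (nat \<Rightarrow> nat \<Rightarrow> real) \<Rightarrow> (nat \<Rightarrow> (nat \<times> nat \<Rightarrow> complex) \<Rightarrow> real) \<Rightarrow> (real \<times> real) set" where
  "scheme_dofs M N r U \<sigma> g = {(d1, d2). \<exists>a :: real \<Rightarrow> real \<times> real. \<exists>p. (p \<longlongrightarrow> 0) at_top \<and>
     (\<forall>\<^sub>F \<rho> in at_top. 0 \<le> p \<rho> \<and> a \<rho> \<in> scheme_rates M N r U \<sigma> g \<rho> (p \<rho>)) \<and>
     ((\<lambda>\<rho>. fst (a \<rho>) / ln \<rho>) \<longlongrightarrow> d1) at_top \<and> ((\<lambda>\<rho>. snd (a \<rho>) / ln \<rho>) \<longlongrightarrow> d2) at_top}"

text \<open>The two families come with different error bounds. Their sum dominates both and still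
  tends to 0, so at each large \<rho> both rate pairs lie in one convex set of
  \<open>scheme_rates\<close>.\<close>

lemma convex_scheme_dofs: "convex (scheme_dofs M N r U \<sigma> g)"
proof (rule convexI)
  fix x y :: "real \<times> real" and u v :: real
  assume x: "x \<in> scheme_dofs M N r U \<sigma> g" and y: "y \<in> scheme_dofs M N r U \<sigma> g"
    and uv: "0 \<le> u" "0 \<le> v" "u + v = 1"
  from x obtain a p where a: "(p \<longlongrightarrow> 0) at_top"
     "\<forall>\<^sub>F \<rho> in at_top. 0 \<le> p \<rho> \<and> a \<rho> \<in> scheme_rates M N r U \<sigma> g \<rho> (p \<rho>)"
     "((\<lambda>\<rho>. fst (a \<rho>) / ln \<rho>) \<longlongrightarrow> fst x) at_top" "((\<lambda>\<rho>. snd (a \<rho>) / ln \<rho>) \<longlongrightarrow> snd x) at_top"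
    unfolding scheme_dofs_def by (cases x) auto
  from y obtain b s where b: "(s \<longlongrightarrow> 0) at_top"
     "\<forall>\<^sub>F \<rho> in at_top. 0 \<le> s \<rho> \<and> b \<rho> \<in> scheme_rates M N r U \<sigma> g \<rho> (s \<rho>)"
     "((\<lambda>\<rho>. fst (b \<rho>) / ln \<rho>) \<longlongrightarrow> fst y) at_top" "((\<lambda>\<rho>. snd (b \<rho>) / ln \<rho>) \<longlongrightarrow> snd y) at_top"
    unfolding scheme_dofs_def by (cases y) auto
  let ?c = "\<lambda>\<rho>. u *\<^sub>R a \<rho> + v *\<^sub>R b \<rho>" and ?t = "\<lambda>\<rho>. p \<rho> + s \<rho>"
  have "(?t \<longlongrightarrow> 0) at_top" using tendsto_add[OF a(1) b(1)] by simp
  moreover have "\<forall>\<^sub>F \<rho> in at_top. 0 \<le> ?t \<rho> \<and> ?c \<rho> \<in> scheme_rates M N r U \<sigma> g \<rho> (?t \<rho>)"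
    using a(2) b(2)
  proof eventually_elim
    case (elim \<rho>)
    have "a \<rho> \<in> scheme_rates M N r U \<sigma> g \<rho> (?t \<rho>)" "b \<rho> \<in> scheme_rates M N r U \<sigma> g \<rho> (?t \<rho>)"
      using elim scheme_rates_mono[of "p \<rho>" "?t \<rho>" M N r U \<sigma> g \<rho>]
        scheme_rates_mono[of "s \<rho>" "?t \<rho>" M N r U \<sigma> g \<rho>] by auto
    then show ?case using convexD[OF convex_scheme_rates _ _ uv] elim by auto
  qed
  moreover have "((\<lambda>\<rho>. fst (?c \<rho>) / ln \<rho>) \<longlongrightarrow> fst (u *\<^sub>R x + v *\<^sub>R y)) at_top"
    using tendsto_add[OF tendsto_mult[OF tendsto_const[of u] a(3)] tendsto_mult[OF tendsto_const[of v] b(3)]]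
    by (simp add: add_divide_distrib)
  moreover have "((\<lambda>\<rho>. snd (?c \<rho>) / ln \<rho>) \<longlongrightarrow> snd (u *\<^sub>R x + v *\<^sub>R y)) at_top"
    using tendsto_add[OF tendsto_mult[OF tendsto_const[of u] a(4)] tendsto_mult[OF tendsto_const[of v] b(4)]]
    by (simp add: add_divide_distrib)
  ultimately show "u *\<^sub>R x + v *\<^sub>R y \<in> scheme_dofs M N r U \<sigma> g"
    unfolding scheme_dofs_def case_prod_beta mem_Collect_eq by (intro exI[of _ ?c] exI[of _ ?t] conjI)
qed

text \<open>After division by ln \<rho> the loss ln 2 and the factor 1 - 2 p(\<rho>) disappear in
  the limit. At those \<rho> where no scheme with error at most 1/2 is at hand, the rate pair (0, 0)
  is used.\<close>

lemma scheme_dofs_subset_dof_region: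
  assumes P: "\<And>k. k \<in> {1,2} \<Longrightarrow> prob_space (use_space (N k) (r k) (g k))"
  shows "scheme_dofs M N r U \<sigma> g \<subseteq> dof_region M N r U \<sigma> g"
proof
  fix d assume "d \<in> scheme_dofs M N r U \<sigma> g"
  then obtain a p where p: "(p \<longlongrightarrow> 0) at_top"
     and ev: "\<forall>\<^sub>F \<rho> in at_top. 0 \<le> p \<rho> \<and> a \<rho> \<in> scheme_rates M N r U \<sigma> g \<rho> (p \<rho>)"
     and lim: "((\<lambda>\<rho>. fst (a \<rho>) / ln \<rho>) \<longlongrightarrow> fst d) at_top" "((\<lambda>\<rho>. snd (a \<rho>) / ln \<rho>) \<longlongrightarrow> snd d) at_top"
    unfolding scheme_dofs_def by (cases d) auto
  define good where "good \<rho> \<longleftrightarrow> 0 \<le> p \<rho> \<and> p \<rho> \<le> 1 / 2 \<and> a \<rho> \<in> scheme_rates M N r U \<sigma> g \<rho> (p \<rho>)" for \<rho>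
  define h where "h \<rho> x = max 0 ((1 - 2 * p \<rho>) * x - ln 2)" for \<rho> x :: real
  define R where "R \<rho> = (if good \<rho> then (h \<rho> (fst (a \<rho>)), h \<rho> (snd (a \<rho>))) else (0, 0))" for \<rho>
  have "\<forall>\<^sub>F \<rho> in at_top. p \<rho> < 1 / 2" using p by (rule order_tendstoD) simp
  with ev have good: "\<forall>\<^sub>F \<rho> in at_top. good \<rho>"
    by eventually_elim (auto simp: good_def)
  have cap: "R \<rho> \<in> cap_region M N r U \<sigma> g \<rho>" if "\<rho> > 0" for \<rho>
    using that cap_region_zero[of \<rho>] scheme_rates_cap_region[OF P, where p = "p \<rho>" and ?a1.0 = "fst (a \<rho>)" and ?a2.0 = "snd (a \<rho>)"]
    by (auto simp: R_def h_def good_def)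
  have ln0: "((\<lambda>\<rho>::real. ln 2 / ln \<rho>) \<longlongrightarrow> 0) at_top"
    by (intro tendsto_divide_0[OF tendsto_const] filterlim_at_top_imp_at_infinity ln_at_top)
  have L: "((\<lambda>\<rho>. h \<rho> (x \<rho>) / ln \<rho>) \<longlongrightarrow> l) at_top"
    if x: "((\<lambda>\<rho>. x \<rho> / ln \<rho>) \<longlongrightarrow> l) at_top" and x0: "\<forall>\<^sub>F \<rho> in at_top. x \<rho> \<ge> 0" for x l
  proof -
    have ev1: "\<forall>\<^sub>F \<rho> in at_top. \<rho> > (1::real)" by (rule eventually_gt_at_top)
    have "\<forall>\<^sub>F \<rho> in at_top. x \<rho> / ln \<rho> \<ge> 0" using x0 ev1 by eventually_elim auto
    \<comment> \<open>The limit is nonnegative, so the maximum with 0 does not alter it.\<close>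
    then have l: "l \<ge> 0" by (intro tendsto_lowerbound[OF x]) auto
    have "((\<lambda>\<rho>. max 0 ((1 - 2 * p \<rho>) * (x \<rho> / ln \<rho>) - ln 2 / ln \<rho>)) \<longlongrightarrow> max 0 ((1 - 2 * 0) * l - 0)) at_top"
      by (intro tendsto_max tendsto_diff tendsto_mult tendsto_const p x ln0)
    moreover have "\<forall>\<^sub>F \<rho> in at_top. max 0 ((1 - 2 * p \<rho>) * (x \<rho> / ln \<rho>) - ln 2 / ln \<rho>) = h \<rho> (x \<rho>) / ln \<rho>"
      using ev1 by eventually_elim (simp add: h_def max_divide_distrib_right diff_divide_distrib)
    ultimately show ?thesis using l by (simp add: tendsto_cong)
  qed
  have nn: "\<forall>\<^sub>F \<rho> in at_top. fst (a \<rho>) \<ge> 0" "\<forall>\<^sub>F \<rho> in at_top. snd (a \<rho>) \<ge> 0"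
    using ev by (eventually_elim, force simp: scheme_rates_def)+
  have "((\<lambda>\<rho>. fst (R \<rho>) / ln \<rho>) \<longlongrightarrow> fst d) at_top"
    by (rule Lim_transform_eventually[OF L[OF lim(1) nn(1)]])
       (use good in eventually_elim, simp add: R_def)
  moreover have "((\<lambda>\<rho>. snd (R \<rho>) / ln \<rho>) \<longlongrightarrow> snd d) at_top"
    by (rule Lim_transform_eventually[OF L[OF lim(2) nn(2)]])
       (use good in eventually_elim, simp add: R_def)
  ultimately show "d \<in> dof_region M N r U \<sigma> g"
    unfolding dof_region_def case_prod_beta mem_Collect_eq using cap by (intro exI[of _ R] conjI) auto
qed

section \<open>Generic full rank\<close>

text \<open>Induction over the variables with Fubini: in the new variable t the function is p0 + t
  s. If the slope s is not identically zero, it is nonzero almost everywhere by induction, and then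
  a single t is a root. Otherwise the function does not depend on t and induction applies to p0.
  Multiaffinity is inherited by both p0 and s. That p depends on the coordinates in I only links
  arbitrary functions G to the extensional ones of the product space.\<close>

lemma AE_multiaffine_nonzero:
  fixes p :: "('i \<Rightarrow> complex) \<Rightarrow> complex"
  assumes "finite I" "p \<in> borel_measurable (PiM I (\<lambda>_. lborel))"
    and "\<And>G G'. (\<And>i. i \<in> I \<Longrightarrow> G i = G' i) \<Longrightarrow> p G = p G'"
    and "\<And>i G t. i \<in> I \<Longrightarrow> p (G(i := t)) = p (G(i := 0)) + t * (p (G(i := 1)) - p (G(i := 0)))"
    and "p G0 \<noteq> 0"
  shows "AE G in PiM I (\<lambda>_. lborel). p G \<noteq> 0"
  using assms
proof (induction I arbitrary: p G0 rule: finite_induct)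
  case empty
  have "p G = p G0" for G by (rule empty.prems(2)) auto
  with empty.prems(4) have "p G \<noteq> 0" for G by metis
  then show ?case by (intro AE_I2)
next
  case (insert i I)
  interpret product_sigma_finite "\<lambda>_::'i. lborel :: complex measure" by standard
  let ?s = "\<lambda>G. p (G(i := 1)) - p (G(i := 0))" and ?p0 = "\<lambda>G. p (G(i := 0))"
  have upd: "(\<lambda>G. p (G(i := c))) \<in> borel_measurable (PiM I (\<lambda>_. lborel))" for c
  proof -
    have "(\<lambda>G. G(i := c)) \<in> PiM I (\<lambda>_. lborel) \<rightarrow>\<^sub>M PiM (insert i I) (\<lambda>_. lborel)"
      by (rule measurable_fun_upd[of _ I]) auto
    from measurable_compose[OF this insert.prems(1)] show ?thesis .
  qed
  have swap: "G(j := t, i := c) = G(i := c, j := t)" if "j \<in> I" for G :: "'i \<Rightarrow> complex" and j t c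
    using that insert.hyps by (auto simp: fun_upd_twist)
  have AE1: "AE G in PiM I (\<lambda>_. lborel). ?s G \<noteq> 0" if "?s G1 \<noteq> 0" for G1
  proof (rule insert.IH)
    show "?s (G(j := t)) = ?s (G(j := 0)) + t * (?s (G(j := 1)) - ?s (G(j := 0)))" if "j \<in> I" for j G t
    proof -
      have "j \<in> insert i I" using that by simp
      note e = insert.prems(3)[OF this, of "G(i := 1)" t] insert.prems(3)[OF this, of "G(i := 0)" t]
      show ?thesis unfolding swap[OF that] e by (simp only: algebra_simps)
    qed
    show "?s G = ?s G'" if "\<And>j. j \<in> I \<Longrightarrow> G j = G' j" for G G'
      by (intro arg_cong2[where f = "(-)"] insert.prems(2)) (use that in auto)
    show "?s \<in> borel_measurable (PiM I (\<lambda>_. lborel))" by (intro borel_measurable_diff upd)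
  qed (fact that)
  have AE0: "AE G in PiM I (\<lambda>_. lborel). ?p0 G \<noteq> 0" if "?p0 G1 \<noteq> 0" for G1
  proof (rule insert.IH)
    show "?p0 (G(j := t)) = ?p0 (G(j := 0)) + t * (?p0 (G(j := 1)) - ?p0 (G(j := 0)))" if "j \<in> I" for j G t
      unfolding swap[OF that] using that by (intro insert.prems(3)) auto
    show "?p0 G = ?p0 G'" if "\<And>j. j \<in> I \<Longrightarrow> G j = G' j" for G G'
      by (intro insert.prems(2)) (use that in auto)
  qed (fact upd that)+
  define Z where "Z = {G \<in> space (PiM (insert i I) (\<lambda>_. lborel)). p G = 0}"
  have Z: "Z \<in> sets (PiM (insert i I) (\<lambda>_. lborel))"
    unfolding Z_def using insert.prems(1) by measurable
  have inner: "AE x in PiM I (\<lambda>_. lborel). AE y in lborel. p (x(i := y)) \<noteq> 0"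
  proof (cases "\<exists>G1. ?s G1 \<noteq> 0")
    case True
    then obtain G1 where "?s G1 \<noteq> 0" by blast
    from AE1[OF this] show ?thesis
    proof eventually_elim
      case (elim x)
      have "AE y in lborel. y \<noteq> - ?p0 x / ?s x" by (rule AE_lborel_singleton)
      then show ?case
      proof eventually_elim
        case (elim y)
        have "p (x(i := y)) = ?p0 x + y * ?s x" by (rule insert.prems(3)) simp
        moreover have "?p0 x + y * ?s x \<noteq> 0"
        proof
          assume "?p0 x + y * ?s x = 0"
          then have "y * ?s x = - ?p0 x" by (simp add: eq_neg_iff_add_eq_0 add.commute)
          then have "y = - ?p0 x / ?s x" using \<open>?s x \<noteq> 0\<close> by (metis nonzero_eq_divide_eq)
          with elim show False by blast
        qed
        ultimately show ?case by simp
      qed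
    qed
  next
    case False
    have eq: "p (G(i := y)) = ?p0 G" for G y
    proof -
      have "p (G(i := y)) = ?p0 G + y * ?s G" by (rule insert.prems(3)) simp
      moreover have "?s G = 0" using False by blast
      ultimately show ?thesis by (simp only: mult_zero_right add_0_right)
    qed
    have "?p0 G0 \<noteq> 0" using eq[of G0 "G0 i"] insert.prems(4) by (metis fun_upd_triv)
    from AE0[OF this] show ?thesis
    proof eventually_elim
      case (elim x)
      then have "p (x(i := y)) \<noteq> 0" for y using eq[of x y] by metis
      then show ?case by (intro AE_I2)
    qed
  qed
  have "emeasure (PiM (insert i I) (\<lambda>_. lborel)) Z
      = (\<integral>\<^sup>+x. \<integral>\<^sup>+y. indicator Z (x(i := y)) \<partial>lborel \<partial>PiM I (\<lambda>_. lborel))"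
    unfolding nn_integral_indicator[OF Z, symmetric]
    by (rule product_nn_integral_insert) (use Z insert.hyps in auto)
  also have "\<dots> = (\<integral>\<^sup>+x. 0 \<partial>PiM I (\<lambda>_. lborel :: complex measure))"
  proof (intro nn_integral_cong_AE)
    show "AE x in PiM I (\<lambda>_. lborel). (\<integral>\<^sup>+y. indicator Z (x(i := y)) \<partial>lborel) = 0"
      using inner
    proof eventually_elim
      case (elim x)
      have "(\<integral>\<^sup>+y. indicator Z (x(i := y)) \<partial>lborel) = (\<integral>\<^sup>+y. 0 \<partial>(lborel :: complex measure))"
        using elim by (intro nn_integral_cong_AE) (auto simp: Z_def indicator_def elim: eventually_mono)
      then show ?case by simp
    qed
  qed
  finally have "emeasure (PiM (insert i I) (\<lambda>_. lborel)) Z = 0" by simp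
  then show ?case
    using Z by (subst AE_iff_measurable[OF Z]) (auto simp: Z_def)
qed

section \<open>Determinants as functions of the channel\<close>

lemma permutes_nat_less: "\<pi> permutes {0..<n} \<Longrightarrow> i < n \<Longrightarrow> \<pi> i < n" for n :: nat
  using permutes_in_image[of \<pi> "{0..<n}" i] by simp

lemma borel_measurable_det:
  fixes A :: "'a \<Rightarrow> nat \<Rightarrow> nat \<Rightarrow> complex"
  assumes "\<And>i j. i < n \<Longrightarrow> j < n \<Longrightarrow> (\<lambda>x. A x i j) \<in> borel_measurable M"
  shows "(\<lambda>x. det (mat n n (\<lambda>(i, j). A x i j))) \<in> borel_measurable M"
proof -
  have "det (mat n n (\<lambda>(i, j). A x i j))
      = (\<Sum>p\<in>{p. p permutes {0..<n}}. signof p * (\<Prod>i = 0..<n. A x i (p i)))" for x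
    by (subst det_def'[of _ n]) (auto intro!: sum.cong prod.cong simp: permutes_nat_less)
  then show ?thesis
    using assms by (auto intro!: borel_measurable_sum borel_measurable_times borel_measurable_prod simp: permutes_nat_less)
qed

lemma borel_measurable_cofactor:
  fixes A :: "'a \<Rightarrow> nat \<Rightarrow> nat \<Rightarrow> complex"
  assumes A: "\<And>i j. i < n \<Longrightarrow> j < n \<Longrightarrow> (\<lambda>x. A x i j) \<in> borel_measurable M" and "a < n" "b < n"
  shows "(\<lambda>x. cofactor (mat n n (\<lambda>(i, j). A x i j)) a b) \<in> borel_measurable M"
proof -
  define ii where "ii k i = (if i < k then i else Suc i)" for k i :: nat
  have "mat_delete (mat n n (\<lambda>(i, j). A x i j)) a b
      = mat (n - 1) (n - 1) (\<lambda>(i, j). A x (ii a i) (ii b j))" for x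
    unfolding mat_delete_def by (rule eq_matI) (auto simp: ii_def)
  then have "cofactor (mat n n (\<lambda>(i, j). A x i j)) a b
      = (-1) ^ (a + b) * det (mat (n - 1) (n - 1) (\<lambda>(i, j). A x (ii a i) (ii b j)))" for x
    by (simp add: cofactor_def)
  then show ?thesis
    using assms
    by (simp only:) (intro borel_measurable_times borel_measurable_const borel_measurable_det A, auto simp: ii_def)
qed

text \<open>A single entry of \<open>G\<close> influences only one row of the product matrix,
  affinely, and each Leibniz product contains at most one factor from that row.\<close>

lemma det_affine_entry:
  fixes u :: "nat \<Rightarrow> nat \<Rightarrow> complex" and G :: "nat \<times> nat \<Rightarrow> complex" and n r :: nat
  defines "p \<equiv> (\<lambda>G. det (mat n n (\<lambda>(i, j). \<Sum>a<r. G (i, a) * u j a)))"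
  shows "p (G(e := t)) = p (G(e := 0)) + t * (p (G(e := 1)) - p (G(e := 0)))"
proof -
  obtain i0 a0 where e: "e = (i0, a0)" by force
  define F where "F t i j = (\<Sum>a<r. (G(e := t)) (i, a) * u j a)" for t i j
  have Ft: "F t i j = F 0 i j + t * (F 1 i j - F 0 i j)" for t i j
    unfolding F_def sum_subtractf[symmetric] sum_distrib_left sum.distrib[symmetric]
    by (intro sum.cong) (auto simp: algebra_simps)
  have Fc: "F t i j = F 0 i j" if "i \<noteq> i0" for t i j
    using that by (simp add: F_def e)
  have p: "p (G(e := t)) = (\<Sum>\<pi>\<in>{\<pi>. \<pi> permutes {0..<n}}. signof \<pi> * (\<Prod>i = 0..<n. F t i (\<pi> i)))" for t
    unfolding p_def F_def
    by (subst det_def'[of _ n]) (auto intro!: sum.cong prod.cong simp: permutes_nat_less)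
  have prod_affine: "(\<Prod>i = 0..<n. F t i (\<pi> i)) = (\<Prod>i = 0..<n. F 0 i (\<pi> i))
      + t * ((\<Prod>i = 0..<n. F 1 i (\<pi> i)) - (\<Prod>i = 0..<n. F 0 i (\<pi> i)))" for \<pi>
  proof (cases "i0 < n")
    case True
    let ?R = "\<Prod>i\<in>{0..<n} - {i0}. F 0 i (\<pi> i)"
    have eq: "(\<Prod>i = 0..<n. F t i (\<pi> i)) = F t i0 (\<pi> i0) * ?R" for t
    proof -
      have "(\<Prod>i = 0..<n. F t i (\<pi> i)) = F t i0 (\<pi> i0) * (\<Prod>i\<in>{0..<n} - {i0}. F t i (\<pi> i))"
        using True by (subst prod.remove[of _ i0]) auto
      also have "(\<Prod>i\<in>{0..<n} - {i0}. F t i (\<pi> i)) = ?R"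
        by (intro prod.cong) (auto intro!: Fc)
      finally show ?thesis .
    qed
    show ?thesis unfolding eq by (subst Ft[of t i0 "\<pi> i0"]) (simp add: algebra_simps)
  next
    case False
    then have "(\<Prod>i = 0..<n. F t i (\<pi> i)) = (\<Prod>i = 0..<n. F 0 i (\<pi> i))" for t
      by (intro prod.cong refl Fc) auto
    from this[of t] this[of 1] show ?thesis by simp
  qed
  show ?thesis
    unfolding p sum_subtractf[symmetric] sum_distrib_left sum.distrib[symmetric]
    by (intro sum.cong refl) (subst prod_affine, simp add: algebra_simps)
qed

text \<open>Quantitative injectivity by Cramer's rule. Let A be the first n rows of the matrix with
  entries \<Sum>G(i,a) u_j(a). Then adj(A) A = det(A) I expresses det(A) c_b through the entries of
  A c, with cofactors as coefficients. The determinant is multiaffine in \<open>G\<close> and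
  nonzero at one point, hence nonzero almost everywhere.\<close>

lemma full_rank_lower_bound:
  fixes u Y :: "nat \<Rightarrow> nat \<Rightarrow> complex"
  assumes n: "n \<le> N"
    and dual: "\<And>i j. i < n \<Longrightarrow> j < n \<Longrightarrow> (\<Sum>a<r. Y i a * u j a) = (if i = j then 1 else 0)"
  obtains \<delta> :: "(nat \<times> nat \<Rightarrow> complex) \<Rightarrow> real" where
    "\<delta> \<in> borel_measurable (Gspace N r)" "\<And>G. \<delta> G \<ge> 0" "AE G in Gspace N r. \<delta> G > 0"
    "\<And>G c b. b < n \<Longrightarrow> \<delta> G * cmod (c b) \<le> (\<Sum>i<N. cmod (\<Sum>j<n. c j * (\<Sum>a<r. G (i, a) * u j a)))"
proof -
  define F where "F G i j = (\<Sum>a<r. G (i, a) * u j a)" for G :: "nat \<times> nat \<Rightarrow> complex" and i j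
  define A where "A G = mat n n (\<lambda>(i, j). F G i j)" for G
  define K where "K G = (\<Sum>b<n. \<Sum>i<n. cmod (cofactor (A G) i b))" for G
  \<comment> \<open>K bounds all cofactors; the 1 keeps the denominator positive, and keeps \<delta>
    positive wherever the determinant is nonzero.\<close>
  define \<delta> where "\<delta> G = cmod (det (A G)) / (1 + K G)" for G
  have Fm: "(\<lambda>G. F G i j) \<in> borel_measurable (Gspace N r)" if "i < n" "j < n" for i j
  proof -
    have "(\<lambda>G. G (i, a)) \<in> borel_measurable (Gspace N r)" if "a < r" for a
      using measurable_component_singleton[of "(i, a)" "{..<N} \<times> {..<r}" "\<lambda>_. lborel :: complex measure"]
        that \<open>i < n\<close> n by (simp add: Gspace_def)
    then show ?thesis unfolding F_def by (intro borel_measurable_sum borel_measurable_times) auto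
  qed
  have dm: "(\<lambda>G. det (A G)) \<in> borel_measurable (Gspace N r)"
    unfolding A_def by (intro borel_measurable_det Fm)
  have Km: "K \<in> borel_measurable (Gspace N r)"
    unfolding K_def A_def
    by (intro borel_measurable_sum borel_measurable_norm[THEN measurable_compose[rotated]] borel_measurable_cofactor Fm) auto
  have K0: "K G \<ge> 0" for G unfolding K_def by (intro sum_nonneg) auto
  have K1: "1 + K G > 0" for G using K0[of G] by linarith
  have nz: "AE G in Gspace N r. det (A G) \<noteq> 0"
    unfolding Gspace_def
  proof (rule AE_multiaffine_nonzero)
    show "(\<lambda>G. det (A G)) \<in> borel_measurable (PiM ({..<N} \<times> {..<r}) (\<lambda>_. lborel))"
      using dm by (simp add: Gspace_def)
    show "det (A G) = det (A G')" if "\<And>i. i \<in> {..<N} \<times> {..<r} \<Longrightarrow> G i = G' i" for G G'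
    proof -
      have "A G = A G'" unfolding A_def F_def using that n by (intro cong_mat) (auto intro!: sum.cong)
      then show ?thesis by simp
    qed
    show "det (A (G(i := t))) = det (A (G(i := 0))) + t * (det (A (G(i := 1))) - det (A (G(i := 0))))" for i G t
      unfolding A_def F_def by (rule det_affine_entry)
    \<comment> \<open>The point of nonvanishing: the channel whose rows are the dual functionals
      \<open>Y\<close> turns A into the identity matrix.\<close>
    have "A (\<lambda>(i, a). Y i a) = 1\<^sub>m n"
      unfolding A_def F_def by (rule eq_matI) (auto simp: dual)
    then show "det (A (\<lambda>(i, a). Y i a)) \<noteq> 0" by simp
  qed auto
  show ?thesis
  proof (rule that[of \<delta>])
    show "\<delta> \<in> borel_measurable (Gspace N r)" unfolding \<delta>_def using dm Km by measurable
    show "\<delta> G \<ge> 0" for G using K1[of G] by (simp add: \<delta>_def)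
    show "AE G in Gspace N r. \<delta> G > 0"
      using nz by eventually_elim (use K1 in \<open>simp add: \<delta>_def\<close>)
    show "\<delta> G * cmod (c b) \<le> (\<Sum>i<N. cmod (\<Sum>j<n. c j * (\<Sum>a<r. G (i, a) * u j a)))" if b: "b < n" for G c b
    proof -
      define v where "v i = (\<Sum>j<n. c j * F G i j)" for i
      have Ac: "A G \<in> carrier_mat n n" by (simp add: A_def)
      have adj: "(\<Sum>i<n. cofactor (A G) i b * F G i j) = (if b = j then det (A G) else 0)" if j: "j < n" for j
      proof -
        have "(adj_mat (A G) * A G) $$ (b, j) = (det (A G) \<cdot>\<^sub>m 1\<^sub>m n) $$ (b, j)"
          using adj_mat(3)[OF Ac] by simp
        moreover have "(adj_mat (A G) * A G) $$ (b, j) = (\<Sum>i<n. cofactor (A G) i b * F G i j)"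
          using b j adj_mat(1)[OF Ac] Ac
          by (auto simp: times_mat_def scalar_prod_def adj_mat_def A_def lessThan_atLeast0 intro!: sum.cong)
        ultimately show ?thesis using b j by auto
      qed
      have "det (A G) * c b = (\<Sum>j<n. c j * (if b = j then det (A G) else 0))"
        using b by (simp add: if_distrib[of "\<lambda>x. _ * x"] cong: if_cong)
      also have "\<dots> = (\<Sum>j<n. c j * (\<Sum>i<n. cofactor (A G) i b * F G i j))"
        by (intro sum.cong) (auto simp: adj)
      also have "\<dots> = (\<Sum>i<n. cofactor (A G) i b * v i)"
        unfolding v_def sum_distrib_left by (subst sum.swap) (intro sum.cong, auto simp: algebra_simps)
      finally have eq: "det (A G) * c b = (\<Sum>i<n. cofactor (A G) i b * v i)" .
      have "cmod (det (A G)) * cmod (c b) \<le> (\<Sum>i<n. cmod (cofactor (A G) i b) * cmod (v i))"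
        unfolding norm_mult[symmetric] eq by (rule norm_sum)
      also have "\<dots> \<le> (\<Sum>i<n. K G * cmod (v i))"
      proof (intro sum_mono mult_right_mono)
        fix i assume i: "i \<in> {..<n}"
        have "cmod (cofactor (A G) i b) \<le> (\<Sum>i<n. cmod (cofactor (A G) i b))"
          using i by (intro member_le_sum) auto
        also have "\<dots> \<le> K G"
          unfolding K_def using b
          by (intro member_le_sum[of b _ "\<lambda>b. \<Sum>i<n. cmod (cofactor (A G) i b)"]) (auto intro: sum_nonneg)
        finally show "cmod (cofactor (A G) i b) \<le> K G" .
      qed auto
      \<comment> \<open>The remaining N - n antennas only enlarge the right-hand side.\<close>
      also have "\<dots> \<le> (1 + K G) * (\<Sum>i<N. cmod (v i))"
        unfolding sum_distrib_left[symmetric] using n K0[of G]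
        by (intro mult_mono sum_mono2 sum_nonneg) auto
      finally have "cmod (det (A G)) * cmod (c b) \<le> (1 + K G) * (\<Sum>i<N. cmod (v i))" .
      then show ?thesis
        using K1[of G] by (simp add: \<delta>_def v_def F_def field_simps)
    qed
  qed
qed

section \<open>Beams\<close>

interpretation cvec: vector_space cscale
  by unfold_locales (auto simp: cscale_def fun_eq_iff algebra_simps)

text \<open>Conjugate linear in the first argument. Vectors are functions on all of nat, of which
  only the first M coordinates count, so this form is degenerate; definiteness has to be recovered
  from the support of the vectors involved.\<close>

definition cip :: "nat \<Rightarrow> (nat \<Rightarrow> complex) \<Rightarrow> (nat \<Rightarrow> complex) \<Rightarrow> complex" where
  "cip M f h = (\<Sum>i<M. cnj (f i) * h i)"

lemma cip_add_left: "cip M (f + f') h = cip M f h + cip M f' h"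
  by (simp add: cip_def algebra_simps sum.distrib)

lemma cip_add_right: "cip M f (h + h') = cip M f h + cip M f h'"
  by (simp add: cip_def algebra_simps sum.distrib)

lemma cip_diff_right: "cip M f (h - h') = cip M f h - cip M f h'"
  by (simp add: cip_def algebra_simps sum_subtractf)

lemma cip_scale_left: "cip M (cscale c f) h = cnj c * cip M f h"
  by (simp add: cip_def cscale_def sum_distrib_left algebra_simps)

lemma cip_scale_right: "cip M f (cscale c h) = c * cip M f h"
  by (simp add: cip_def cscale_def sum_distrib_left algebra_simps)

lemma cip_zero_right [simp]: "cip M f 0 = 0"
  by (simp add: cip_def)

lemma cip_zero_left [simp]: "cip M 0 f = 0"
  by (simp add: cip_def)

lemma cip_sum_right: "cip M f (\<Sum>x\<in>A. h x) = (\<Sum>x\<in>A. cip M f (h x))"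
proof (induction A rule: infinite_finite_induct)
  case (infinite A)
  then show ?case by (metis sum.infinite cip_zero_right)
next
  case empty
  show ?case by (simp only: sum.empty cip_zero_right)
next
  case (insert x A)
  then show ?case by (metis sum.insert cip_add_right)
qed

lemma cip_self_eq_0:
  assumes "cip M f f = 0" "i < M" shows "f i = 0"
proof -
  have "cip M f f = complex_of_real (\<Sum>i<M. (cmod (f i))\<^sup>2)"
    unfolding cip_def of_real_sum by (intro sum.cong refl) (simp only: complex_norm_square mult.commute)
  with assms(1) have "(\<Sum>i<M. (cmod (f i))\<^sup>2) = 0" by (simp only: of_real_eq_0_iff)
  then have "(cmod (f i))\<^sup>2 = 0" using assms(2) by (subst (asm) sum_nonneg_eq_0_iff) auto
  then show ?thesis by simp
qed

lemma cip_orthogonal_span: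
  assumes "\<And>b. b \<in> B \<Longrightarrow> cip M b x = 0" and "w \<in> cvec.span B"
  shows "cip M w x = 0"
proof -
  have "cvec.span B \<subseteq> {w. cip M w x = 0}"
    using assms(1)
    by (intro cvec.span_minimal) (auto simp: cvec.subspace_def cip_add_left cip_scale_left)
  then show ?thesis using assms(2) by blast
qed

text \<open>Gram-Schmidt, one vector at a time: the part b' of the new vector orthogonal to the span
  of \<open>B\<close> corrects the old projection.\<close>

lemma orthogonal_projection_exists:
  assumes "finite B"
  shows "\<exists>w\<in>cvec.span B. \<forall>b\<in>B. cip M b (v - w) = 0"
  using assms
proof (induction B arbitrary: v rule: finite_induct)
  case empty
  then show ?case by (auto intro!: bexI[of _ 0] cvec.span_zero)
next
  case (insert b B)
  obtain w0 where w0: "w0 \<in> cvec.span B" "\<And>x. x \<in> B \<Longrightarrow> cip M x (b - w0) = 0"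
    using insert.IH[of b] by blast
  obtain w1 where w1: "w1 \<in> cvec.span B" "\<And>x. x \<in> B \<Longrightarrow> cip M x (v - w1) = 0"
    using insert.IH[of v] by blast
  define b' where "b' = b - w0"
  have b: "b = w0 + b'" by (simp add: b'_def)
  have sub: "cvec.span B \<subseteq> cvec.span (insert b B)" by (intro cvec.span_mono) auto
  show ?case
  proof (cases "cip M b' b' = 0")
    \<comment> \<open>Here b' vanishes on the first M coordinates, so the new vector brings no new
      condition and the old projection serves.\<close>
    case True
    have "b' i = 0" if "i < M" for i using cip_self_eq_0[OF True that] .
    then have "cip M b' y = 0" for y by (simp add: cip_def)
    moreover have "cip M w0 (v - w1) = 0" using cip_orthogonal_span[OF w1(2) w0(1)] by simp
    ultimately have "cip M b (v - w1) = 0" unfolding b cip_add_left by simp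
    then have "\<forall>x\<in>insert b B. cip M x (v - w1) = 0" using w1(2) by blast
    then show ?thesis using w1(1) sub by blast
  next
    case False
    define c where "c = cip M b' (v - w1) / cip M b' b'"
    define w where "w = w1 + cscale c b'"
    have vw: "v - w = (v - w1) - cscale c b'" by (simp add: w_def)
    have B: "cip M x (v - w) = 0" if "x \<in> B" for x
      unfolding vw cip_diff_right[of M x "v - w1"] cip_scale_right using w0(2)[OF that] w1(2)[OF that] by (simp add: b'_def)
    have "cip M b' (v - w) = 0"
      unfolding vw cip_diff_right[of M b' "v - w1"] cip_scale_right using False by (simp add: c_def)
    moreover have "cip M w0 (v - w) = 0" using cip_orthogonal_span[OF B w0(1)] by simp
    ultimately have "cip M b (v - w) = 0" by (subst b) (simp only: cip_add_left, simp)
    moreover have "w \<in> cvec.span (insert b B)"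
      unfolding w_def b'_def using w0 w1 sub
      by (intro cvec.span_add cvec.span_scale cvec.span_diff) (auto intro: cvec.span_base)
    ultimately show ?thesis using B by blast
  qed
qed

text \<open>The vector dual to b is the component x of b orthogonal to the other members of
  \<open>B\<close>, rescaled. If cip x x were 0, the support condition would give x = 0 and put b
  into the span of the others.\<close>

lemma dual_vectors_exist:
  assumes B: "finite B" "cvec.independent B" and supp: "\<And>b i. b \<in> B \<Longrightarrow> i \<ge> M \<Longrightarrow> b i = 0"
  shows "\<exists>X. \<forall>b\<in>B. \<forall>b'\<in>B. cip M b' (X b) = (if b' = b then 1 else 0)"
proof -
  have "\<exists>x. \<forall>b'\<in>B. cip M b' x = (if b' = b then 1 else 0)" if b: "b \<in> B" for b
  proof -
    obtain w where w: "w \<in> cvec.span (B - {b})" "\<And>b'. b' \<in> B - {b} \<Longrightarrow> cip M b' (b - w) = 0"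
      using orthogonal_projection_exists[of "B - {b}" M b] B(1) by auto
    define x where "x = b - w"
    have wM: "w i = 0" if "i \<ge> M" for i
    proof -
      have "cvec.span (B - {b}) \<subseteq> {f. f i = 0}"
        using supp that by (intro cvec.span_minimal) (auto simp: cvec.subspace_def cscale_def)
      then show ?thesis using w by auto
    qed
    have nz: "cip M x x \<noteq> 0"
    proof
      assume "cip M x x = 0"
      then have "x i = 0" for i
        using cip_self_eq_0[of M x i] supp[OF b, of i] wM[of i] by (cases "i < M") (auto simp: x_def)
      then have "b = w" by (auto simp: x_def fun_eq_iff)
      with w(1) b B(2) show False by (auto simp: cvec.dependent_def)
    qed
    have "cip M w x = 0" using cip_orthogonal_span[OF w(2) w(1)] by (simp add: x_def)
    moreover have "b = w + x" by (simp add: x_def)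
    ultimately have bx: "cip M b x = cip M x x" by (metis add_0 cip_add_left)
    show ?thesis
    proof (intro exI[of _ "cscale (1 / cip M x x) x"] ballI)
      fix b' assume "b' \<in> B"
      then show "cip M b' (cscale (1 / cip M x x) x) = (if b' = b then 1 else 0)"
        using nz bx w(2)[of b'] by (auto simp: cip_scale_right x_def)
    qed
  qed
  then show ?thesis by metis
qed

section \<open>Eigenspaces and the beams dual to their bases\<close>

lemma cip_col: "cip M (Defs.col M U a) f = (\<Sum>i<M. cnj (U (i, a)) * f i)"
  by (simp add: cip_def Defs.col_def)

lemma eigenspace_supported: "f \<in> eigenspace M r U \<Longrightarrow> i \<ge> M \<Longrightarrow> f i = 0"
proof -
  assume f: "f \<in> eigenspace M r U" and i: "i \<ge> M"
  have "cvec.span (Defs.col M U ` {..<r}) \<subseteq> {f. f i = 0}"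
    using i by (intro cvec.span_minimal) (auto simp: cvec.subspace_def cscale_def Defs.col_def)
  then show ?thesis using f by (auto simp: eigenspace_def)
qed

text \<open>For f = U c the pairing with x is a linear function of U^H x, with the conjugates of c
  as coefficients. Thus functionals given by vectors of the eigenspace can be evaluated on what the
  channel matrix retains of x.\<close>

lemma eigenspace_coordinates:
  assumes "f \<in> eigenspace M r U"
  shows "\<exists>y. \<forall>x. cip M f x = (\<Sum>a<r. y a * (\<Sum>i<M. cnj (U (i, a)) * x i))"
proof -
  let ?P = "{f. \<exists>y. \<forall>x. cip M f x = (\<Sum>a<r. y a * (\<Sum>i<M. cnj (U (i, a)) * x i))}"
  have "cvec.span (Defs.col M U ` {..<r}) \<subseteq> ?P"
  proof (intro cvec.span_minimal)
    show "Defs.col M U ` {..<r} \<subseteq> ?P"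
    proof (rule image_subsetI)
      fix a assume a: "a \<in> {..<r}"
      show "Defs.col M U a \<in> ?P"
        unfolding mem_Collect_eq cip_col
        by (rule exI[of _ "\<lambda>a'. if a' = a then 1 else 0"])
           (use a in \<open>simp add: if_distrib[of "\<lambda>x. x * _"] cong: if_cong\<close>)
    qed
    show "cvec.subspace ?P"
    proof (rule cvec.subspaceI)
      show "0 \<in> ?P" by (auto intro!: exI[of _ "\<lambda>_. 0"])
      fix f h assume "f \<in> ?P" "h \<in> ?P"
      then obtain y z where "\<forall>x. cip M f x = (\<Sum>a<r. y a * (\<Sum>i<M. cnj (U (i, a)) * x i))"
          "\<forall>x. cip M h x = (\<Sum>a<r. z a * (\<Sum>i<M. cnj (U (i, a)) * x i))" by auto
      then show "f + h \<in> ?P"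
        by (auto intro!: exI[of _ "\<lambda>a. y a + z a"] simp: cip_add_left distrib_right sum.distrib)
    next
      fix c f assume "f \<in> ?P"
      then obtain y where "\<forall>x. cip M f x = (\<Sum>a<r. y a * (\<Sum>i<M. cnj (U (i, a)) * x i))" by auto
      then show "cscale c f \<in> ?P"
        by (auto intro!: exI[of _ "\<lambda>a. cnj c * y a"] simp: cip_scale_left sum_distrib_left mult.assoc)
    qed
  qed
  then show ?thesis using assms by (auto simp: eigenspace_def)
qed

text \<open>Pairing a vanishing combination of the columns with one of them isolates its
  coefficient.\<close>

lemma dim_eigenspace:
  assumes on: "\<And>a b. a < r \<Longrightarrow> b < r \<Longrightarrow> (\<Sum>i<M. cnj (U (i, a)) * U (i, b)) = (if a = b then 1 else 0)"
  shows "cvec.dim (eigenspace M r U) = r"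
proof -
  let ?c = "Defs.col M U"
  have ip: "cip M (?c a) (?c b) = (if a = b then 1 else 0)" if "a < r" "b < r" for a b
    using on[OF that] by (simp add: cip_def Defs.col_def)
  have inj: "inj_on ?c {..<r}"
  proof (rule inj_onI)
    fix a b assume "a \<in> {..<r}" "b \<in> {..<r}" "?c a = ?c b"
    then show "a = b" using ip[of a b] ip[of a a] by (auto split: if_splits)
  qed
  have "cvec.independent (?c ` {..<r})"
  proof
    assume "cvec.dependent (?c ` {..<r})"
    then obtain u where u: "\<exists>v\<in>?c ` {..<r}. u v \<noteq> 0" "(\<Sum>v\<in>?c ` {..<r}. cscale (u v) v) = 0"
      by (subst (asm) cvec.dependent_finite) auto
    from u(1) obtain a where a: "a < r" "u (?c a) \<noteq> 0" by auto
    have "0 = cip M (?c a) (\<Sum>v\<in>?c ` {..<r}. cscale (u v) v)" by (simp add: u(2))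
    also have "\<dots> = (\<Sum>v\<in>?c ` {..<r}. u v * cip M (?c a) v)"
      by (simp add: cip_sum_right cip_scale_right)
    also have "\<dots> = (\<Sum>b<r. u (?c b) * cip M (?c a) (?c b))"
      by (subst sum.reindex[OF inj]) simp
    also have "\<dots> = (\<Sum>b<r. if a = b then u (?c b) else 0)"
      by (intro sum.cong) (use a in \<open>auto simp: ip\<close>)
    also have "\<dots> = u (?c a)" using a by simp
    finally show False using a by simp
  qed
  then have "cvec.dim (?c ` {..<r}) = card (?c ` {..<r})" by (rule cvec.dim_eq_card_independent)
  then show ?thesis by (simp add: eigenspace_def card_image[OF inj])
qed

text \<open>The argument behind the dimension formula: in a linear relation the part over
  \<open>A2 - A1\<close> is minus the part over \<open>A1\<close>, so it lies in both subspaces and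
  hence in the span of \<open>B0\<close>.\<close>

lemma independent_union_over_intersection:
  assumes V: "cvec.subspace V1" "cvec.subspace V2" and fin: "finite A1" "finite A2"
    and A: "A1 \<subseteq> V1" "A2 \<subseteq> V2" "cvec.independent A1" "cvec.independent A2"
    and B0: "B0 \<subseteq> A1" "B0 \<subseteq> A2" "V1 \<inter> V2 \<subseteq> cvec.span B0"
  shows "cvec.independent (A1 \<union> A2)" "A1 \<inter> A2 = B0"
proof -
  have fB0: "finite B0" using B0(1) fin(1) finite_subset by blast
  show int: "A1 \<inter> A2 = B0"
  proof (rule ccontr)
    assume "A1 \<inter> A2 \<noteq> B0"
    then obtain x where x: "x \<in> A1" "x \<in> A2" "x \<notin> B0" using B0 by auto
    then have "x \<in> cvec.span B0" using A B0(3) by blast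
    then have "x \<in> cvec.span (A1 - {x})" using cvec.span_mono[of B0 "A1 - {x}"] x B0 by auto
    with x A(3) show False by (auto simp: cvec.dependent_def)
  qed
  show "cvec.independent (A1 \<union> A2)"
  proof
    assume "cvec.dependent (A1 \<union> A2)"
    then obtain u where u: "\<exists>v\<in>A1 \<union> A2. u v \<noteq> 0" "(\<Sum>v\<in>A1 \<union> A2. cscale (u v) v) = 0"
      using fin by (subst (asm) cvec.dependent_finite) auto
    let ?s = "\<lambda>S. \<Sum>v\<in>S. cscale (u v) v"
    have split: "?s A1 + ?s (A2 - A1) = 0"
      using u(2) fin sum.union_disjoint[of A1 "A2 - A1" "\<lambda>v. cscale (u v) v"] by simp
    have s1: "?s A1 \<in> V1" using A V by (intro cvec.subspace_sum) (auto intro: cvec.subspace_scale)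
    have s2: "?s (A2 - A1) \<in> V2" using A V by (intro cvec.subspace_sum) (auto intro: cvec.subspace_scale)
    have "?s (A2 - A1) = - ?s A1" using split by (simp add: eq_neg_iff_add_eq_0 add.commute)
    then have "?s (A2 - A1) \<in> V1" using cvec.subspace_neg[OF V(1) s1] by simp
    with s2 have "?s (A2 - A1) \<in> cvec.span B0" using B0 by blast
    then obtain w where w: "?s (A2 - A1) = (\<Sum>v\<in>B0. cscale (w v) v)"
      using cvec.span_finite[OF fB0] by auto
    \<comment> \<open>Moving the combination over \<open>B0\<close> to the other side yields a
      relation within \<open>A2\<close> whose coefficients outside \<open>B0\<close> are those of u;
      independence of \<open>A2\<close> makes them vanish.\<close>
    define t where "t v = (if v \<in> B0 then - w v else u v)" for v
    have "A2 = B0 \<union> (A2 - A1)" using int by auto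
    then have "(\<Sum>v\<in>A2. cscale (t v) v) = (\<Sum>v\<in>B0. cscale (t v) v) + (\<Sum>v\<in>A2 - A1. cscale (t v) v)"
      using fin fB0 B0 by (subst sum.union_disjoint[symmetric]) auto
    also have "(\<Sum>v\<in>B0. cscale (t v) v) = - (\<Sum>v\<in>B0. cscale (w v) v)"
      unfolding sum_negf[symmetric] by (intro sum.cong) (auto simp: t_def)
    also have "(\<Sum>v\<in>A2 - A1. cscale (t v) v) = ?s (A2 - A1)"
      using B0 by (intro sum.cong) (auto simp: t_def)
    finally have "(\<Sum>v\<in>A2. cscale (t v) v) = 0" by (simp only: w add.left_inverse)
    then have "\<forall>v\<in>A2. t v = 0" using A(4) fin(2) cvec.dependent_finite by blast
    then have z2: "u v = 0" if "v \<in> A2 - A1" for v using that B0 by (auto simp: t_def split: if_splits)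
    then have "?s (A2 - A1) = 0" by (intro sum.neutral) auto
    with split have "?s A1 = 0" by simp
    then have "\<forall>v\<in>A1. u v = 0" using A(3) fin(1) cvec.dependent_finite by blast
    with z2 u(1) show False by auto
  qed
qed

text \<open>The common beams are indexed by \<open>B0\<close>, the private beams of user \<open>k\<close> by \<open>B k\<close>; the functionals \<open>Y k\<close>
  on the range of \<open>U\<^sub>k\<^sup>H\<close> witness the linear independence of the beams visible to user \<open>k\<close>.\<close>

lemma beams_exist:
  fixes r :: "nat \<Rightarrow> nat" and U :: "nat \<Rightarrow> nat \<times> nat \<Rightarrow> complex"
  assumes on: "\<And>k a b. k \<in> {1,2} \<Longrightarrow> a < r k \<Longrightarrow> b < r k \<Longrightarrow>
      (\<Sum>i<M. cnj (U k (i, a)) * U k (i, b)) = (if a = b then 1 else 0)"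
  obtains B0 :: "(nat \<Rightarrow> complex) set" and B :: "nat \<Rightarrow> (nat \<Rightarrow> complex) set"
      and X :: "(nat \<Rightarrow> complex) \<Rightarrow> nat \<Rightarrow> complex" and Y :: "nat \<Rightarrow> (nat \<Rightarrow> complex) \<Rightarrow> nat \<Rightarrow> complex"
  where "finite B0" "\<And>k. k \<in> {1,2} \<Longrightarrow> finite (B k)"
    "\<And>k. k \<in> {1,2} \<Longrightarrow> B0 \<inter> B k = {}" "B 1 \<inter> B 2 = {}"
    "card B0 = cdim (eigenspace M (r 1) (U 1) \<inter> eigenspace M (r 2) (U 2))"
    "\<And>k. k \<in> {1,2} \<Longrightarrow> card B0 + card (B k) = r k"
    "\<And>k b a. k \<in> {1,2} \<Longrightarrow> b \<in> (B 1 \<union> B 2) - B k \<Longrightarrow> a < r k \<Longrightarrow> (\<Sum>m<M. cnj (U k (m, a)) * X b m) = 0"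
    "\<And>k b b'. k \<in> {1,2} \<Longrightarrow> b \<in> B0 \<union> B k \<Longrightarrow> b' \<in> B0 \<union> B k \<Longrightarrow>
       (\<Sum>a<r k. Y k b' a * (\<Sum>m<M. cnj (U k (m, a)) * X b m)) = (if b' = b then 1 else 0)"
proof -
  define V where "V k = eigenspace M (r k) (U k)" for k
  have Vs: "cvec.subspace (V k)" for k by (simp add: V_def eigenspace_def)
  obtain B0 where B0: "B0 \<subseteq> V 1 \<inter> V 2" "cvec.independent B0" "V 1 \<inter> V 2 \<subseteq> cvec.span B0"
      "card B0 = cvec.dim (V 1 \<inter> V 2)"
    using cvec.basis_exists by blast
  have "\<exists>A. B0 \<subseteq> A \<and> A \<subseteq> V k \<and> cvec.independent A \<and> V k \<subseteq> cvec.span A" if "k \<in> {1,2}" for k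
  proof -
    have "B0 \<subseteq> V k" using B0(1) that by auto
    then show ?thesis using cvec.maximal_independent_subset_extend[OF _ B0(2), of "V k"] by metis
  qed
  then obtain A where A: "\<And>k. k \<in> {1,2} \<Longrightarrow> B0 \<subseteq> A k \<and> A k \<subseteq> V k \<and> cvec.independent (A k) \<and> V k \<subseteq> cvec.span (A k)"
    by metis
  have finA: "finite (A k)" if "k \<in> {1,2}" for k
    using cvec.independent_span_bound[of "Defs.col M (U k) ` {..<r k}" "A k"] A[OF that]
    by (auto simp: V_def eigenspace_def)
  have cardA: "card (A k) = r k" if "k \<in> {1,2}" for k
  proof -
    have "card (A k) = cvec.dim (V k)" using A[OF that] by (intro cvec.basis_card_eq_dim) auto
    also have "\<dots> = r k" unfolding V_def by (rule dim_eigenspace[OF on[OF that]])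
    finally show ?thesis .
  qed
  have ind: "cvec.independent (A 1 \<union> A 2)" and int: "A 1 \<inter> A 2 = B0"
    using independent_union_over_intersection[OF Vs[of 1] Vs[of 2] finA[of 1] finA[of 2], of B0] A[of 1] A[of 2] B0(3)
    by auto
  have supp: "b i = 0" if "b \<in> A 1 \<union> A 2" "i \<ge> M" for b i
    using that A[of 1] A[of 2] eigenspace_supported[of b M _ _ i] unfolding V_def by blast
  have "\<exists>X. \<forall>b\<in>A 1 \<union> A 2. \<forall>b'\<in>A 1 \<union> A 2. cip M b' (X b) = (if b' = b then 1 else 0)"
    by (rule dual_vectors_exist[OF _ ind]) (use finA[of 1] finA[of 2] supp in auto)
  then obtain X where X0: "\<forall>b\<in>A 1 \<union> A 2. \<forall>b'\<in>A 1 \<union> A 2. cip M b' (X b) = (if b' = b then 1 else 0)" ..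
  note X = X0[rule_format]
  \<comment> \<open>Duality of the beams with vectors of the eigenspace becomes a statement about
    the images of the beams under U_k^H; this is the form in which it certifies their independence
    at the receiver.\<close>
  have "\<exists>Y. \<forall>k\<in>{1,2}. \<forall>b'\<in>A k. \<forall>x. cip M b' x = (\<Sum>a<r k. Y k b' a * (\<Sum>i<M. cnj (U k (i, a)) * x i))"
  proof (intro bchoice ballI)
    fix k b' assume k: "k \<in> {1,2}" and b': "b' \<in> A k"
    have "b' \<in> eigenspace M (r k) (U k)" using A[OF k] b' unfolding V_def by blast
    then show "\<exists>y. \<forall>x. cip M b' x = (\<Sum>a<r k. y a * (\<Sum>i<M. cnj (U k (i, a)) * x i))"
      by (rule eigenspace_coordinates)
  qed
  then obtain Y where Y0: "\<forall>k\<in>{1,2}. \<forall>b'\<in>A k. \<forall>x.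
      cip M b' x = (\<Sum>a<r k. Y k b' a * (\<Sum>i<M. cnj (U k (i, a)) * x i))" ..
  note Y = Y0[rule_format]
  define B where "B k = A k - B0" for k
  have AB: "B0 \<union> B k = A k" if "k \<in> {1,2}" for k using A[OF that] by (auto simp: B_def)
  have finB0: "finite B0" using finA[of 1] A[of 1] finite_subset by auto
  show ?thesis
  proof (rule that[of B0 B X Y])
    show "card B0 = cdim (eigenspace M (r 1) (U 1) \<inter> eigenspace M (r 2) (U 2))"
      using B0(4) by (simp add: cdim_def V_def)
    show "card B0 + card (B k) = r k" if "k \<in> {1,2}" for k
      unfolding B_def using A[OF that] finA[OF that] cardA[OF that] finB0 card_mono[of "A k" B0]
      by (subst card_Diff_subset) auto
    show "(\<Sum>m<M. cnj (U k (m, a)) * X b m) = 0"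
      if k: "k \<in> {1,2}" and b: "b \<in> (B 1 \<union> B 2) - B k" and a: "a < r k" for k b a
    proof -
      have bA: "b \<in> A 1 \<union> A 2" "b \<notin> A k" using b by (auto simp: B_def)
      \<comment> \<open>A beam dual to a vector outside \<open>A k\<close> is orthogonal to all of
        \<open>A k\<close>, hence to its span, which contains the columns of U_k.\<close>
      have "cip M b' (X b) = 0" if "b' \<in> A k" for b'
        using X[OF bA(1), of b'] that bA k by auto
      then have "cip M w (X b) = 0" if "w \<in> cvec.span (A k)" for w
        using cip_orthogonal_span that by blast
      moreover have "Defs.col M (U k) a \<in> cvec.span (A k)"
      proof -
        have "Defs.col M (U k) a \<in> V k" using a by (auto simp: V_def eigenspace_def intro: cvec.span_base)
        then show ?thesis using A[OF k] by blast
      qed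
      ultimately show ?thesis by (simp add: cip_col[symmetric])
    qed
    show "(\<Sum>a<r k. Y k b' a * (\<Sum>m<M. cnj (U k (m, a)) * X b m)) = (if b' = b then 1 else 0)"
      if k: "k \<in> {1,2}" and b: "b \<in> B0 \<union> B k" "b' \<in> B0 \<union> B k" for k b b'
      using Y[OF k, of b' "X b"] X[of b b'] b k unfolding AB[OF k] by auto
  qed (use finA finB0 int in \<open>auto simp: B_def\<close>)
qed

section \<open>Minimum distance detection\<close>

text \<open>The events decrease as the amplitude n grows, and their intersection lies in the null
  set \<delta> = 0; continuity of the measure from above gives the limit, without a rate. The factor
  2 leaves room for the noise in the residuals of both the right and a wrong candidate.\<close>

lemma noise_margin_tendsto:
  assumes c: "corr_user M N r U \<sigma> g"
    and \<delta>[measurable]: "\<delta> \<in> borel_measurable (Gspace N r)" and \<delta>0: "\<And>G. \<delta> G \<ge> (0::real)"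
    and pos: "AE G in Gspace N r. \<delta> G > 0"
  shows "(\<lambda>n. measure (use_space N r g) {\<omega> \<in> space (use_space N r g).
      real n * \<delta> (fst \<omega>) \<le> 2 * (\<Sum>i<N. cmod (snd \<omega> i))}) \<longlonglongrightarrow> 0"
proof -
  let ?P = "use_space N r g" and ?D = "density (Gspace N r) (\<lambda>G. ennreal (g G))"
  interpret P: prob_space ?P by (rule prob_space_use_space[OF c])
  interpret W: prob_space "noise_space N" by (rule prob_space_noise_space)
  have g[measurable]: "g \<in> borel_measurable (Gspace N r)" using c by (simp add: corr_user_def)
  define Bad where "Bad n = {\<omega> \<in> space ?P. real n * \<delta> (fst \<omega>) \<le> 2 * (\<Sum>i<N. cmod (snd \<omega> i))}" for n
  have w[measurable]: "(\<lambda>\<omega>. snd \<omega> i) \<in> borel_measurable ?P" if "i < N" for i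
    by (rule borel_measurable_use_space_snd[OF that])
  have d[measurable]: "(\<lambda>\<omega>. \<delta> (fst \<omega>)) \<in> borel_measurable ?P"
    unfolding use_space_def by measurable
  have Bad[measurable]: "Bad n \<in> sets ?P" for n unfolding Bad_def by measurable
  have dec: "decseq Bad"
  proof (rule decseq_SucI)
    fix n
    have "real n * \<delta> G \<le> real (Suc n) * \<delta> G" for G using \<delta>0[of G] by (intro mult_right_mono) auto
    then show "Bad (Suc n) \<subseteq> Bad n" unfolding Bad_def using order.trans by blast
  qed
  let ?Z = "{G \<in> space ?D. \<delta> G = 0}"
  have Z: "?Z \<in> sets ?D" by measurable
  have "AE G in ?D. \<delta> G > 0" using pos by (subst AE_density) auto
  then have "AE G in ?D. \<not> \<delta> G = 0" by eventually_elim auto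
  then have Z0: "emeasure ?D ?Z = 0" using Z by (subst (asm) AE_iff_measurable[of ?Z]) auto
  have sub: "(\<Inter>n. Bad n) \<subseteq> ?Z \<times> space (noise_space N)"
  proof
    fix \<omega> assume \<omega>: "\<omega> \<in> (\<Inter>n. Bad n)"
    have "\<delta> (fst \<omega>) = 0"
    proof (rule ccontr)
      assume "\<delta> (fst \<omega>) \<noteq> 0"
      then have p: "\<delta> (fst \<omega>) > 0" using \<delta>0[of "fst \<omega>"] by simp
      obtain n :: nat where "real n * \<delta> (fst \<omega>) > 2 * (\<Sum>i<N. cmod (snd \<omega> i))"
        using reals_Archimedean3[OF p] by blast
      moreover have "\<omega> \<in> Bad n" using \<omega> by blast
      ultimately show False by (simp add: Bad_def)
    qed
    moreover have "\<omega> \<in> space ?P" using \<omega> by (auto simp: Bad_def)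
    ultimately show "\<omega> \<in> ?Z \<times> space (noise_space N)"
      by (auto simp: use_space_def space_pair_measure)
  qed
  have "emeasure ?P (\<Inter>n. Bad n) \<le> emeasure ?P (?Z \<times> space (noise_space N))"
    using sub Z by (intro emeasure_mono) (auto simp: use_space_def)
  also have "\<dots> = 0"
    unfolding use_space_def using Z Z0 by (subst W.emeasure_pair_measure_Times) auto
  finally have "measure ?P (\<Inter>n. Bad n) = 0" by (simp add: measure_def)
  moreover have "(\<lambda>n. measure ?P (Bad n)) \<longlonglongrightarrow> measure ?P (\<Inter>n. Bad n)"
    using dec by (intro Lim_measure_decseq) auto
  ultimately show ?thesis unfolding Bad_def by simp
qed

lemma full_rank_lower_bound_set:
  fixes u Y :: "'b \<Rightarrow> nat \<Rightarrow> complex"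
  assumes S: "finite S" "card S \<le> N"
    and dual: "\<And>b b'. b \<in> S \<Longrightarrow> b' \<in> S \<Longrightarrow> (\<Sum>a<r. Y b' a * u b a) = (if b' = b then 1 else 0)"
  obtains \<delta> :: "(nat \<times> nat \<Rightarrow> complex) \<Rightarrow> real" where
    "\<delta> \<in> borel_measurable (Gspace N r)" "\<And>G. \<delta> G \<ge> 0" "AE G in Gspace N r. \<delta> G > 0"
    "\<And>G c b. b \<in> S \<Longrightarrow> \<delta> G * cmod (c b) \<le> (\<Sum>i<N. cmod (\<Sum>j\<in>S. c j * (\<Sum>a<r. G (i, a) * u j a)))"
proof -
  obtain h where h: "bij_betw h {..<card S} S"
    using ex_bij_betw_nat_finite[OF S(1)] by (auto simp: atLeast0LessThan)
  have hS: "h i \<in> S" if "i < card S" for i using h that by (auto simp: bij_betw_def)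
  have inj: "h i = h j \<longleftrightarrow> i = j" if "i < card S" "j < card S" for i j
    using h that by (auto simp: bij_betw_def inj_on_def)
  have "(\<Sum>a<r. Y (h i) a * u (h j) a) = (if i = j then 1 else 0)" if "i < card S" "j < card S" for i j
    using dual[OF hS[OF that(2)] hS[OF that(1)]] inj[OF that] by simp
  from full_rank_lower_bound[OF S(2) this]
  obtain \<delta> :: "(nat \<times> nat \<Rightarrow> complex) \<Rightarrow> real" where \<delta>: "\<delta> \<in> borel_measurable (Gspace N r)" "\<And>G. \<delta> G \<ge> 0"
    "AE G in Gspace N r. \<delta> G > 0"
    "\<And>G c b. b < card S \<Longrightarrow> \<delta> G * cmod (c b) \<le>
        (\<Sum>i<N. cmod (\<Sum>j<card S. c j * (\<Sum>a<r. G (i, a) * u (h j) a)))"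
    by blast
  show ?thesis
  proof (rule that[OF \<delta>(1-3)])
    fix G c b assume "b \<in> S"
    then obtain j where j: "j < card S" "b = h j" using h by (auto simp: bij_betw_def)
    have "\<delta> G * cmod (c (h j)) \<le> (\<Sum>i<N. cmod (\<Sum>j<card S. c (h j) * (\<Sum>a<r. G (i, a) * u (h j) a)))"
      using \<delta>(4)[OF j(1), of G "\<lambda>j. c (h j)"] .
    also have "\<dots> = (\<Sum>i<N. cmod (\<Sum>j\<in>S. c j * (\<Sum>a<r. G (i, a) * u j a)))"
      by (intro sum.cong refl arg_cong[where f = cmod] sum.reindex_bij_betw[OF h])
    finally show "\<delta> G * cmod (c b) \<le> (\<Sum>i<N. cmod (\<Sum>j\<in>S. c j * (\<Sum>a<r. G (i, a) * u j a)))"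
      by (simp add: j)
  qed
qed

text \<open>The sum of absolute values replaces the Euclidean norm; it is the norm in which
  injectivity of the channel is bounded below.\<close>

definition residual :: "nat \<Rightarrow> nat \<Rightarrow> (nat \<Rightarrow> complex) \<Rightarrow> (nat \<times> nat \<Rightarrow> complex) \<times> (nat \<Rightarrow> complex) \<Rightarrow> real" where
  "residual M N x hy = (\<Sum>i<N. cmod (snd hy i - (\<Sum>m<M. fst hy (i, m) * x m)))"

text \<open>The search runs over letter pairs, since the streams of the other user may be visible
  too, but only the user's own letter is returned. Pairs that differ in invisible streams only have
  equal residuals; such ties are harmless. \<open>LEAST\<close> makes the choice definite. The first
  component of \<open>hy\<close> is the channel matrix, so this is where CSIR enters.\<close>

definition min_dist_detect :: "nat \<Rightarrow> nat \<Rightarrow> (nat \<times> nat \<Rightarrow> nat \<Rightarrow> complex) \<Rightarrow> (nat \<times> nat) set \<Rightarrow> nat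
    \<Rightarrow> (nat \<times> nat \<Rightarrow> complex) \<times> (nat \<Rightarrow> complex) \<Rightarrow> nat" where
  "min_dist_detect M N f Q k hy =
     (LEAST v. \<exists>s\<in>Q. msg k s = v \<and> (\<forall>t\<in>Q. residual M N (f s) hy \<le> residual M N (f t) hy))"

lemma min_dist_detect_correct:
  assumes Q: "finite Q" "s \<in> Q"
    and closer: "\<And>t. t \<in> Q \<Longrightarrow> msg k t \<noteq> msg k s \<Longrightarrow> residual M N (f s) hy < residual M N (f t) hy"
  shows "min_dist_detect M N f Q k hy = msg k s"
proof -
  obtain t where t: "t \<in> Q" "\<And>t'. t' \<in> Q \<Longrightarrow> residual M N (f t) hy \<le> residual M N (f t') hy"
    using ex_min_if_finite[of "(\<lambda>t. residual M N (f t) hy) ` Q"] Q by (force simp: not_less)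
  have same: "msg k t' = msg k s" if "t' \<in> Q" "\<And>t''. t'' \<in> Q \<Longrightarrow> residual M N (f t') hy \<le> residual M N (f t'') hy" for t'
    using closer[OF that(1)] that(2)[OF Q(2)] by fastforce
  show ?thesis
    unfolding min_dist_detect_def
  proof (rule Least_equality)
    show "\<exists>s'\<in>Q. msg k s' = msg k s \<and> (\<forall>t\<in>Q. residual M N (f s') hy \<le> residual M N (f t) hy)"
      using t same[OF t] by blast
    show "msg k s \<le> v" if "\<exists>s'\<in>Q. msg k s' = v \<and> (\<forall>t\<in>Q. residual M N (f s') hy \<le> residual M N (f t) hy)" for v
      using that same by fastforce
  qed
qed

lemma measurable_min_dist_detect:
  assumes "finite Q"
  shows "(\<lambda>\<omega>. min_dist_detect M N f Q k (use_output M N r U \<sigma> x \<omega>)) \<in> use_space N r g \<rightarrow>\<^sub>M count_space UNIV"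
proof -
  have w[measurable]: "(\<lambda>\<omega>. snd \<omega> i) \<in> borel_measurable (use_space N r g)" if "i < N" for i
    by (rule borel_measurable_use_space_snd[OF that])
  have G[measurable]: "(\<lambda>\<omega>. fst \<omega> (i, a)) \<in> borel_measurable (use_space N r g)" if "i < N" "a < r" for i a
    by (rule borel_measurable_use_space_fst[OF that])
  have H: "(\<lambda>\<omega>. chan_matrix M N r U \<sigma> (fst \<omega>) (i, m)) \<in> borel_measurable (use_space N r g)" if "i < N" for i m
    unfolding chan_matrix_def using that by (auto intro!: borel_measurable_sum borel_measurable_times G)
  have res[measurable]: "(\<lambda>\<omega>. residual M N y (use_output M N r U \<sigma> x \<omega>)) \<in> borel_measurable (use_space N r g)" for y
    unfolding residual_def use_output_def received_def
    by (intro borel_measurable_sum measurable_compose[OF _ borel_measurable_norm] borel_measurable_diff)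
       (auto intro!: borel_measurable_sum borel_measurable_times borel_measurable_add H w)
  have [measurable (raw)]: "countable Q" using assms by (rule countable_finite)
  show ?thesis unfolding min_dist_detect_def using assms by measurable
qed

section \<open>Error probability of superposed streams\<close>

text \<open>n is the amplitude, and \<open>e s b\<close> is the constellation point that the letter
  pair s places on beam b with direction \<open>X b\<close>.\<close>

definition superpose :: "'b set \<Rightarrow> ('b \<Rightarrow> nat \<Rightarrow> complex) \<Rightarrow> nat \<Rightarrow> (nat \<times> nat \<Rightarrow> 'b \<Rightarrow> complex)
    \<Rightarrow> nat \<times> nat \<Rightarrow> nat \<Rightarrow> complex" where
  "superpose S X n e s = (\<lambda>m. of_nat n * (\<Sum>b\<in>S. e s b * X b m))"

lemma chan_matrix_superpose:
  assumes "i < N"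
  shows "(\<Sum>m<M. chan_matrix M N r U \<sigma> G (i, m) * superpose S X n e s m) =
     of_nat n * (\<Sum>b\<in>S. e s b * (\<Sum>a<r. G (i, a) * (complex_of_real (sqrt (\<sigma> a)) * (\<Sum>m<M. cnj (U (m, a)) * X b m))))"
proof -
  have "(\<Sum>m<M. chan_matrix M N r U \<sigma> G (i, m) * superpose S X n e s m)
     = (\<Sum>m<M. \<Sum>b\<in>S. \<Sum>a<r. of_nat n * (e s b * (G (i, a) * (complex_of_real (sqrt (\<sigma> a)) * (cnj (U (m, a)) * X b m)))))"
    using assms by (intro sum.cong refl)
      (simp add: chan_matrix_def superpose_def sum_distrib_left sum_distrib_right mult_ac, rule sum.swap)
  also have "\<dots> = (\<Sum>b\<in>S. \<Sum>a<r. \<Sum>m<M. of_nat n * (e s b * (G (i, a) * (complex_of_real (sqrt (\<sigma> a)) * (cnj (U (m, a)) * X b m)))))"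
    by (subst sum.swap) (intro sum.cong refl sum.swap)
  also have "\<dots> = of_nat n * (\<Sum>b\<in>S. e s b * (\<Sum>a<r. G (i, a) * (complex_of_real (sqrt (\<sigma> a)) * (\<Sum>m<M. cnj (U (m, a)) * X b m))))"
    by (simp add: sum_distrib_left)
  finally show ?thesis .
qed

text \<open>\<open>Ow\<close> are the streams with data for the user, \<open>Vis\<close> those that
  reach it and \<open>S\<close> all streams. The bound p n is fixed before \<open>Q\<close> and
  \<open>e\<close>: the constellation enters only through its unit spacing on \<open>Ow\<close>, so
  it may grow with the SNR. A user without streams has a constant message and no rank condition to
  meet; this lets the other user use dimensions that the idle one could not resolve.\<close>

lemma detection_error_vanishes:
  fixes X Y :: "'b \<Rightarrow> nat \<Rightarrow> complex"
  assumes c: "corr_user M N r U \<sigma> g" and S: "finite S" "Ow \<subseteq> Vis" "Vis \<subseteq> S"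
    and invisible: "\<And>b a. b \<in> S - Vis \<Longrightarrow> a < r \<Longrightarrow> (\<Sum>m<M. cnj (U (m, a)) * X b m) = 0"
    and rank: "Ow = {} \<or> (card Vis \<le> N \<and> (\<forall>b\<in>Vis. \<forall>b'\<in>Vis.
        (\<Sum>a<r. Y b' a * (\<Sum>m<M. cnj (U (m, a)) * X b m)) = (if b' = b then 1 else 0)))"
  obtains p where "p \<longlonglongrightarrow> 0" "\<And>n. 0 \<le> p n"
    "\<And>n Q e s. finite Q \<Longrightarrow> s \<in> Q \<Longrightarrow>
       (\<And>s t. s \<in> Q \<Longrightarrow> t \<in> Q \<Longrightarrow> msg k s \<noteq> msg k t \<Longrightarrow> \<exists>b\<in>Ow. 1 \<le> cmod (e s b - e t b)) \<Longrightarrow>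
       measure (use_space N r g) {\<omega> \<in> space (use_space N r g).
         min_dist_detect M N (superpose S X n e) Q k (use_output M N r U \<sigma> (superpose S X n e s) \<omega>) \<noteq> msg k s} \<le> p n"
proof (cases "Ow = {}")
  case True
  show ?thesis
  proof (rule that[of "\<lambda>_. 0"])
    fix n Q e s assume Q: "finite Q" "s \<in> Q"
      and e: "\<And>s t. s \<in> Q \<Longrightarrow> t \<in> Q \<Longrightarrow> msg k s \<noteq> msg k t \<Longrightarrow> \<exists>b\<in>Ow. 1 \<le> cmod (e s b - e t b :: complex)"
    have "min_dist_detect M N (superpose S X n e) Q k hy = msg k s" for hy
      by (rule min_dist_detect_correct[OF Q]) (use e[OF Q(2)] True in fastforce)
    then show "measure (use_space N r g) {\<omega> \<in> space (use_space N r g).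
         min_dist_detect M N (superpose S X n e) Q k (use_output M N r U \<sigma> (superpose S X n e s) \<omega>) \<noteq> msg k s} \<le> 0"
      by simp
  qed auto
next
  case False
  with rank have V: "card Vis \<le> N" and dual: "\<And>b b'. b \<in> Vis \<Longrightarrow> b' \<in> Vis \<Longrightarrow>
        (\<Sum>a<r. Y b' a * (\<Sum>m<M. cnj (U (m, a)) * X b m)) = (if b' = b then 1 else 0)" by auto
  have \<sigma>: "\<sigma> a > 0" if "a < r" for a using c that by (auto simp: corr_user_def)
  define u where "u b a = complex_of_real (sqrt (\<sigma> a)) * (\<Sum>m<M. cnj (U (m, a)) * X b m)" for b a
  \<comment> \<open>The positive factors sqrt(\<sigma> a) of the channel are absorbed into the
    images of the beams and divided out of the dual functionals.\<close>
  define Y' where "Y' b a = Y b a / complex_of_real (sqrt (\<sigma> a))" for b a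
  have finV: "finite Vis" using S finite_subset by blast
  have "(\<Sum>a<r. Y' b' a * u b a) = (if b' = b then 1 else 0)" if "b \<in> Vis" "b' \<in> Vis" for b b'
  proof -
    have "(\<Sum>a<r. Y' b' a * u b a) = (\<Sum>a<r. Y b' a * (\<Sum>m<M. cnj (U (m, a)) * X b m))"
      using \<sigma> by (intro sum.cong refl) (force simp: Y'_def u_def)
    then show ?thesis using dual[OF that] by simp
  qed
  from full_rank_lower_bound_set[OF finV V this]
  obtain \<delta> :: "(nat \<times> nat \<Rightarrow> complex) \<Rightarrow> real" where \<delta>: "\<delta> \<in> borel_measurable (Gspace N r)" "\<And>G. \<delta> G \<ge> 0"
    "AE G in Gspace N r. \<delta> G > 0"
    "\<And>G c b. b \<in> Vis \<Longrightarrow> \<delta> G * cmod (c b) \<le> (\<Sum>i<N. cmod (\<Sum>j\<in>Vis. c j * (\<Sum>a<r. G (i, a) * u j a)))"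
    by blast
  let ?P = "use_space N r g"
  interpret P: prob_space ?P by (rule prob_space_use_space[OF c])
  define Bad where "Bad n = {\<omega> \<in> space ?P. real n * \<delta> (fst \<omega>) \<le> 2 * (\<Sum>i<N. cmod (snd \<omega> i))}" for n
  have Bads: "Bad n \<in> sets ?P" for n
  proof -
    note [measurable] = \<delta>(1)
    have [measurable]: "(\<lambda>\<omega>. snd \<omega> i) \<in> borel_measurable ?P" if "i < N" for i
      by (rule borel_measurable_use_space_snd[OF that])
    have [measurable]: "(\<lambda>\<omega>. \<delta> (fst \<omega>)) \<in> borel_measurable ?P" unfolding use_space_def by measurable
    show ?thesis unfolding Bad_def by measurable
  qed
  show ?thesis
  proof (rule that[of "\<lambda>n. measure ?P (Bad n)"])
    show "(\<lambda>n. measure ?P (Bad n)) \<longlonglongrightarrow> 0"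
      unfolding Bad_def by (rule noise_margin_tendsto[OF c \<delta>(1-3)])
    fix n Q e s assume Q: "finite Q" "s \<in> Q"
      and e: "\<And>s t. s \<in> Q \<Longrightarrow> t \<in> Q \<Longrightarrow> msg k s \<noteq> msg k t \<Longrightarrow> \<exists>b\<in>Ow. 1 \<le> cmod (e s b - e t b :: complex)"
    let ?f = "superpose S X n e"
    have "min_dist_detect M N ?f Q k (use_output M N r U \<sigma> (?f s) \<omega>) = msg k s"
      if \<omega>: "\<omega> \<in> space ?P" "\<omega> \<notin> Bad n" for \<omega>
    proof (rule min_dist_detect_correct[OF Q])
      fix t assume t: "t \<in> Q" "msg k t \<noteq> msg k s"
      obtain b where b: "b \<in> Ow" "1 \<le> cmod (e s b - e t b)" using e[OF Q(2) t(1)] t(2) by metis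
      define G where "G = fst \<omega>"
      define W where "W = (\<Sum>i<N. cmod (snd \<omega> i))"
      let ?H = "chan_matrix M N r U \<sigma> G"
      define d where "d i = of_nat n * (\<Sum>b\<in>Vis. (e s b - e t b) * (\<Sum>a<r. G (i, a) * u b a))" for i
      have diff: "(\<Sum>m<M. ?H (i, m) * ?f s m) - (\<Sum>m<M. ?H (i, m) * ?f t m) = d i" if "i < N" for i
      proof -
        have "(\<Sum>m<M. ?H (i, m) * ?f s m) - (\<Sum>m<M. ?H (i, m) * ?f t m)
            = of_nat n * (\<Sum>b\<in>S. (e s b - e t b) * (\<Sum>a<r. G (i, a) * u b a))"
          unfolding chan_matrix_superpose[OF that] u_def
          by (simp add: left_diff_distrib right_diff_distrib sum_subtractf)
        \<comment> \<open>Streams outside \<open>Vis\<close> are annihilated by U^H and drop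
          out.\<close>
        also have "(\<Sum>b\<in>S. (e s b - e t b) * (\<Sum>a<r. G (i, a) * u b a))
            = (\<Sum>b\<in>Vis. (e s b - e t b) * (\<Sum>a<r. G (i, a) * u b a))"
          using S invisible by (intro sum.mono_neutral_right) (auto simp: u_def)
        finally show ?thesis by (simp add: d_def)
      qed
      \<comment> \<open>Outside the bad event two candidates with different own letters have images
        more than 2 W apart, W being the size of the noise. So the residual of the wrong one exceeds
        W, which is the residual of the right one.\<close>
      have W2: "real n * \<delta> G > 2 * W" using \<omega> by (auto simp: Bad_def W_def G_def)
      have "real n * \<delta> G \<le> real n * (\<delta> G * cmod (e s b - e t b))"
        using b(2) \<delta>(2)[of G] by (intro mult_left_mono) (auto simp: mult_le_cancel_left1)
      also have "\<dots> \<le> real n * (\<Sum>i<N. cmod (\<Sum>b\<in>Vis. (e s b - e t b) * (\<Sum>a<r. G (i, a) * u b a)))"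
        using b(1) S(2) \<delta>(4)[of b G "\<lambda>b. e s b - e t b"] by (intro mult_left_mono) auto
      also have "\<dots> = (\<Sum>i<N. cmod (d i))" by (simp only: d_def norm_mult norm_of_nat sum_distrib_left[of "real n"])
      finally have d: "real n * \<delta> G \<le> (\<Sum>i<N. cmod (d i))" .
      have rs: "residual M N (?f s) (use_output M N r U \<sigma> (?f s) \<omega>) = W"
        unfolding residual_def use_output_def received_def W_def by simp
      have "(\<Sum>i<N. cmod (d i)) - W \<le> residual M N (?f t) (use_output M N r U \<sigma> (?f s) \<omega>)"
        unfolding W_def residual_def use_output_def received_def sum_subtractf[symmetric]
      proof (intro sum_mono)
        fix i assume "i \<in> {..<N}"
        then have i: "i < N" by simp
        have "cmod (d i) - cmod (snd \<omega> i) \<le> cmod (d i + snd \<omega> i)" by (metis norm_diff_ineq)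
        also have "d i + snd \<omega> i = (\<Sum>m<M. ?H (i, m) * ?f s m) + snd \<omega> i - (\<Sum>m<M. ?H (i, m) * ?f t m)"
          using diff[OF i] by (simp add: algebra_simps)
        finally show "cmod (d i) - cmod (snd \<omega> i) \<le> cmod (snd (chan_matrix M N r U \<sigma> (fst \<omega>),
             \<lambda>i. if i < N then (\<Sum>m<M. chan_matrix M N r U \<sigma> (fst \<omega>) (i, m) * ?f s m) + snd \<omega> i else 0) i -
             (\<Sum>m<M. fst (chan_matrix M N r U \<sigma> (fst \<omega>),
             \<lambda>i. if i < N then (\<Sum>m<M. chan_matrix M N r U \<sigma> (fst \<omega>) (i, m) * ?f s m) + snd \<omega> i else 0) (i, m) * ?f t m))"
          using i by (simp add: G_def)
      qed
      with d W2 rs show "residual M N (?f s) (use_output M N r U \<sigma> (?f s) \<omega>)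
          < residual M N (?f t) (use_output M N r U \<sigma> (?f s) \<omega>)" by linarith
    qed
    then have "{\<omega> \<in> space ?P. min_dist_detect M N ?f Q k (use_output M N r U \<sigma> (?f s) \<omega>) \<noteq> msg k s} \<subseteq> Bad n"
      by blast
    then show "measure ?P {\<omega> \<in> space ?P. min_dist_detect M N ?f Q k (use_output M N r U \<sigma> (?f s) \<omega>) \<noteq> msg k s}
        \<le> measure ?P (Bad n)"
      using Bads by (intro P.finite_measure_mono) auto
  qed auto
qed

section \<open>Superposed QAM streams\<close>

text \<open>An uncentred grid of Q^2 points with unit spacing; its power is of order Q^2, and
  constant factors in the power do not change the degrees of freedom.\<close>

definition qam :: "nat \<Rightarrow> complex set" where
  "qam Q = (\<lambda>(x, y). Complex (real x) (real y)) ` ({..<Q} \<times> {..<Q})"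

lemma card_qam: "card (qam Q) = Q * Q"
  unfolding qam_def by (subst card_image) (auto simp: inj_on_def)

lemma finite_qam: "finite (qam Q)"
  by (simp add: qam_def)

lemma qam_separated:
  assumes "z \<in> qam Q" "z' \<in> qam Q" "z \<noteq> z'"
  shows "1 \<le> cmod (z - z')"
proof -
  obtain x y x' y' where z: "z = Complex (real x) (real y)" "z' = Complex (real x') (real y')"
    using assms by (auto simp: qam_def)
  have "x \<noteq> x' \<or> y \<noteq> y'" using assms z by auto
  then have "\<bar>Re (z - z')\<bar> \<ge> 1 \<or> \<bar>Im (z - z')\<bar> \<ge> 1" by (auto simp: z)
  then show ?thesis using abs_Re_le_cmod[of "z - z'"] abs_Im_le_cmod[of "z - z'"] by linarith
qed

lemma qam_bounded:
  assumes "z \<in> qam Q" shows "cmod z \<le> 2 * real Q"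
proof -
  obtain x y where z: "z = Complex (real x) (real y)" "x < Q" "y < Q" using assms by (auto simp: qam_def)
  show ?thesis using cmod_le[of z] z by simp
qed

text \<open>A letter of user k is a tuple of QAM points, one for each stream in \<open>Ow k\<close>.
  Distinct tuples differ on some owned stream, there by at least 1, which is the separation that
  \<open>err\<close> asks for. The power bound is the triangle inequality over the beams; its factor
  2 comes from \<open>qam_bounded\<close>.\<close>

lemma qam_symbol_scheme:
  fixes X :: "'b \<Rightarrow> nat \<Rightarrow> complex"
  assumes S: "S = Ow 1 \<union> Ow 2" "Ow 1 \<inter> Ow 2 = {}" "finite S"
    and err: "\<And>k Q e s. k \<in> {1,2} \<Longrightarrow> finite Q \<Longrightarrow> s \<in> Q \<Longrightarrow>
       (\<And>s t. s \<in> Q \<Longrightarrow> t \<in> Q \<Longrightarrow> msg k s \<noteq> msg k t \<Longrightarrow> \<exists>b\<in>Ow k. 1 \<le> cmod (e s b - e t b)) \<Longrightarrow>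
       measure (use_space (N k) (r k) (g k)) {\<omega> \<in> space (use_space (N k) (r k) (g k)).
         min_dist_detect M (N k) (superpose S X n e) Q k
           (use_output M (N k) (r k) (U k) (\<sigma> k) (superpose S X n e s) \<omega>) \<noteq> msg k s} \<le> p"
    and Q: "Q \<ge> 1"
    and power: "(real n * real Q)\<^sup>2 * (\<Sum>m<M. (2 * (\<Sum>b\<in>S. cmod (X b m)))\<^sup>2) \<le> \<rho>"
  obtains f D where "symbol_scheme M N r U \<sigma> g \<rho> p (\<lambda>k. (Q * Q) ^ card (Ow k)) f D"
proof -
  define q where "q k = (Q * Q) ^ card (Ow k)" for k
  have finO: "finite (Ow k)" if "k \<in> {1,2}" for k using S that by auto
  have "\<exists>E. bij_betw E {..<q k} (\<Pi>\<^sub>E b\<in>Ow k. qam Q)" if "k \<in> {1,2}" for k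
  proof -
    have "card (\<Pi>\<^sub>E b\<in>Ow k. qam Q) = q k"
      using finO[OF that] by (simp add: card_PiE card_qam q_def)
    then show ?thesis
      using ex_bij_betw_nat_finite[of "\<Pi>\<^sub>E b\<in>Ow k. qam Q"] finO[OF that] finite_qam
      by (auto simp: atLeast0LessThan finite_PiE)
  qed
  then obtain E where E: "\<And>k. k \<in> {1,2} \<Longrightarrow> bij_betw (E k) {..<q k} (\<Pi>\<^sub>E b\<in>Ow k. qam Q)" by metis
  have E1: "E k v \<in> (\<Pi>\<^sub>E b\<in>Ow k. qam Q)" if "k \<in> {1,2}" "v < q k" for k v
    using E[OF that(1)] that(2) by (auto simp: bij_betw_def)
  define e where "e s b = (if b \<in> Ow 1 then E 1 (fst s) b else E 2 (snd s) b)" for s :: "nat \<times> nat" and b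
  let ?S = "{..<q 1} \<times> {..<q 2}"
  have e_eq: "e s b = E k (msg k s) b" if "k \<in> {1,2}" "b \<in> Ow k" for k s b
    using that S by (auto simp: e_def msg_def)
  have msg_q: "msg k s < q k" if "k \<in> {1,2}" "s \<in> ?S" for k s
    using that by (auto simp: msg_def)
  have sep: "\<exists>b\<in>Ow k. 1 \<le> cmod (e s b - e t b)"
    if k: "k \<in> {1,2}" and st: "s \<in> ?S" "t \<in> ?S" "msg k s \<noteq> msg k t" for k s t
  proof -
    have "E k (msg k s) \<noteq> E k (msg k t)"
      using E[OF k] msg_q[OF k st(1)] msg_q[OF k st(2)] st(3) by (auto simp: bij_betw_def inj_on_def)
    then obtain b where b: "E k (msg k s) b \<noteq> E k (msg k t) b" by auto
    have "b \<in> Ow k"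
      using b E1[OF k msg_q[OF k st(1)]] E1[OF k msg_q[OF k st(2)]] by (force simp: PiE_def extensional_def)
    moreover have "1 \<le> cmod (E k (msg k s) b - E k (msg k t) b)"
      using \<open>b \<in> Ow k\<close> b E1[OF k msg_q[OF k st(1)]] E1[OF k msg_q[OF k st(2)]]
      by (intro qam_separated[of _ Q]) auto
    ultimately show ?thesis using e_eq[OF k] by (intro bexI[of _ b]) simp_all
  qed
  have e_bound: "cmod (e s b) \<le> 2 * real Q" if s: "s \<in> ?S" and b: "b \<in> S" for s b
  proof -
    obtain k :: nat where k: "k \<in> {1,2}" "b \<in> Ow k" using b S(1) by blast
    then have "e s b \<in> qam Q" using E1[OF k(1) msg_q[OF k(1) s]] e_eq[OF k] k(2) by (metis PiE_mem)
    then show ?thesis by (rule qam_bounded)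
  qed
  let ?f = "superpose S X n e"
  have pw: "(\<Sum>m<M. (cmod (?f s m))\<^sup>2) \<le> \<rho>" if s: "s \<in> ?S" for s
  proof -
    have "(\<Sum>m<M. (cmod (?f s m))\<^sup>2) \<le> (\<Sum>m<M. (real n * real Q)\<^sup>2 * (2 * (\<Sum>b\<in>S. cmod (X b m)))\<^sup>2)"
    proof (intro sum_mono)
      fix m
      have "cmod (\<Sum>b\<in>S. e s b * X b m) \<le> (\<Sum>b\<in>S. 2 * real Q * cmod (X b m))"
        by (rule sum_norm_le) (auto simp: norm_mult intro!: mult_right_mono e_bound s)
      also have "\<dots> = 2 * real Q * (\<Sum>b\<in>S. cmod (X b m))" by (simp add: sum_distrib_left)
      finally have le: "cmod (\<Sum>b\<in>S. e s b * X b m) \<le> 2 * real Q * (\<Sum>b\<in>S. cmod (X b m))" .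
      have "cmod (?f s m) = real n * cmod (\<Sum>b\<in>S. e s b * X b m)"
        by (simp add: superpose_def norm_mult)
      also have "\<dots> \<le> real n * (2 * real Q * (\<Sum>b\<in>S. cmod (X b m)))" by (intro mult_left_mono le) auto
      finally have "(cmod (?f s m))\<^sup>2 \<le> (real n * (2 * real Q * (\<Sum>b\<in>S. cmod (X b m))))\<^sup>2"
        by (intro power_mono) auto
      then show "(cmod (?f s m))\<^sup>2 \<le> (real n * real Q)\<^sup>2 * (2 * (\<Sum>b\<in>S. cmod (X b m)))\<^sup>2"
        by (simp add: power_mult_distrib mult_ac)
    qed
    then show ?thesis using power by (simp add: sum_distrib_left)
  qed
  have "symbol_scheme M N r U \<sigma> g \<rho> p q ?f (\<lambda>k. min_dist_detect M (N k) ?f ?S k)"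
    unfolding symbol_scheme_def
  proof (intro conjI ballI)
    show "q k \<ge> 1" for k using Q by (simp add: q_def Suc_le_eq)
    show "(\<Sum>m<M. (cmod (?f s m))\<^sup>2) \<le> \<rho>" if "s \<in> ?S" for s by (rule pw[OF that])
    fix k s assume k: "k \<in> {1::nat,2}" and s: "s \<in> ?S"
    show "(\<lambda>\<omega>. min_dist_detect M (N k) ?f ?S k (use_output M (N k) (r k) (U k) (\<sigma> k) (?f s) \<omega>))
        \<in> use_space (N k) (r k) (g k) \<rightarrow>\<^sub>M count_space UNIV"
      by (rule measurable_min_dist_detect) simp
    show "measure (use_space (N k) (r k) (g k)) {\<omega> \<in> space (use_space (N k) (r k) (g k)).
         min_dist_detect M (N k) ?f ?S k (use_output M (N k) (r k) (U k) (\<sigma> k) (?f s) \<omega>) \<noteq> msg k s} \<le> p"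
      by (rule err[OF k _ s sep[OF k]]) simp_all
  qed
  then show ?thesis using that unfolding q_def by blast
qed

text \<open>The amplitude \<open>\<lfloor>ln \<rho>\<rfloor>\<close> eventually beats the noise, yet it is too small to cost degrees of freedom.\<close>

lemma qam_size_asymptotics:
  fixes D :: real
  assumes D: "D > 0"
  shows "filterlim (\<lambda>\<rho>::real. nat \<lfloor>ln \<rho>\<rfloor>) at_top at_top"
    and "\<forall>\<^sub>F \<rho> in at_top. nat \<lfloor>sqrt \<rho> / (D * real (nat \<lfloor>ln \<rho>\<rfloor>))\<rfloor> \<ge> 1"
    and "\<forall>\<^sub>F \<rho> in at_top. (real (nat \<lfloor>ln \<rho>\<rfloor>) * real (nat \<lfloor>sqrt \<rho> / (D * real (nat \<lfloor>ln \<rho>\<rfloor>))\<rfloor>) * D)\<^sup>2 \<le> \<rho>"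
    and "((\<lambda>\<rho>. ln (real (nat \<lfloor>sqrt \<rho> / (D * real (nat \<lfloor>ln \<rho>\<rfloor>))\<rfloor>)) / ln \<rho>) \<longlongrightarrow> 1 / 2) at_top"
proof -
  show lim: "filterlim (\<lambda>\<rho>::real. nat \<lfloor>ln \<rho>\<rfloor>) at_top at_top" by real_asymp
  have "filterlim (\<lambda>\<rho>::real. nat \<lfloor>sqrt \<rho> / (D * real (nat \<lfloor>ln \<rho>\<rfloor>))\<rfloor>) at_top at_top"
    using D by real_asymp
  then show "\<forall>\<^sub>F \<rho> in at_top. nat \<lfloor>sqrt \<rho> / (D * real (nat \<lfloor>ln \<rho>\<rfloor>))\<rfloor> \<ge> 1"
    by (simp only: filterlim_at_top)
  show "((\<lambda>\<rho>. ln (real (nat \<lfloor>sqrt \<rho> / (D * real (nat \<lfloor>ln \<rho>\<rfloor>))\<rfloor>)) / ln \<rho>) \<longlongrightarrow> 1 / 2) at_top"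
    using D by real_asymp
  have "\<forall>\<^sub>F \<rho>::real in at_top. nat \<lfloor>ln \<rho>\<rfloor> \<ge> 1" using lim by (simp only: filterlim_at_top)
  moreover have "\<forall>\<^sub>F \<rho>::real in at_top. \<rho> \<ge> 0" by (rule eventually_ge_at_top)
  ultimately show "\<forall>\<^sub>F \<rho> in at_top. (real (nat \<lfloor>ln \<rho>\<rfloor>) * real (nat \<lfloor>sqrt \<rho> / (D * real (nat \<lfloor>ln \<rho>\<rfloor>))\<rfloor>) * D)\<^sup>2 \<le> \<rho>"
  proof eventually_elim
    case (elim \<rho>)
    define n where "n = real (nat \<lfloor>ln \<rho>\<rfloor>)"
    have n: "n > 0" using elim(1) unfolding n_def by linarith
    have "real (nat \<lfloor>sqrt \<rho> / (D * n)\<rfloor>) \<le> sqrt \<rho> / (D * n)" using elim(2) n D by (intro of_nat_floor) auto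
    then have "n * real (nat \<lfloor>sqrt \<rho> / (D * n)\<rfloor>) * D \<le> sqrt \<rho>" using n D by (simp add: field_simps)
    then have "(n * real (nat \<lfloor>sqrt \<rho> / (D * n)\<rfloor>) * D)\<^sup>2 \<le> (sqrt \<rho>)\<^sup>2" using n D by (intro power_mono) auto
    then show ?case using elim(2) by (simp add: n_def)
  qed
qed

text \<open>Each stream carries Q^2 points with Q of order sqrt \<rho> / ln \<rho>, so its
  logarithmic alphabet size divided by ln \<rho> tends to 1: one degree of freedom per
  stream.\<close>

lemma streams_in_scheme_dofs:
  fixes X :: "'b \<Rightarrow> nat \<Rightarrow> complex" and Y :: "nat \<Rightarrow> 'b \<Rightarrow> nat \<Rightarrow> complex"
  assumes c: "\<And>k. k \<in> {1,2} \<Longrightarrow> corr_user M (N k) (r k) (U k) (\<sigma> k) (g k)"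
    and S: "S = Ow 1 \<union> Ow 2" "Ow 1 \<inter> Ow 2 = {}" "finite S"
    and Vis: "\<And>k. k \<in> {1,2} \<Longrightarrow> Ow k \<subseteq> Vis k" "\<And>k. k \<in> {1,2} \<Longrightarrow> Vis k \<subseteq> S"
    and invisible: "\<And>k b a. k \<in> {1,2} \<Longrightarrow> b \<in> S - Vis k \<Longrightarrow> a < r k \<Longrightarrow> (\<Sum>m<M. cnj (U k (m, a)) * X b m) = 0"
    and rank: "\<And>k. k \<in> {1,2} \<Longrightarrow> Ow k = {} \<or> (card (Vis k) \<le> N k \<and> (\<forall>b\<in>Vis k. \<forall>b'\<in>Vis k.
        (\<Sum>a<r k. Y k b' a * (\<Sum>m<M. cnj (U k (m, a)) * X b m)) = (if b' = b then 1 else 0)))"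
  shows "(real (card (Ow 1)), real (card (Ow 2))) \<in> scheme_dofs M N r U \<sigma> g"
proof -
  have "\<exists>p. p \<longlonglongrightarrow> 0 \<and> (\<forall>n. 0 \<le> p n) \<and> (\<forall>n Q e s. finite Q \<longrightarrow> s \<in> Q \<longrightarrow>
       (\<forall>s\<in>Q. \<forall>t\<in>Q. msg k s \<noteq> msg k t \<longrightarrow> (\<exists>b\<in>Ow k. 1 \<le> cmod (e s b - e t b))) \<longrightarrow>
       measure (use_space (N k) (r k) (g k)) {\<omega> \<in> space (use_space (N k) (r k) (g k)).
         min_dist_detect M (N k) (superpose S X n e) Q k
           (use_output M (N k) (r k) (U k) (\<sigma> k) (superpose S X n e s) \<omega>) \<noteq> msg k s} \<le> p n)"
    if k: "k \<in> {1,2}" for k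
  proof -
    obtain p where p: "p \<longlonglongrightarrow> 0" "\<And>n. 0 \<le> p n"
      "\<And>n Q e s. finite Q \<Longrightarrow> s \<in> Q \<Longrightarrow>
       (\<And>s t. s \<in> Q \<Longrightarrow> t \<in> Q \<Longrightarrow> msg k s \<noteq> msg k t \<Longrightarrow> \<exists>b\<in>Ow k. 1 \<le> cmod (e s b - e t b)) \<Longrightarrow>
       measure (use_space (N k) (r k) (g k)) {\<omega> \<in> space (use_space (N k) (r k) (g k)).
         min_dist_detect M (N k) (superpose S X n e) Q k
           (use_output M (N k) (r k) (U k) (\<sigma> k) (superpose S X n e s) \<omega>) \<noteq> msg k s} \<le> p n"
      by (rule detection_error_vanishes[OF c[OF k] S(3) Vis(1)[OF k] Vis(2)[OF k] invisible[OF k] rank[OF k]]) blast+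
    show ?thesis
    proof (intro exI[of _ p] conjI allI impI)
      fix n Q e s assume Q: "finite Q" "s \<in> Q"
        and "\<forall>s\<in>Q. \<forall>t\<in>Q. msg k s \<noteq> msg k t \<longrightarrow> (\<exists>b\<in>Ow k. 1 \<le> cmod (e s b - e t b :: complex))"
      then show "measure (use_space (N k) (r k) (g k)) {\<omega> \<in> space (use_space (N k) (r k) (g k)).
         min_dist_detect M (N k) (superpose S X n e) Q k
           (use_output M (N k) (r k) (U k) (\<sigma> k) (superpose S X n e s) \<omega>) \<noteq> msg k s} \<le> p n"
        by (intro p(3)) auto
    qed (use p in auto)
  qed
  then have "\<exists>p. \<forall>k\<in>{1,2}. p k \<longlonglongrightarrow> 0 \<and> (\<forall>n. 0 \<le> p k n) \<and> (\<forall>n Q e s. finite Q \<longrightarrow> s \<in> Q \<longrightarrow>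
       (\<forall>s\<in>Q. \<forall>t\<in>Q. msg k s \<noteq> msg k t \<longrightarrow> (\<exists>b\<in>Ow k. 1 \<le> cmod (e s b - e t b))) \<longrightarrow>
       measure (use_space (N k) (r k) (g k)) {\<omega> \<in> space (use_space (N k) (r k) (g k)).
         min_dist_detect M (N k) (superpose S X n e) Q k
           (use_output M (N k) (r k) (U k) (\<sigma> k) (superpose S X n e s) \<omega>) \<noteq> msg k s} \<le> p k n)"
    by (intro bchoice ballI)
  then obtain p :: "nat \<Rightarrow> nat \<Rightarrow> real" where p: "\<forall>k\<in>{1,2}. p k \<longlonglongrightarrow> 0 \<and> (\<forall>n. 0 \<le> p k n) \<and> (\<forall>n Q e s. finite Q \<longrightarrow> s \<in> Q \<longrightarrow>
       (\<forall>s\<in>Q. \<forall>t\<in>Q. msg k s \<noteq> msg k t \<longrightarrow> (\<exists>b\<in>Ow k. 1 \<le> cmod (e s b - e t b))) \<longrightarrow>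
       measure (use_space (N k) (r k) (g k)) {\<omega> \<in> space (use_space (N k) (r k) (g k)).
         min_dist_detect M (N k) (superpose S X n e) Q k
           (use_output M (N k) (r k) (U k) (\<sigma> k) (superpose S X n e s) \<omega>) \<noteq> msg k s} \<le> p k n)" ..
  have p0: "p k \<longlonglongrightarrow> 0" "0 \<le> p k n" if "k \<in> {1,2}" for k n
    using p that by blast+
  have err: "measure (use_space (N k) (r k) (g k)) {\<omega> \<in> space (use_space (N k) (r k) (g k)).
         min_dist_detect M (N k) (superpose S X n e) Q k
           (use_output M (N k) (r k) (U k) (\<sigma> k) (superpose S X n e s) \<omega>) \<noteq> msg k s} \<le> p 1 n + p 2 n"
    if k: "k \<in> {1,2}" and Q: "finite Q" "s \<in> Q"
      and e: "\<And>s t. s \<in> Q \<Longrightarrow> t \<in> Q \<Longrightarrow> msg k s \<noteq> msg k t \<Longrightarrow> \<exists>b\<in>Ow k. 1 \<le> cmod (e s b - e t b)" for k n Q e s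
  proof -
    have "measure (use_space (N k) (r k) (g k)) {\<omega> \<in> space (use_space (N k) (r k) (g k)).
         min_dist_detect M (N k) (superpose S X n e) Q k
           (use_output M (N k) (r k) (U k) (\<sigma> k) (superpose S X n e s) \<omega>) \<noteq> msg k s} \<le> p k n"
      by (rule p[THEN bspec, OF k, THEN conjunct2, THEN conjunct2, rule_format, OF Q]) (rule e)
    also have "p k n \<le> p 1 n + p 2 n" using k p0(2)[of 1 n] p0(2)[of 2 n] by auto
    finally show ?thesis .
  qed
  define C where "C = (\<Sum>m<M. (2 * (\<Sum>b\<in>S. cmod (X b m)))\<^sup>2)"
  \<comment> \<open>C collects the norms of the beams in the power bound; the 1 keeps D positive
    when there is no beam at all, since D is a divisor in the constellation size.\<close>
  define D where "D = sqrt (1 + C)"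
  have C0: "C \<ge> 0" unfolding C_def by (intro sum_nonneg) auto
  have D: "D > 0" "C \<le> D\<^sup>2" using C0 by (auto simp: D_def)
  define n where "n \<rho> = nat \<lfloor>ln \<rho>\<rfloor>" for \<rho> :: real
  define Q where "Q \<rho> = nat \<lfloor>sqrt \<rho> / (D * real (n \<rho>))\<rfloor>" for \<rho>
  note asym = qam_size_asymptotics[OF D(1), folded n_def, folded Q_def]
  define a where "a \<rho> = (ln (real ((Q \<rho> * Q \<rho>) ^ card (Ow 1))), ln (real ((Q \<rho> * Q \<rho>) ^ card (Ow 2))))" for \<rho>
  define P where "P \<rho> = p 1 (n \<rho>) + p 2 (n \<rho>)" for \<rho>
  have P0: "0 \<le> P \<rho>" for \<rho> using p0(2)[of 1] p0(2)[of 2] by (auto simp: P_def)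
  have Plim: "(P \<longlongrightarrow> 0) at_top"
    unfolding P_def using tendsto_add[OF filterlim_compose[OF p0(1)[of 1] asym(1)] filterlim_compose[OF p0(1)[of 2] asym(1)]]
    by simp
  have ev: "\<forall>\<^sub>F \<rho> in at_top. 0 \<le> P \<rho> \<and> a \<rho> \<in> scheme_rates M N r U \<sigma> g \<rho> (P \<rho>)"
    using asym(2,3)
  proof eventually_elim
    case (elim \<rho>)
    have "(real (n \<rho>) * real (Q \<rho>))\<^sup>2 * C \<le> (real (n \<rho>) * real (Q \<rho>))\<^sup>2 * D\<^sup>2"
      using D(2) by (intro mult_left_mono) auto
    also have "\<dots> \<le> \<rho>" using elim(2) by (simp add: power_mult_distrib)
    finally have power: "(real (n \<rho>) * real (Q \<rho>))\<^sup>2 * (\<Sum>m<M. (2 * (\<Sum>b\<in>S. cmod (X b m)))\<^sup>2) \<le> \<rho>"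
      by (simp add: C_def)
    obtain f F where "symbol_scheme M N r U \<sigma> g \<rho> (P \<rho>) (\<lambda>k. (Q \<rho> * Q \<rho>) ^ card (Ow k)) f F"
      unfolding P_def by (rule qam_symbol_scheme[OF S err elim(1) power])
    from scheme_rates_single[OF this] show ?case using P0 by (simp add: a_def)
  qed
  have lim: "((\<lambda>\<rho>. ln (real ((Q \<rho> * Q \<rho>) ^ m)) / ln \<rho>) \<longlongrightarrow> real m) at_top" for m :: nat
  proof -
    have "((\<lambda>\<rho>. real m * (2 * (ln (real (Q \<rho>)) / ln \<rho>))) \<longlongrightarrow> real m * (2 * (1 / 2))) at_top"
      by (intro tendsto_mult tendsto_const asym(4))
    moreover have "\<forall>\<^sub>F \<rho> in at_top. real m * (2 * (ln (real (Q \<rho>)) / ln \<rho>)) = ln (real ((Q \<rho> * Q \<rho>) ^ m)) / ln \<rho>"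
      using asym(2)
    proof eventually_elim
      case (elim \<rho>)
      then have "ln (real ((Q \<rho> * Q \<rho>) ^ m)) = real m * (2 * ln (real (Q \<rho>)))"
        by (simp add: ln_realpow ln_mult)
      then show ?case by simp
    qed
    ultimately have "((\<lambda>\<rho>. ln (real ((Q \<rho> * Q \<rho>) ^ m)) / ln \<rho>) \<longlongrightarrow> real m * (2 * (1 / 2))) at_top"
      by (rule Lim_transform_eventually)
    then show ?thesis by simp
  qed
  show ?thesis unfolding scheme_dofs_def
    using Plim ev lim[of "card (Ow 1)"] lim[of "card (Ow 2)"]
    by (auto simp: a_def intro!: exI[of _ a] exI[of _ P])
qed

text \<open>User \<open>k\<close> owns \<open>e\<^sub>k\<close> private and \<open>c\<^sub>k\<close> common streams; it decodes all common streams, unless it has no data.\<close>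

lemma stream_allocation_in_scheme_dofs:
  fixes N r :: "nat \<Rightarrow> nat"
  assumes c: "\<And>k. k \<in> {1,2} \<Longrightarrow> corr_user M (N k) (r k) (U k) (\<sigma> k) (g k)"
    and r0: "r0 = cdim (eigenspace M (r 1) (U 1) \<inter> eigenspace M (r 2) (U 2))"
    and priv: "e1 + r0 \<le> r 1" "e2 + r0 \<le> r 2" and common: "c1 + c2 \<le> r0"
    and decode: "e1 + c1 = 0 \<or> e1 + c1 + c2 \<le> N 1" "e2 + c2 = 0 \<or> e2 + c1 + c2 \<le> N 2"
  shows "(real (e1 + c1), real (e2 + c2)) \<in> scheme_dofs M N r U \<sigma> g"
proof -
  have on: "(\<Sum>i<M. cnj (U k (i, a)) * U k (i, b)) = (if a = b then 1 else 0)"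
    if "k \<in> {1,2}" "a < r k" "b < r k" for k a b
    using c[OF that(1)] that(2,3) by (auto simp: corr_user_def)
  obtain B0 :: "(nat \<Rightarrow> complex) set" and B X Y
    where fin: "finite B0" "\<And>k. k \<in> {1,2} \<Longrightarrow> finite (B k)"
    and disj: "\<And>k. k \<in> {1,2} \<Longrightarrow> B0 \<inter> B k = {}" "B 1 \<inter> B 2 = {}"
    and cardB0: "card B0 = cdim (eigenspace M (r 1) (U 1) \<inter> eigenspace M (r 2) (U 2))"
    and cardB: "\<And>k. k \<in> {1,2} \<Longrightarrow> card B0 + card (B k) = r k"
    and inv: "\<And>k b a. k \<in> {1,2} \<Longrightarrow> b \<in> (B 1 \<union> B 2) - B k \<Longrightarrow> a < r k \<Longrightarrow> (\<Sum>m<M. cnj (U k (m, a)) * X b m) = 0"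
    and dual: "\<And>k b b'. k \<in> {1,2} \<Longrightarrow> b \<in> B0 \<union> B k \<Longrightarrow> b' \<in> B0 \<union> B k \<Longrightarrow>
       (\<Sum>a<r k. Y k b' a * (\<Sum>m<M. cnj (U k (m, a)) * X b m)) = (if b' = b then 1 else 0)"
    by (rule beams_exist[OF on]) blast+
  have "c1 \<le> card B0" using common r0 cardB0 by simp
  then obtain C1 where C1: "C1 \<subseteq> B0" "card C1 = c1" "finite C1" by (rule obtain_subset_with_card_n)
  have "c2 \<le> card (B0 - C1)" using common r0 cardB0 C1 by (simp add: card_Diff_subset)
  then obtain C2 where C2: "C2 \<subseteq> B0 - C1" "card C2 = c2" "finite C2" by (rule obtain_subset_with_card_n)
  have "e1 \<le> card (B 1)" using priv r0 cardB0 cardB[of 1] by simp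
  then obtain T1 where T1: "T1 \<subseteq> B 1" "card T1 = e1" "finite T1" by (rule obtain_subset_with_card_n)
  have "e2 \<le> card (B 2)" using priv r0 cardB0 cardB[of 2] by simp
  then obtain T2 where T2: "T2 \<subseteq> B 2" "card T2 = e2" "finite T2" by (rule obtain_subset_with_card_n)
  define Ow where "Ow k = (if k = (1::nat) then T1 \<union> C1 else T2 \<union> C2)" for k
  \<comment> \<open>Each user sees its own private beams and the common beams of both owners, but
    not the private beams of the other user.\<close>
  define Vis where "Vis k = (if k = (1::nat) then T1 else T2) \<union> (C1 \<union> C2)" for k
  define S where "S = Ow 1 \<union> Ow 2"
  have d: "B0 \<inter> B 1 = {}" "B0 \<inter> B 2 = {}" using disj by auto
  have cOw: "card (Ow 1) = e1 + c1" "card (Ow 2) = e2 + c2"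
    using T1 T2 C1 C2 d unfolding Ow_def by (auto simp: card_Un_disjoint[symmetric] intro!: card_Un_disjoint)
  have cVis: "card (Vis 1) \<le> e1 + c1 + c2" "card (Vis 2) \<le> e2 + c1 + c2"
    using card_Un_le[of T1 "C1 \<union> C2"] card_Un_le[of T2 "C1 \<union> C2"] card_Un_le[of C1 C2] T1 T2 C1 C2
    by (auto simp: Vis_def)
  have VB: "Vis k \<subseteq> B0 \<union> B k" if "k \<in> {1,2}" for k
    using that T1 T2 C1 C2 by (auto simp: Vis_def)
  have "(real (card (Ow 1)), real (card (Ow 2))) \<in> scheme_dofs M N r U \<sigma> g"
  proof (rule streams_in_scheme_dofs[OF c S_def])
    show "Ow 1 \<inter> Ow 2 = {}" using T1 T2 C1 C2 d disj(2) by (auto simp: Ow_def)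
    show "finite S" using T1 T2 C1 C2 by (auto simp: S_def Ow_def)
    show "Ow k \<subseteq> Vis k" if "k \<in> {1,2}" for k by (auto simp: Ow_def Vis_def)
    show "Vis k \<subseteq> S" if "k \<in> {1,2}" for k using that by (auto simp: S_def Ow_def Vis_def)
    show "(\<Sum>m<M. cnj (U k (m, a)) * X b m) = 0" if "k \<in> {1,2}" "b \<in> S - Vis k" "a < r k" for k b a
    proof (rule inv[OF that(1) _ that(3)])
      show "b \<in> B 1 \<union> B 2 - B k" using that T1 T2 C1 C2 d disj(2) by (auto simp: S_def Ow_def Vis_def split: if_splits)
    qed
    show "Ow k = {} \<or> (card (Vis k) \<le> N k \<and> (\<forall>b\<in>Vis k. \<forall>b'\<in>Vis k.
        (\<Sum>a<r k. Y k b' a * (\<Sum>m<M. cnj (U k (m, a)) * X b m)) = (if b' = b then 1 else 0)))"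
      if k: "k \<in> {1,2}" for k
    proof -
      have "Ow k = {} \<or> card (Vis k) \<le> N k"
      proof (cases "k = 1")
        case True
        then show ?thesis using decode(1) cOw(1) cVis(1) T1 C1 by (auto simp: Ow_def)
      next
        case False
        with k have "k = 2" by simp
        then show ?thesis using decode(2) cOw(2) cVis(2) T2 C2 by (auto simp: Ow_def)
      qed
      then show ?thesis using dual[OF k] VB[OF k] by blast
    qed
  qed (use c in auto)
  then show ?thesis by (simp only: cOw)
qed

section \<open>The vertices of the hull\<close>

text \<open>Read off from the sizes of the beam families. It makes the truncated differences
  \<open>r k - r0\<close> true ones in the counts below.\<close>

lemma cdim_eigenspace_Int_le:
  fixes r :: "nat \<Rightarrow> nat" and U :: "nat \<Rightarrow> nat \<times> nat \<Rightarrow> complex"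
  assumes "\<And>k a b. k \<in> {1,2} \<Longrightarrow> a < r k \<Longrightarrow> b < r k \<Longrightarrow>
      (\<Sum>i<M. cnj (U k (i, a)) * U k (i, b)) = (if a = b then 1 else 0)" and k: "k \<in> {1,2}"
  shows "cdim (eigenspace M (r 1) (U 1) \<inter> eigenspace M (r 2) (U 2)) \<le> r k"
  by (rule beams_exist[OF assms(1)], assumption+) (metis k le_add1)

theorem theorem1:
  fixes M :: nat and N r :: "nat \<Rightarrow> nat" and U :: "nat \<Rightarrow> nat \<times> nat \<Rightarrow> complex"
    and \<sigma> :: "nat \<Rightarrow> nat \<Rightarrow> real" and g :: "nat \<Rightarrow> (nat \<times> nat \<Rightarrow> complex) \<Rightarrow> real"
  assumes "M \<ge> 1"
    and "corr_user M (N 1) (r 1) (U 1) (\<sigma> 1) (g 1)"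
    and "corr_user M (N 2) (r 2) (U 2) (\<sigma> 2) (g 2)"
  defines "r0 \<equiv> cdim (eigenspace M (r 1) (U 1) \<inter> eigenspace M (r 2) (U 2))"
    and "Ns \<equiv> (\<lambda>k. min (N k) (r k))"
  shows "convex hull
           ({(0, 0), (real (Ns 1), 0), (0, real (Ns 2)),
             (max 0 (real (Ns 1) - real r0), real (Ns 2)),
             (real (Ns 1), max 0 (real (Ns 2) - real r0))}
            \<union> (if N 1 \<le> r 1 \<and> N 2 \<le> r 2 then
                 {(min (real (N 1)) (real (r 1) - real r0)
                     + min (max 0 (real (N 1) - real (r 1) + real r0))
                           (max 0 (real (N 2) - real (r 2) + real r0)),
                   min (real (N 2)) (real (r 2) - real r0)),
                  (min (real (N 1)) (real (r 1) - real r0),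
                   min (real (N 2)) (real (r 2) - real r0)
                     + min (max 0 (real (N 1) - real (r 1) + real r0))
                           (max 0 (real (N 2) - real (r 2) + real r0)))}
               else {}))
         \<subseteq> dof_region M N r U \<sigma> g"
proof -
  have c: "corr_user M (N k) (r k) (U k) (\<sigma> k) (g k)" if "k \<in> {1,2}" for k
    using that assms(2,3) by auto
  note alloc = stream_allocation_in_scheme_dofs[of M N r U \<sigma> g r0, OF c r0_def[THEN meta_eq_to_obj_eq]]
  have r0: "r0 \<le> r k" if "k \<in> {1,2}" for k
    unfolding r0_def
    by (rule cdim_eigenspace_Int_le[OF _ that]) (use c in \<open>simp add: corr_user_def\<close>)
  note r0 = r0[of 1, simplified] r0[of 2, simplified]
  let ?D = "scheme_dofs M N r U \<sigma> g"
  have v0: "(0, 0) \<in> ?D" using alloc[of 0 0 0 0] r0 by simp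
  \<comment> \<open>User k fills its private beams, of which there are r_k - r0, before it takes
    common ones; the remainder is at most r0 because \<open>Ns k\<close> is at most r_k.\<close>
  have split: "min a b + (a - min a b) = a" for a b :: nat by simp
  have v1: "(real (Ns 1), 0) \<in> ?D"
  proof -
    have "(real (min (Ns 1) (r 1 - r0) + (Ns 1 - min (Ns 1) (r 1 - r0))), real (0 + 0)) \<in> ?D"
      by (rule alloc) (use r0 in \<open>auto simp: Ns_def\<close>)
    then show ?thesis unfolding split by simp
  qed
  have v2: "(0, real (Ns 2)) \<in> ?D"
  proof -
    have "(real (0 + 0), real (min (Ns 2) (r 2 - r0) + (Ns 2 - min (Ns 2) (r 2 - r0)))) \<in> ?D"
      by (rule alloc) (use r0 in \<open>auto simp: Ns_def\<close>)
    then show ?thesis unfolding split by simp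
  qed
  have v3: "(max 0 (real (Ns 1) - real r0), real (Ns 2)) \<in> ?D"
  proof -
    \<comment> \<open>User 1 stays with private beams and gives up r0 of its dimensions. If any
      stream is left to it, the at most r0 common streams of user 2 still fit among its
      \<open>N 1\<close> antennas.\<close>
    have "(real (Ns 1 - r0 + 0), real (min (Ns 2) (r 2 - r0) + (Ns 2 - min (Ns 2) (r 2 - r0)))) \<in> ?D"
      by (rule alloc) (use r0 in \<open>auto simp: Ns_def\<close>)
    moreover have "max 0 (real (Ns 1) - real r0) = real (Ns 1 - r0)" by (simp add: max_def of_nat_diff)
    ultimately show ?thesis unfolding split by simp
  qed
  have v4: "(real (Ns 1), max 0 (real (Ns 2) - real r0)) \<in> ?D"
  proof -
    have "(real (min (Ns 1) (r 1 - r0) + (Ns 1 - min (Ns 1) (r 1 - r0))), real (Ns 2 - r0 + 0)) \<in> ?D"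
      by (rule alloc) (use r0 in \<open>auto simp: Ns_def\<close>)
    moreover have "max 0 (real (Ns 2) - real r0) = real (Ns 2 - r0)" by (simp add: max_def of_nat_diff)
    ultimately show ?thesis unfolding split by simp
  qed
  define e where "e k = min (N k) (r k - r0)" for k
  \<comment> \<open>m counts the common streams: each user still has to resolve them with the
    antennas left over from its private streams. N_k \<le> r_k bounds m by r0, the number of common
    beams; and if one user has no antenna left, truncated subtraction gives m = 0.\<close>
  define m where "m = min (N 1 - (r 1 - r0)) (N 2 - (r 2 - r0))"
  have e: "min (real (N 1)) (real (r 1) - real r0) = real (e 1)" "min (real (N 2)) (real (r 2) - real r0) = real (e 2)"
    using r0 by (simp_all add: e_def of_nat_diff flip: of_nat_min)
  have m: "min (max 0 (real (N 1) - real (r 1) + real r0)) (max 0 (real (N 2) - real (r 2) + real r0)) = real m"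
    using r0 by (simp add: m_def max_def min_def of_nat_diff) linarith
  have v5: "(real (e 1 + m), real (e 2 + 0)) \<in> ?D" "(real (e 1 + 0), real (e 2 + m)) \<in> ?D"
    if "N 1 \<le> r 1" "N 2 \<le> r 2"
    by (rule alloc; use r0 that in \<open>auto simp: e_def m_def\<close>)+
  \<comment> \<open>The hull is taken on the level of symbol schemes, where convexity is available,
    before passing to \<open>dof_region\<close>.\<close>
  have "convex hull
           ({(0, 0), (real (Ns 1), 0), (0, real (Ns 2)),
             (max 0 (real (Ns 1) - real r0), real (Ns 2)),
             (real (Ns 1), max 0 (real (Ns 2) - real r0))}
            \<union> (if N 1 \<le> r 1 \<and> N 2 \<le> r 2 then
                 {(real (e 1) + real m, real (e 2)), (real (e 1), real (e 2) + real m)} else {})) \<subseteq> ?D"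
    using v0 v1 v2 v3 v4 v5 by (intro hull_minimal convex_scheme_dofs) auto
  also have "?D \<subseteq> dof_region M N r U \<sigma> g"
    by (rule scheme_dofs_subset_dof_region) (rule prob_space_use_space[OF c])
  finally show ?thesis unfolding e m .
qed

end
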